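(* Let $k>0$ and $l\ne0$ be coprime integers, and let $s\in\{0,1,\ldots,|l|-1\}$, $t\in\{0,1,\ldots,k-1\}$. Put $$F=\begin{pmatrix}0&I\\ I&0\end{pmatrix},\qquad \gamma=\begin{pmatrix}I&0\\0&-I\end{pmatrix}.$$ (1) If $l>0$, then $(\mathcal{V}_{s,t}\oplus\mathcal{V}_{s,t},\ \bar\pi_{s,t}:=\pi_{s,t}\oplus\pi_c,\ F,\ \gamma)$ is a 1-summable (even) Fredholm module over $\mathcal{O}(S^2_{pq}(k,l^+))$. (2) If $l<0$, then $(\mathcal{V}_s\oplus\mathcal{V}_t,\ \bar\pi^-_{s,t}:=\pi^{-1}_s\oplus\pi^{-2}_t,\ F,\ \gamma)$ is a 1-summable (even) Fredholm module over $\mathcal{O}(S^2_{pq}(k,l^-))$. The corresponding Chern characters $\tau^{+}_{s,t}$ (for $l>0$) and $\tau^-_{s,t}$ (for $l<0$) are given, for $\lambda\in\mathbb{N}$ and $\mu\in\mathbb{Z}$, by $$\tau^\pm_{s,t}(A^\lambda C_\pm^{\#\mu})=\begin{cases}\dfrac{p^{\lambda s}}{1-p^{\lambda|l|}}&\text{if }\mu=0,\ \lambda\ne0,\\ 0&\text{otherwise},\end{cases}\qquad \tau^\pm_{s,t}(B^\lambda C_\pm^{\#\mu})=\begin{cases}\dfrac{q^{\lambda t}}{1-q^{\lambda k}}&\text{if }\mu=0,\ \lambda\ne0,\\ 0&\text{otherwise}.\end{cases}$$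
   Context: $\mathbb{N}=\{0,1,2,\ldots\}$. Fix real numbers $0<p,q,\theta<1$ with $\theta$ irrational. $\mathcal{O}(S^3_{pq\theta})$ is the unital complex $*$-algebra generated by $a,b$ subject to $$ab=e^{2\pi i\theta}ba,\quad ab^*=e^{-2\pi i\theta}b^*a,\quad a^*a-paa^*=1-p,\quad b^*b-qbb^*=1-q,\quad (1-aa^* )(1-bb^* )=0.$$ Put $A=1-aa^*$, $B=1-bb^*$. For coprime integers $k>0$, $l\neq0$, the algebra $\mathcal{O}(S^2_{pq}(k,l^{\pm}))$ (sign $\pm$ = sign of $l$) is the fixed point algebra of the $\mathcal{O}(U(1))=\mathbb{C}[u,u^*]$-coaction ($uu^*=u^*u=1$, $u$ group-like) on $\mathcal{O}(S^3_{pq\theta})$ given by the $*$-algebra map $a\mapsto a\otimes u^k$, $b\mapsto b\otimes u^l$. It is generated as a $*$-algebra by $A$, $B$ and $C_\pm$, where $C_+=a^lb^{*k}$ for $l>0$ and $C_-=a^{*|l|}b^{*k}$ for $l<0$. Write $C_\pm^{\#\mu}=C_\pm^\mu$ for $\mu\ge0$ and $C_\pm^{\#\mu}=C_\pm^{*|\mu|}$ for $\mu<0$. Representations. For $m\in\mathbb{N}$ let $\mathcal{V}_m\cong\ell^2(\mathbb{N})$ be a Hilbert space with orthonormal basis $(e^m_n)_{n\in\mathbb{N}}$; all $\mathcal{V}_m$ are identified with each other via $e^m_n\leftrightarrow e^{m'}_n$. For $s=0,\ldots,|l|-1$ and $t=0,\ldots,k-1$ there are $*$-representations $\pi^{\pm1}_s$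 on $\mathcal{V}_s$ and $\pi^{\pm2}_t$ on $\mathcal{V}_t$ of $\mathcal{O}(S^2_{pq}(k,l^\pm))$ given by: $$\pi^{\pm1}_s(A)e^s_n=p^{n|l|+s}e^s_n,\quad \pi^{\pm1}_s(B)e^s_n=0,\quad \pi^1_s(C_+)e^s_n=\prod_{i=1}^{l}(1-p^{i+nl+s})^{1/2}e^s_{n+1},$$ $$\pi^{-1}_s(C_-)e^s_n=\prod_{i=1}^{|l|}(1-p^{i+(n-1)|l|+s})^{1/2}e^s_{n-1},$$ $$\pi^{\pm2}_t(A)e^t_n=0,\quad \pi^{\pm2}_t(B)e^t_n=q^{nk+t}e^t_n,\quad \pi^{\pm2}_t(C_\pm)e^t_n=\prod_{j=1}^{k}(1-q^{j+(n-1)k+t})^{1/2}e^t_{n-1}$$ (the coefficients of $e_{-1}$ vanish). For $l>0$, $\pi_{s,t}=\pi^1_s\oplus\pi^2_t$ acts on the Hilbert space $\mathcal{V}_{s,t}$ with orthonormal basis $f^{s,t}_m$, $m\in\mathbb{Z}$, where $f^{s,t}_m$ corresponds to $e^s_m$ for $m\ge0$ and to $e^t_{-m-1}$ for $m<0$. The representation $\pi_c$ on $\mathcal{V}_{s,t}$ (the integral over $|\lambda|=1$ of the one-dimensional representations $A,B\mapsto0$, $C_+\mapsto\lambda$) is given by $\pi_c(A)=\pi_c(B)=0$, $\pi_c(C_+^\mu)f^{s,t}_m=f^{s,t}_{m+\mu}$, $\pi_c(C_+^{*\mu})f^{s,t}_m=f^{s,t}_{m-\mu}$ for $m\in\mathbb{Z}$,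 $\mu\in\mathbb{N}$. An even Fredholm module over a $*$-algebra $\mathcal{A}$ is a quadruple $(\mathcal{V},\pi,F,\gamma)$ with $\pi$ a representation of $\mathcal{A}$ on the Hilbert space $\mathcal{V}$ and $F,\gamma$ operators on $\mathcal{V}$ such that $F^*=F$, $F^2=I$, $\gamma^2=I$, $\gamma F=-F\gamma$, and $[F,\pi(x)]$ is compact for all $x\in\mathcal{A}$. It is 1-summable if $[F,\pi(x)]$ is trace class for all $x\in\mathcal{A}$. The Chern character of the Fredholm modules in the claim is the functional $\tau^\pm_{s,t}(x)=\mathrm{Tr}(\gamma\bar\pi^{\pm}_{s,t}(x))$ (with $\bar\pi^+_{s,t}=\bar\pi_{s,t}$), where for $\bar\pi=\pi_+\oplus\pi_-$ on two identified Hilbert spaces this is understood as $\mathrm{Tr}(\pi_+(x)-\pi_-(x))$.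
   Formalization: For l<0, μ=0, λ≠0 the value of τ^-_{s,t}(B^λ) is proved to be -q^{λt}/(1-q^{λk}); the printed plus sign is false, since π^{-1}_s(B)=0 and B acts only through the subtracted representation π^{-2}_t. *)

theory Defs
  imports
    "HOL-Analysis.Analysis"
    "HOL-Library.Poly_Mapping"
    "HOL-Algebra.QuotRing"
    "HOL-Algebra.Module"
begin

section \<open>Complex Hilbert spaces and their operators\<close>

text \<open>The complex inner product is conjugate-linear in the first argument; its real part is the
  inner product of the underlying real Hilbert space, which supplies norm and topology.\<close>

class chilbert_space = real_inner + complete_space +
  fixes scaleC :: "complex \<Rightarrow> 'a \<Rightarrow> 'a"  (infixr \<open>*\<^sub>C\<close> 75)
    and cinner :: "'a \<Rightarrow> 'a \<Rightarrow> complex"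
  assumes scaleC_add_right: "c *\<^sub>C (x + y) = c *\<^sub>C x + c *\<^sub>C y"
    and scaleC_add_left: "(c + d) *\<^sub>C x = c *\<^sub>C x + d *\<^sub>C x"
    and scaleC_scaleC: "c *\<^sub>C (d *\<^sub>C x) = (c * d) *\<^sub>C x"
    and scaleC_of_real: "complex_of_real r *\<^sub>C x = r *\<^sub>R x"
    and cinner_commute: "cinner x y = cnj (cinner y x)"
    and cinner_add_right: "cinner x (y + z) = cinner x y + cinner x z"
    and cinner_scaleC_right: "cinner x (c *\<^sub>C y) = c * cinner x y"
    and Re_cinner: "Re (cinner x y) = inner x y"

instantiation prod :: (chilbert_space, chilbert_space) chilbert_space
begin

definition scaleC_prod :: "complex \<Rightarrow> 'a \<times> 'b \<Rightarrow> 'a \<times> 'b" where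
  "scaleC_prod c v = (c *\<^sub>C fst v, c *\<^sub>C snd v)"

definition cinner_prod :: "'a \<times> 'b \<Rightarrow> 'a \<times> 'b \<Rightarrow> complex" where
  "cinner_prod v w = cinner (fst v) (fst w) + cinner (snd v) (snd w)"

instance
proof
  fix c d :: complex and r :: real and x y z :: "'a \<times> 'b"
  show "c *\<^sub>C (x + y) = c *\<^sub>C x + c *\<^sub>C y"
    by (simp add: scaleC_prod_def scaleC_add_right)
  show "(c + d) *\<^sub>C x = c *\<^sub>C x + d *\<^sub>C x"
    by (simp add: scaleC_prod_def scaleC_add_left)
  show "c *\<^sub>C (d *\<^sub>C x) = (c * d) *\<^sub>C x"
    by (simp add: scaleC_prod_def scaleC_scaleC)
  show "complex_of_real r *\<^sub>C x = r *\<^sub>R x"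
    by (simp add: scaleC_prod_def scaleC_of_real scaleR_prod_def)
  show "cinner x y = cnj (cinner y x)"
    unfolding cinner_prod_def complex_cnj_add
    by (simp add: cinner_commute[symmetric])
  show "cinner x (y + z) = cinner x y + cinner x z"
    by (simp add: cinner_prod_def cinner_add_right)
  show "cinner x (c *\<^sub>C y) = c * cinner x y"
    by (simp add: cinner_prod_def scaleC_prod_def cinner_scaleC_right distrib_left)
  show "Re (cinner x y) = inner x y"
    by (simp add: cinner_prod_def Re_cinner inner_prod_def)
qed

end

definition bounded_clinear :: "('h::chilbert_space \<Rightarrow> 'h) \<Rightarrow> bool" where
  "bounded_clinear T \<longleftrightarrow> bounded_linear T \<and> (\<forall>c x. T (c *\<^sub>C x) = c *\<^sub>C T x)"

definition compact_operator :: "('h::chilbert_space \<Rightarrow> 'h) \<Rightarrow> bool" where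
  "compact_operator T \<longleftrightarrow> bounded_clinear T \<and> compact (closure (T ` cball 0 1))"

text \<open>Trace class operators, defined as the nuclear operators
  \<open>T = \<Sum>n. |x\<^sub>n\<rangle>\<langle>y\<^sub>n|\<close> with \<open>\<Sum>n. \<parallel>x\<^sub>n\<parallel> \<parallel>y\<^sub>n\<parallel> < \<infinity>\<close>.\<close>

definition trace_class :: "('h::chilbert_space \<Rightarrow> 'h) \<Rightarrow> bool" where
  "trace_class T \<longleftrightarrow> bounded_clinear T \<and>
     (\<exists>(x :: nat \<Rightarrow> 'h) (y :: nat \<Rightarrow> 'h). summable (\<lambda>n. norm (x n) * norm (y n)) \<and>
        (\<forall>v. (\<lambda>n. cinner (y n) v *\<^sub>C x n) sums T v))"

definition orthonormal_basis :: "'h::chilbert_space set \<Rightarrow> bool" where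
  "orthonormal_basis E \<longleftrightarrow>
     (\<forall>x\<in>E. \<forall>y\<in>E. cinner x y = (if x = y then 1 else 0)) \<and>
     closure (span (\<Union>c. scaleC c ` E)) = UNIV"

text \<open>For a trace class operator the sum converges absolutely and does not depend on the chosen
  orthonormal basis.\<close>

definition op_trace :: "('h::chilbert_space \<Rightarrow> 'h) \<Rightarrow> complex" where
  "op_trace T = (\<Sum>\<^sub>\<infinity>e\<in>(SOME E. orthonormal_basis E). cinner e (T e))"


section \<open>Unital complex *-algebras\<close>

record 'a star_alg = "(complex, 'a) module" +
  star :: "'a \<Rightarrow> 'a"

definition star_hom :: "('a, 'm) star_alg_scheme \<Rightarrow> ('b, 'n) star_alg_scheme \<Rightarrow> ('a \<Rightarrow> 'b) \<Rightarrow> bool" where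
  "star_hom R S \<phi> \<longleftrightarrow>
     \<phi> \<in> carrier R \<rightarrow> carrier S \<and>
     \<phi> \<one>\<^bsub>R\<^esub> = \<one>\<^bsub>S\<^esub> \<and>
     (\<forall>x\<in>carrier R. \<forall>y\<in>carrier R. \<phi> (x \<oplus>\<^bsub>R\<^esub> y) = \<phi> x \<oplus>\<^bsub>S\<^esub> \<phi> y) \<and>
     (\<forall>x\<in>carrier R. \<forall>y\<in>carrier R. \<phi> (x \<otimes>\<^bsub>R\<^esub> y) = \<phi> x \<otimes>\<^bsub>S\<^esub> \<phi> y) \<and>
     (\<forall>c. \<forall>x\<in>carrier R. \<phi> (c \<odot>\<^bsub>R\<^esub> x) = c \<odot>\<^bsub>S\<^esub> \<phi> x) \<and>
     (\<forall>x\<in>carrier R. \<phi> (star R x) = star S (\<phi> x))"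

definition star_rep :: "('a, 'm) star_alg_scheme \<Rightarrow> ('a \<Rightarrow> 'h::chilbert_space \<Rightarrow> 'h) \<Rightarrow> bool" where
  "star_rep R \<pi> \<longleftrightarrow>
     (\<forall>x\<in>carrier R. bounded_clinear (\<pi> x)) \<and>
     \<pi> \<one>\<^bsub>R\<^esub> = id \<and>
     (\<forall>x\<in>carrier R. \<forall>y\<in>carrier R. \<pi> (x \<oplus>\<^bsub>R\<^esub> y) = (\<lambda>v. \<pi> x v + \<pi> y v)) \<and>
     (\<forall>x\<in>carrier R. \<forall>y\<in>carrier R. \<pi> (x \<otimes>\<^bsub>R\<^esub> y) = \<pi> x \<circ> \<pi> y) \<and>
     (\<forall>c. \<forall>x\<in>carrier R. \<pi> (c \<odot>\<^bsub>R\<^esub> x) = (\<lambda>v. c *\<^sub>C \<pi> x v)) \<and>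
     (\<forall>x\<in>carrier R. \<forall>v w. cinner (\<pi> (star R x) v) w = cinner v (\<pi> x w))"

definition rep_sum ::
    "('a \<Rightarrow> 'h \<Rightarrow> 'h) \<Rightarrow> ('a \<Rightarrow> 'g \<Rightarrow> 'g) \<Rightarrow> 'a \<Rightarrow> 'h \<times> 'g \<Rightarrow> 'h \<times> 'g" where
  "rep_sum \<pi> \<sigma> x = (\<lambda>(v, w). (\<pi> x v, \<sigma> x w))"

text \<open>The quotient by a two-sided ideal that is stable under the involution.\<close>

definition quot_star_alg :: "('a, 'm) star_alg_scheme \<Rightarrow> 'a set \<Rightarrow> 'a set star_alg" where
  "quot_star_alg R J =
     \<lparr>carrier = carrier (R Quot J), mult = mult (R Quot J), one = one (R Quot J),
      zero = zero (R Quot J), add = add (R Quot J),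
      smult = (\<lambda>c X. \<Union>x\<in>X. J +>\<^bsub>R\<^esub> (c \<odot>\<^bsub>R\<^esub> x)),
      star = (\<lambda>X. star R ` X)\<rparr>"

text \<open>The tensor product of \<open>R\<close> with the Hopf *-algebra \<open>\<O>(U(1)) = \<complex>[u,u\<^sup>*]\<close>.  A finitely supported
  function \<open>f\<close> on the integers stands for \<open>\<Sum>n. f n \<otimes> u\<^sup>n\<close>, where \<open>u\<^sup>-\<^sup>1 = u\<^sup>*\<close>.\<close>

definition tensor_U1 :: "('a, 'm) star_alg_scheme \<Rightarrow> (int \<Rightarrow> 'a) star_alg" where
  "tensor_U1 R =
     \<lparr>carrier = {f. (\<forall>n. f n \<in> carrier R) \<and> finite {n. f n \<noteq> \<zero>\<^bsub>R\<^esub>}},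
      mult = (\<lambda>f g n. \<Oplus>\<^bsub>R\<^esub>i\<in>{i. f i \<noteq> \<zero>\<^bsub>R\<^esub>}. f i \<otimes>\<^bsub>R\<^esub> g (n - i)),
      one = (\<lambda>n. if n = 0 then \<one>\<^bsub>R\<^esub> else \<zero>\<^bsub>R\<^esub>),
      zero = (\<lambda>n. \<zero>\<^bsub>R\<^esub>),
      add = (\<lambda>f g n. f n \<oplus>\<^bsub>R\<^esub> g n),
      smult = (\<lambda>c f n. c \<odot>\<^bsub>R\<^esub> f n),
      star = (\<lambda>f n. star R (f (- n)))\<rparr>"

definition tensor_u :: "('a, 'm) star_alg_scheme \<Rightarrow> 'a \<Rightarrow> int \<Rightarrow> (int \<Rightarrow> 'a)" where
  "tensor_u R x n = (\<lambda>m. if m = n then x else \<zero>\<^bsub>R\<^esub>)"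


section \<open>The free *-algebra on two generators\<close>

datatype gen = GenA | GenB

text \<open>A letter is a generator together with a flag telling whether it is starred.\<close>

datatype star_word = Star_Word (letters: "(gen \<times> bool) list")

instantiation star_word :: monoid_add
begin

definition zero_star_word :: star_word where
  "zero_star_word = Star_Word []"

definition plus_star_word :: "star_word \<Rightarrow> star_word \<Rightarrow> star_word" where
  "plus_star_word v w = Star_Word (letters v @ letters w)"

instance
  by standard (simp_all add: zero_star_word_def plus_star_word_def)

end

definition word_star :: "star_word \<Rightarrow> star_word" where
  "word_star w = Star_Word (rev (map (\<lambda>(g, s). (g, \<not> s)) (letters w)))"

type_synonym free_elem = "star_word \<Rightarrow>\<^sub>0 complex"

definition scalar :: "complex \<Rightarrow> free_elem" where
  "scalar c = Poly_Mapping.single 0 c"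

definition letter :: "gen \<Rightarrow> bool \<Rightarrow> free_elem" where
  "letter g s = Poly_Mapping.single (Star_Word [(g, s)]) 1"

definition free_star :: "free_elem \<Rightarrow> free_elem" where
  "free_star x = (\<Sum>w\<in>Poly_Mapping.keys x.
     Poly_Mapping.single (word_star w) (cnj (Poly_Mapping.lookup x w)))"

definition free_star_alg :: "free_elem star_alg" where
  "free_star_alg =
     \<lparr>carrier = UNIV, mult = (*), one = 1, zero = 0, add = (+),
      smult = (\<lambda>c x. scalar c * x), star = free_star\<rparr>"


section \<open>The quantum 3-sphere\<close>

text \<open>Differences of the two sides of the defining relations.\<close>

definition S3_relators :: "real \<Rightarrow> real \<Rightarrow> real \<Rightarrow> free_elem set" where
  "S3_relators p q \<theta> =
     (let a = letter GenA False; a' = letter GenA True;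
          b = letter GenB False; b' = letter GenB True
      in {a * b - scalar (exp (2 * pi * \<i> * \<theta>)) * b * a,
          a * b' - scalar (exp (- (2 * pi * \<i> * \<theta>))) * b' * a,
          a' * a - scalar p * a * a' - scalar (1 - p),
          b' * b - scalar q * b * b' - scalar (1 - q),
          (1 - a * a') * (1 - b * b')})"

definition S3_ideal :: "real \<Rightarrow> real \<Rightarrow> real \<Rightarrow> free_elem set" where
  "S3_ideal p q \<theta> =
     Idl\<^bsub>free_star_alg\<^esub> (S3_relators p q \<theta> \<union> free_star ` S3_relators p q \<theta>)"

definition S3 :: "real \<Rightarrow> real \<Rightarrow> real \<Rightarrow> free_elem set star_alg" where
  "S3 p q \<theta> = quot_star_alg free_star_alg (S3_ideal p q \<theta>)"

definition S3_a :: "real \<Rightarrow> real \<Rightarrow> real \<Rightarrow> free_elem set" where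
  "S3_a p q \<theta> = S3_ideal p q \<theta> +>\<^bsub>free_star_alg\<^esub> letter GenA False"

definition S3_b :: "real \<Rightarrow> real \<Rightarrow> real \<Rightarrow> free_elem set" where
  "S3_b p q \<theta> = S3_ideal p q \<theta> +>\<^bsub>free_star_alg\<^esub> letter GenB False"


section \<open>The quantum weighted spheres as fixed point algebras\<close>

definition U1_coaction ::
    "real \<Rightarrow> real \<Rightarrow> real \<Rightarrow> nat \<Rightarrow> int \<Rightarrow> (free_elem set \<Rightarrow> int \<Rightarrow> free_elem set) \<Rightarrow> bool" where
  "U1_coaction p q \<theta> k l \<rho> \<longleftrightarrow>
     star_hom (S3 p q \<theta>) (tensor_U1 (S3 p q \<theta>)) \<rho> \<and>
     \<rho> (S3_a p q \<theta>) = tensor_u (S3 p q \<theta>) (S3_a p q \<theta>) (int k) \<and>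
     \<rho> (S3_b p q \<theta>) = tensor_u (S3 p q \<theta>) (S3_b p q \<theta>) l"

definition fixed_point_alg ::
    "'a star_alg \<Rightarrow> ('a \<Rightarrow> int \<Rightarrow> 'a) \<Rightarrow> 'a star_alg" where
  "fixed_point_alg R \<rho> = R\<lparr>carrier := {x \<in> carrier R. \<rho> x = tensor_u R x 0}\<rparr>"

definition S2_A :: "real \<Rightarrow> real \<Rightarrow> real \<Rightarrow> free_elem set" where
  "S2_A p q \<theta> = (let R = S3 p q \<theta>; a = S3_a p q \<theta> in \<one>\<^bsub>R\<^esub> \<ominus>\<^bsub>R\<^esub> a \<otimes>\<^bsub>R\<^esub> star R a)"

definition S2_B :: "real \<Rightarrow> real \<Rightarrow> real \<Rightarrow> free_elem set" where
  "S2_B p q \<theta> = (let R = S3 p q \<theta>; b = S3_b p q \<theta> in \<one>\<^bsub>R\<^esub> \<ominus>\<^bsub>R\<^esub> b \<otimes>\<^bsub>R\<^esub> star R b)"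

definition S2_C :: "real \<Rightarrow> real \<Rightarrow> real \<Rightarrow> nat \<Rightarrow> int \<Rightarrow> free_elem set" where
  "S2_C p q \<theta> k l =
     (let R = S3 p q \<theta>; a = S3_a p q \<theta>; b = S3_b p q \<theta> in
      (if l > 0 then a else star R a) [^]\<^bsub>R\<^esub> nat \<bar>l\<bar> \<otimes>\<^bsub>R\<^esub> star R b [^]\<^bsub>R\<^esub> k)"

definition sharp_power :: "'a star_alg \<Rightarrow> 'a \<Rightarrow> int \<Rightarrow> 'a" where
  "sharp_power R x \<mu> = (if \<mu> \<ge> 0 then x [^]\<^bsub>R\<^esub> nat \<mu> else star R x [^]\<^bsub>R\<^esub> nat \<bar>\<mu>\<bar>)"


section \<open>The representations\<close>

text \<open>In the following definitions \<open>R\<close> is a *-algebra with elements \<open>A\<close>, \<open>B\<close> and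
  \<open>C = C\<^sub>\<plusminus>\<close> (according to the sign of \<open>l\<close>), and \<open>e\<close> is the orthonormal basis common to the mutually
  identified Hilbert spaces.  The exponent \<open>i + (n - 1) |l| + s\<close> is only used for \<open>n > 0\<close>.\<close>

definition is_pi1 ::
    "'a star_alg \<Rightarrow> 'a \<Rightarrow> 'a \<Rightarrow> 'a \<Rightarrow> real \<Rightarrow> int \<Rightarrow> nat \<Rightarrow> (nat \<Rightarrow> 'h::chilbert_space)
      \<Rightarrow> ('a \<Rightarrow> 'h \<Rightarrow> 'h) \<Rightarrow> bool" where
  "is_pi1 R A B C p l s e \<pi> \<longleftrightarrow>
     star_rep R \<pi> \<and>
     (\<forall>n. \<pi> A (e n) = p ^ (n * nat \<bar>l\<bar> + s) *\<^sub>R e n) \<and>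
     (\<forall>n. \<pi> B (e n) = 0) \<and>
     (l > 0 \<longrightarrow> (\<forall>n. \<pi> C (e n) =
        (\<Prod>i=1..nat l. sqrt (1 - p ^ (i + n * nat l + s))) *\<^sub>R e (n + 1))) \<and>
     (l < 0 \<longrightarrow> (\<forall>n. \<pi> C (e n) =
        (if n = 0 then 0
         else (\<Prod>i=1..nat \<bar>l\<bar>. sqrt (1 - p ^ (i + (n - 1) * nat \<bar>l\<bar> + s))) *\<^sub>R e (n - 1))))"

definition is_pi2 ::
    "'a star_alg \<Rightarrow> 'a \<Rightarrow> 'a \<Rightarrow> 'a \<Rightarrow> real \<Rightarrow> nat \<Rightarrow> nat \<Rightarrow> (nat \<Rightarrow> 'h::chilbert_space)
      \<Rightarrow> ('a \<Rightarrow> 'h \<Rightarrow> 'h) \<Rightarrow> bool" where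
  "is_pi2 R A B C q k t e \<pi> \<longleftrightarrow>
     star_rep R \<pi> \<and>
     (\<forall>n. \<pi> A (e n) = 0) \<and>
     (\<forall>n. \<pi> B (e n) = q ^ (n * k + t) *\<^sub>R e n) \<and>
     (\<forall>n. \<pi> C (e n) =
        (if n = 0 then 0
         else (\<Prod>j=1..k. sqrt (1 - q ^ (j + (n - 1) * k + t))) *\<^sub>R e (n - 1)))"

text \<open>The basis \<open>(f\<^sub>m)\<close> of \<open>\<V>\<^sub>s \<oplus> \<V>\<^sub>t\<close>, indexed by the integers.\<close>

definition basis_Z :: "(nat \<Rightarrow> 'h::chilbert_space) \<Rightarrow> int \<Rightarrow> 'h \<times> 'h" where
  "basis_Z e m = (if m \<ge> 0 then (e (nat m), 0) else (0, e (nat (- m - 1))))"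

definition is_pic ::
    "'a star_alg \<Rightarrow> 'a \<Rightarrow> 'a \<Rightarrow> 'a \<Rightarrow> (int \<Rightarrow> 'g::chilbert_space) \<Rightarrow> ('a \<Rightarrow> 'g \<Rightarrow> 'g) \<Rightarrow> bool" where
  "is_pic R A B C f \<pi> \<longleftrightarrow>
     star_rep R \<pi> \<and>
     \<pi> A = (\<lambda>v. 0) \<and> \<pi> B = (\<lambda>v. 0) \<and>
     (\<forall>(\<mu>::nat) m. \<pi> (C [^]\<^bsub>R\<^esub> \<mu>) (f m) = f (m + int \<mu>)) \<and>
     (\<forall>(\<mu>::nat) m. \<pi> (star R C [^]\<^bsub>R\<^esub> \<mu>) (f m) = f (m - int \<mu>))"


section \<open>Fredholm modules\<close>

definition commutator :: "('h::ab_group_add \<Rightarrow> 'h) \<Rightarrow> ('h \<Rightarrow> 'h) \<Rightarrow> 'h \<Rightarrow> 'h" where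
  "commutator S T = (\<lambda>v. S (T v) - T (S v))"

definition even_fredholm_module ::
    "'a star_alg \<Rightarrow> ('a \<Rightarrow> 'h::chilbert_space \<Rightarrow> 'h) \<Rightarrow> ('h \<Rightarrow> 'h) \<Rightarrow> ('h \<Rightarrow> 'h) \<Rightarrow> bool" where
  "even_fredholm_module R \<pi> F \<gamma> \<longleftrightarrow>
     star_rep R \<pi> \<and> bounded_clinear F \<and> bounded_clinear \<gamma> \<and>
     (\<forall>v w. cinner (F v) w = cinner v (F w)) \<and>
     F \<circ> F = id \<and> \<gamma> \<circ> \<gamma> = id \<and> (\<forall>v. \<gamma> (F v) = - F (\<gamma> v)) \<and>
     (\<forall>x\<in>carrier R. compact_operator (commutator F (\<pi> x)))"

definition one_summable ::
    "'a star_alg \<Rightarrow> ('a \<Rightarrow> 'h::chilbert_space \<Rightarrow> 'h) \<Rightarrow> ('h \<Rightarrow> 'h) \<Rightarrow> bool" where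
  "one_summable R \<pi> F \<longleftrightarrow> (\<forall>x\<in>carrier R. trace_class (commutator F (\<pi> x)))"

definition flip_op :: "'h \<times> 'h \<Rightarrow> 'h \<times> 'h" where
  "flip_op = (\<lambda>(v, w). (w, v))"

definition grading_op :: "'h \<times> 'h \<Rightarrow> 'h \<times> 'h::uminus" where
  "grading_op = (\<lambda>(v, w). (v, - w))"

text \<open>\<open>Tr (\<gamma> (\<pi>\<^sub>+ \<oplus> \<pi>\<^sub>-)(x))\<close>, read as \<open>Tr (\<pi>\<^sub>+(x) - \<pi>\<^sub>-(x))\<close>: in general the two diagonal blocks
  are not separately of trace class.  For \<open>l < 0\<close> the element \<open>B\<close> acts nontrivially only through
  \<open>\<pi>\<^sub>- = \<pi>\<^sup>-\<^sup>2\<^sub>t\<close>, so powers of \<open>B\<close> have negative trace in that case.\<close>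

definition chern_character ::
    "('a \<Rightarrow> 'h::chilbert_space \<Rightarrow> 'h) \<Rightarrow> ('a \<Rightarrow> 'h \<Rightarrow> 'h) \<Rightarrow> 'a \<Rightarrow> complex" where
  "chern_character \<pi>p \<pi>m x = op_trace (\<lambda>v. \<pi>p x v - \<pi>m x v)"

end

theory Submission
  imports Defs
begin

text \<open>
Both Fredholm modules rest on one fact: for every \<open>x\<close> in the fixed point algebra the difference
\<open>D(x) = \<pi>\<^sub>+(x) - \<pi>\<^sub>-(x)\<close> of the two diagonal representations is of trace class.  The commutator of
\<open>\<pi>\<^sub>+(x) \<oplus> \<pi>\<^sub>-(x)\<close> with the flip has \<open>\<plusminus> D(x)\<close> off the diagonal and zeros on it, so it is then trace
class, hence compact (\<open>fredholm_module_of_trace_class_difference\<close>).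

Since \<open>D(xy) = D(x) \<pi>\<^sub>+(y) + \<pi>\<^sub>-(x) D(y)\<close> and \<open>D(x\<^sup>*) = D(x)\<^sup>*\<close>, the elements with trace class
difference form a *-subalgebra, and it suffices to treat the generators \<open>A\<close>, \<open>B\<close>, \<open>C\<close>.  There the
difference is given by explicit weights on the basis: \<open>A\<close> and \<open>B\<close> have geometrically decaying
eigenvalues or act as zero, and the weights of \<open>C\<close> differ from \<open>1\<close> by a geometrically decaying
amount, so that both representations send \<open>C\<close> to the same shift up to summable errors, apart from
a single basis vector when \<open>l > 0\<close> (\<open>trace_class_difference_pos\<close>, \<open>trace_class_difference_neg\<close>).

That \<open>A\<close>, \<open>B\<close>, \<open>C\<close>, \<open>C\<^sup>*\<close> generate the fixed point algebra (\<open>fixed_point_induct\<close>) follows from the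
grading by \<open>U(1)\<close>.  A fixed point equals its own component of degree zero and is therefore a
combination of words in \<open>a, a\<^sup>*, b, b\<^sup>*\<close> of total weight zero.  As the \<open>a\<close>'s commute with the \<open>b\<close>'s up
to phases, and \<open>a a\<^sup>*\<close>, \<open>a\<^sup>* a\<close>, \<open>b b\<^sup>*\<close>, \<open>b\<^sup>* b\<close> are polynomials in \<open>A\<close> and \<open>B\<close>, each word is congruent to
\<open>f(A, B) a\<^sup>#\<^sup>m b\<^sup>#\<^sup>n\<close>, where \<open>m\<close> and \<open>n\<close> count letters with sign.  If \<open>k m + l n = 0\<close> with \<open>k, l\<close> coprime,
then \<open>m = l j\<close> and \<open>n = - k j\<close>, and \<open>a\<^sup>#\<^sup>m b\<^sup>#\<^sup>n\<close> is up to a phase a power of \<open>C\<close> or of \<open>C\<^sup>*\<close>.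

For the Chern characters, the trace of a nuclear operator may be computed in any orthonormal basis
(\<open>op_trace_eqI\<close>).  In the given basis \<open>A\<close> and \<open>B\<close> are diagonal while \<open>C\<close> and \<open>C\<^sup>*\<close> shift the index, so
the diagonal of \<open>A\<^sup>n C\<^sup>#\<^sup>\<mu>\<close> vanishes for \<open>\<mu> \<noteq> 0\<close>, and for \<open>\<mu> = 0 < n\<close> the trace is a geometric series.
For \<open>n = \<mu> = 0\<close> the two identity operators cancel.
\<close>

section \<open>Complex inner products\<close>

lemma cinner_add_left: "cinner (x + y) z = cinner x z + cinner y z"
  by (metis cinner_add_right cinner_commute complex_cnj_add)

lemma cinner_scaleC_left: "cinner (c *\<^sub>C x) y = cnj c * cinner x y"
  by (metis cinner_scaleC_right cinner_commute complex_cnj_mult)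

lemma cinner_zero_right [simp]: "cinner x 0 = 0"
  using cinner_add_right[of x 0 0] by simp

lemma cinner_zero_left [simp]: "cinner 0 x = 0"
  using cinner_add_left[of 0 0 x] by simp

lemma cinner_minus_right: "cinner x (- y) = - cinner x y"
  using cinner_add_right[of x y "- y"] by (simp add: add_eq_0_iff)

lemma cinner_diff_right: "cinner x (y - z) = cinner x y - cinner x z"
  using cinner_add_right[of x y "- z"] by (simp add: cinner_minus_right)

lemma cinner_diff_left: "cinner (x - y) z = cinner x z - cinner y z"
  by (metis cinner_diff_right cinner_commute complex_cnj_diff)

lemma cinner_scaleR_right: "cinner x (r *\<^sub>R y) = r * cinner x y"
  by (metis cinner_scaleC_right scaleC_of_real)

lemma cinner_scaleR_left: "cinner (r *\<^sub>R x) y = r * cinner x y"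
  by (metis cinner_scaleC_left scaleC_of_real complex_cnj_complex_of_real)

lemma cinner_sum_right: "cinner x (sum f S) = (\<Sum>i\<in>S. cinner x (f i))"
  by (induction S rule: infinite_finite_induct) (simp_all add: cinner_add_right)

lemma cinner_sum_left: "cinner (sum f S) x = (\<Sum>i\<in>S. cinner (f i) x)"
  by (induction S rule: infinite_finite_induct) (simp_all add: cinner_add_left)

lemma cinner_self: "cinner x x = complex_of_real ((norm x)\<^sup>2)"
proof -
  have "Im (cinner x x) = 0"
    using cinner_commute[of x x] by (simp add: complex_eq_iff)
  moreover have "Re (cinner x x) = (norm x)\<^sup>2"
    by (simp add: Re_cinner power2_norm_eq_inner)
  ultimately show ?thesis by (simp add: complex_eq_iff)
qed

lemma scaleC_zero_right [simp]: "c *\<^sub>C (0::'h::chilbert_space) = 0"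
  using scaleC_add_right[of c "0::'h" 0] by simp

lemma scaleC_zero_left [simp]: "0 *\<^sub>C (x::'h::chilbert_space) = 0"
  using scaleC_add_left[of 0 0 x] by simp

lemma scaleC_one [simp]: "1 *\<^sub>C (x::'h::chilbert_space) = x"
  using scaleC_of_real[of 1 x] by simp

lemma scaleC_minus_right: "c *\<^sub>C (- x) = - (c *\<^sub>C (x::'h::chilbert_space))"
  using scaleC_add_right[of c x "- x"] by (simp add: add_eq_0_iff)

lemma scaleC_diff_right: "c *\<^sub>C (x - y) = c *\<^sub>C x - c *\<^sub>C (y::'h::chilbert_space)"
  using scaleC_add_right[of c x "- y"] by (simp add: scaleC_minus_right)

lemma norm_scaleC [simp]: "norm (c *\<^sub>C x) = cmod c * norm (x::'h::chilbert_space)"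
proof -
  have "complex_of_real ((norm (c *\<^sub>C x))\<^sup>2) = cnj c * c * cinner x x"
    unfolding cinner_self[symmetric] by (simp add: cinner_scaleC_left cinner_scaleC_right)
  also have "\<dots> = complex_of_real ((cmod c * norm x)\<^sup>2)"
    unfolding cinner_self power_mult_distrib of_real_mult complex_norm_square by simp
  finally show ?thesis
    unfolding of_real_eq_iff by simp
qed

text \<open>Rotating \<open>y\<close> by a phase makes the inner product real and reduces the complex Cauchy--Schwarz
  inequality to the real one.\<close>

lemma norm_cinner_le: "cmod (cinner x y) \<le> norm x * norm y"
proof (cases "cinner x y = 0")
  case False
  define c where "c = cnj (sgn (cinner x y))"
  have c: "cmod c = 1" using False by (simp add: c_def norm_sgn)
  have "cinner x (c *\<^sub>C y) = cinner x y * cnj (cinner x y) / complex_of_real (cmod (cinner x y))"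
    by (simp add: cinner_scaleC_right c_def sgn_eq)
  also have "\<dots> = complex_of_real (cmod (cinner x y))"
    unfolding complex_norm_square[symmetric] using False by (simp add: power2_eq_square)
  finally have "cinner x (c *\<^sub>C y) = complex_of_real (cmod (cinner x y))" .
  then have "cmod (cinner x y) = inner x (c *\<^sub>C y)"
    by (metis Re_cinner Re_complex_of_real)
  also have "\<dots> \<le> norm x * norm (c *\<^sub>C y)" by (rule norm_cauchy_schwarz)
  finally show ?thesis using c by simp
qed simp

lemma bounded_linear_cinner_right: "bounded_linear (cinner x)"
  by (rule bounded_linear_intro[where K = "norm x"])
     (simp_all add: cinner_add_right cinner_scaleR_right scaleR_conv_of_real
        order_trans[OF norm_cinner_le] mult.commute)

lemma bounded_linear_scaleC_left: "bounded_linear (\<lambda>c. c *\<^sub>C (x::'h::chilbert_space))"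
  by (rule bounded_linear_intro[where K = "norm x"])
     (simp_all add: scaleC_add_left scaleC_scaleC scaleC_of_real[symmetric] scaleR_conv_of_real)

lemma cinner_ext: "(\<And>z. cinner z x = cinner z y) \<Longrightarrow> x = y"
  using cinner_self[of "x - y"] by (simp add: cinner_diff_right)


section \<open>Orthonormal bases\<close>

lemma orthonormal_basisD:
  assumes "orthonormal_basis E" "x \<in> E" "y \<in> E"
  shows "cinner x y = (if x = y then 1 else 0)"
  using assms by (auto simp: orthonormal_basis_def)

lemma norm_orthonormal_basis:
  assumes "orthonormal_basis E" "x \<in> E"
  shows "norm x = 1"
  using orthonormal_basisD[OF assms(1,2,2)] unfolding cinner_self
  by (simp del: of_real_power) (metis norm_ge_zero power2_eq_1_iff of_real_eq_1_iff not_one_le_zero neg_0_le_iff_le)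

text \<open>Pythagoras: the projection is orthogonal to its remainder, because the remainder is orthogonal to
  each \<open>e \<in> G\<close>.\<close>

lemma norm_diff_projection:
  assumes E: "orthonormal_basis E" and G: "finite G" "G \<subseteq> E"
  shows "(norm (y - (\<Sum>e\<in>G. cinner e y *\<^sub>C e)))\<^sup>2 = (norm y)\<^sup>2 - (\<Sum>e\<in>G. (cmod (cinner e y))\<^sup>2)"
proof -
  define z where "z = y - (\<Sum>e\<in>G. cinner e y *\<^sub>C e)"
  have orth: "cinner e z = 0" if "e \<in> G" for e
  proof -
    have "cinner e (\<Sum>e\<in>G. cinner e y *\<^sub>C e) = (\<Sum>e'\<in>G. if e = e' then cinner e' y else 0)"
      unfolding cinner_sum_right using that G
      by (intro sum.cong) (auto simp: cinner_scaleC_right orthonormal_basisD[OF E] subset_iff)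
    also have "\<dots> = cinner e y" using that G by simp
    finally show ?thesis by (simp add: z_def cinner_diff_right)
  qed
  have "cinner z z = cinner y z - cinner (\<Sum>e\<in>G. cinner e y *\<^sub>C e) z"
    by (subst z_def) (simp add: cinner_diff_left)
  also have "cinner (\<Sum>e\<in>G. cinner e y *\<^sub>C e) z = 0"
    by (simp add: cinner_sum_left cinner_scaleC_left orth)
  also have "cinner y z = cinner y y - (\<Sum>e\<in>G. cinner e y * cinner y e)"
    by (simp add: z_def cinner_diff_right cinner_sum_right cinner_scaleC_right)
  also have "(\<Sum>e\<in>G. cinner e y * cinner y e) = complex_of_real (\<Sum>e\<in>G. (cmod (cinner e y))\<^sup>2)"
    unfolding of_real_sum complex_norm_square
    by (intro sum.cong refl) (metis cinner_commute)
  finally have "complex_of_real ((norm z)\<^sup>2)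
      = complex_of_real ((norm y)\<^sup>2 - (\<Sum>e\<in>G. (cmod (cinner e y))\<^sup>2))"
    by (simp only: cinner_self of_real_diff diff_0_right)
  then show ?thesis unfolding of_real_eq_iff z_def .
qed

lemma bessel_inequality:
  assumes "orthonormal_basis E" "finite G" "G \<subseteq> E"
  shows "(\<Sum>e\<in>G. (cmod (cinner e y))\<^sup>2) \<le> (norm y)\<^sup>2"
proof -
  have "0 \<le> (norm (y - (\<Sum>e\<in>G. cinner e y *\<^sub>C e)))\<^sup>2" by simp
  then show ?thesis unfolding norm_diff_projection[OF assms] by simp
qed

text \<open>Vectors of the algebraic span are reproduced by all large finite partial sums; as the
  projections are contractions, density of the span carries this over to the limit.\<close>

lemma orthonormal_expansion:
  assumes E: "orthonormal_basis E"
  shows "((\<lambda>e. cinner e x *\<^sub>C e) has_sum x) E"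
proof -
  define s where "s G y = (\<Sum>e\<in>G. cinner e y *\<^sub>C e)" for G and y :: 'a
  \<comment> \<open>the vectors reproduced by every large finite projection; a real subspace containing all \<open>c e\<close>\<close>
  define Z where "Z = {z. \<exists>F. finite F \<and> F \<subseteq> E \<and> (\<forall>G. finite G \<and> F \<subseteq> G \<and> G \<subseteq> E \<longrightarrow> s G z = z)}"
  have s_add: "s G (y + z) = s G y + s G z" for G y z
    by (simp add: s_def cinner_add_right scaleC_add_left sum.distrib)
  have s_scale: "s G (r *\<^sub>R y) = r *\<^sub>R s G y" for G r y
    by (simp add: s_def cinner_scaleR_right scaleC_scaleC[symmetric] scaleR_sum_right scaleC_of_real)
  have "subspace Z"
    unfolding subspace_def
  proof safe
    show "0 \<in> Z" unfolding Z_def by (auto intro!: exI[of _ "{}"] simp: s_def)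
  next
    fix y z assume "y \<in> Z" "z \<in> Z"
    then obtain F F' where "finite F" "F \<subseteq> E" "\<forall>G. finite G \<and> F \<subseteq> G \<and> G \<subseteq> E \<longrightarrow> s G y = y"
      "finite F'" "F' \<subseteq> E" "\<forall>G. finite G \<and> F' \<subseteq> G \<and> G \<subseteq> E \<longrightarrow> s G z = z"
      unfolding Z_def by blast
    then show "y + z \<in> Z" unfolding Z_def by (intro CollectI exI[of _ "F \<union> F'"]) (simp add: s_add)
  next
    fix r y assume "y \<in> Z"
    then obtain F where "finite F" "F \<subseteq> E" "\<forall>G. finite G \<and> F \<subseteq> G \<and> G \<subseteq> E \<longrightarrow> s G y = y"
      unfolding Z_def by blast
    then show "r *\<^sub>R y \<in> Z" unfolding Z_def by (intro CollectI exI[of _ F]) (simp add: s_scale)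
  qed
  moreover have "c *\<^sub>C e \<in> Z" if "e \<in> E" for c e
  proof -
    have "s G (c *\<^sub>C e) = c *\<^sub>C e" if "finite G" "{e} \<subseteq> G" "G \<subseteq> E" for G
    proof -
      have "s G (c *\<^sub>C e) = (\<Sum>e'\<in>G. if e' = e then c *\<^sub>C e else 0)"
        unfolding s_def using that \<open>e \<in> E\<close>
        by (intro sum.cong refl) (auto simp: cinner_scaleC_right orthonormal_basisD[OF E] subset_iff)
      then show ?thesis using that by simp
    qed
    with that show ?thesis unfolding Z_def by (auto intro!: exI[of _ "{e}"])
  qed
  ultimately have span: "span (\<Union>c. scaleC c ` E) \<subseteq> Z"
    by (intro span_minimal) auto
  show ?thesis
    unfolding has_sum_def tendsto_iff eventually_finite_subsets_at_top
  proof (intro allI impI)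
    fix \<epsilon> :: real assume "0 < \<epsilon>"
    have "x \<in> closure (span (\<Union>c. scaleC c ` E))" using E by (simp add: orthonormal_basis_def)
    then obtain z where "z \<in> Z" and z: "dist z x < \<epsilon>"
      using span \<open>0 < \<epsilon>\<close> unfolding closure_approachable by blast
    from \<open>z \<in> Z\<close> obtain F where F: "finite F" "F \<subseteq> E"
        "\<forall>G. finite G \<and> F \<subseteq> G \<and> G \<subseteq> E \<longrightarrow> s G z = z"
      unfolding Z_def by blast
    have "dist (s G x) x < \<epsilon>" if "finite G" "F \<subseteq> G" "G \<subseteq> E" for G
    proof -
      have "s G x = s G (x - z) + z"
        using s_add[of G "x - z" z] F(3) that by simp
      then have "dist (s G x) x = norm ((x - z) - s G (x - z))"
        by (simp add: dist_norm norm_minus_commute algebra_simps)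
      also have "\<dots> \<le> norm (x - z)"
      proof (rule power2_le_imp_le)
        show "(norm (x - z - s G (x - z)))\<^sup>2 \<le> (norm (x - z))\<^sup>2"
          unfolding s_def norm_diff_projection[OF E that(1,3)] by (simp add: sum_nonneg)
      qed simp
      finally show ?thesis using z by (simp add: dist_norm norm_minus_commute)
    qed
    then show "\<exists>X. finite X \<and> X \<subseteq> E \<and> (\<forall>Y. finite Y \<and> X \<subseteq> Y \<and> Y \<subseteq> E \<longrightarrow>
        dist (\<Sum>e\<in>Y. cinner e x *\<^sub>C e) x < \<epsilon>)"
      using F(1,2) unfolding s_def by blast
  qed
qed

lemma parseval:
  assumes "orthonormal_basis E"
  shows "((\<lambda>e. cinner y e * cinner e x) has_sum cinner y x) E"
  using has_sum_bounded_linear[OF bounded_linear_cinner_right orthonormal_expansion[OF assms], of y x]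
  by (simp add: cinner_scaleC_right mult.commute)

text \<open>A bound uniform in the finite set, by Cauchy--Schwarz for sums and Bessel's inequality; it makes
  the double series for the trace absolutely convergent.\<close>

lemma sum_cinner_products_le:
  assumes "orthonormal_basis E" "finite G" "G \<subseteq> E"
  shows "(\<Sum>e\<in>G. cmod (cinner y e * cinner e x)) \<le> norm y * norm x"
proof -
  have "(\<Sum>e\<in>G. cmod (cinner y e * cinner e x))
      = (\<Sum>e\<in>G. \<bar>cmod (cinner e y)\<bar> * \<bar>cmod (cinner e x)\<bar>)"
    by (intro sum.cong refl) (simp add: norm_mult, metis cinner_commute complex_mod_cnj)
  also have "\<dots> \<le> L2_set (\<lambda>e. cmod (cinner e y)) G * L2_set (\<lambda>e. cmod (cinner e x)) G"
    by (rule L2_set_mult_ineq)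
  also have "\<dots> \<le> norm y * norm x"
    unfolding L2_set_def
    by (intro mult_mono real_le_lsqrt bessel_inequality[OF assms]) (auto intro: sum_nonneg)
  finally show ?thesis .
qed

lemma closure_subspace:
  fixes S :: "'b::real_normed_vector set"
  assumes "subspace S"
  shows "subspace (closure S)"
  unfolding subspace_def
proof safe
  show "0 \<in> closure S" using subspace_0[OF assms] closure_subset by blast
next
  fix x y assume "x \<in> closure S" "y \<in> closure S"
  then obtain u v where "\<And>n. u n \<in> S" "u \<longlonglongrightarrow> x" "\<And>n. v n \<in> S" "v \<longlonglongrightarrow> y"
    unfolding closure_sequential by blast
  then show "x + y \<in> closure S"
    unfolding closure_sequential
    by (intro exI[of _ "\<lambda>n. u n + v n"]) (simp add: tendsto_add subspace_add[OF assms])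
next
  fix c :: real and x assume "x \<in> closure S"
  then obtain u where "\<And>n. u n \<in> S" "u \<longlonglongrightarrow> x"
    unfolding closure_sequential by blast
  then show "c *\<^sub>R x \<in> closure S"
    unfolding closure_sequential
    by (intro exI[of _ "\<lambda>n. c *\<^sub>R u n"]) (simp add: tendsto_scaleR subspace_scale[OF assms])
qed

text \<open>For density it is enough to reach \<open>(x, 0)\<close> and \<open>(0, y)\<close>, which are the limits of the expansions of
  \<open>x\<close> and \<open>y\<close> in the bases of the two summands.\<close>

lemma orthonormal_basis_prod:
  fixes E :: "'h::chilbert_space set" and F :: "'g::chilbert_space set"
  assumes E: "orthonormal_basis E" and F: "orthonormal_basis F"
  shows "orthonormal_basis ((\<lambda>x. (x, 0)) ` E \<union> (\<lambda>y. (0, y)) ` F)"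
proof -
  let ?U = "(\<lambda>x. (x, 0::'g)) ` E \<union> (\<lambda>y. (0::'h, y)) ` F"
  let ?S = "closure (span (\<Union>c. scaleC c ` ?U))"
  have sub: "subspace ?S" by (intro closure_subspace subspace_span)
  have base: "c *\<^sub>C v \<in> ?S" if "v \<in> ?U" for c v
    using that by (intro subsetD[OF closure_subset] span_base) blast
  have base1: "(c *\<^sub>C x, 0) \<in> ?S" if "x \<in> E" for c x
    using base[of "(x, 0)" c] that by (simp add: scaleC_prod_def)
  have base2: "(0, c *\<^sub>C y) \<in> ?S" if "y \<in> F" for c y
    using base[of "(0, y)" c] that by (simp add: scaleC_prod_def)
  have all: "(x, 0) \<in> ?S" for x
  proof -
    have "((\<lambda>e. (cinner e x *\<^sub>C e, 0::'g)) has_sum (x, 0)) E"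
      by (rule has_sum_bounded_linear[OF _ orthonormal_expansion[OF E]])
         (rule bounded_linear_Pair[OF bounded_linear_ident bounded_linear_zero])
    then show ?thesis unfolding has_sum_def
    proof (rule Lim_in_closed_set[rotated 3])
      show "\<forall>\<^sub>F G in finite_subsets_at_top E. (\<Sum>e\<in>G. (cinner e x *\<^sub>C e, 0)) \<in> ?S"
        unfolding eventually_finite_subsets_at_top
        by (intro exI[of _ "{}"] conjI allI impI subspace_sum[OF sub] base1) auto
    qed auto
  qed
  have all': "(0, y) \<in> ?S" for y
  proof -
    have "((\<lambda>e. (0::'h, cinner e y *\<^sub>C e)) has_sum (0, y)) F"
      by (rule has_sum_bounded_linear[OF _ orthonormal_expansion[OF F]])
         (rule bounded_linear_Pair[OF bounded_linear_zero bounded_linear_ident])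
    then show ?thesis unfolding has_sum_def
    proof (rule Lim_in_closed_set[rotated 3])
      show "\<forall>\<^sub>F G in finite_subsets_at_top F. (\<Sum>e\<in>G. (0, cinner e y *\<^sub>C e)) \<in> ?S"
        unfolding eventually_finite_subsets_at_top
        by (intro exI[of _ "{}"] conjI allI impI subspace_sum[OF sub] base2) auto
    qed auto
  qed
  have "v \<in> ?S" for v
    using subspace_add[OF sub all[of "fst v"] all'[of "snd v"]] by simp
  moreover have "\<forall>x\<in>?U. \<forall>y\<in>?U. cinner x y = (if x = y then 1 else 0)"
    using norm_orthonormal_basis[OF E, of 0] norm_orthonormal_basis[OF F, of 0]
    by (auto simp: cinner_prod_def orthonormal_basisD[OF E] orthonormal_basisD[OF F] split: if_splits)
  ultimately show ?thesis unfolding orthonormal_basis_def by blast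
qed

section \<open>Trace class operators\<close>

text \<open>Nuclear representations are indexed by natural numbers; the sum of two of them, and the union of
  two bases, is enumerated alternately.\<close>

definition interleave :: "(nat \<Rightarrow> 'a) \<Rightarrow> (nat \<Rightarrow> 'a) \<Rightarrow> nat \<Rightarrow> 'a" where
  "interleave f g n = (if even n then f (n div 2) else g (n div 2))"

lemma range_interleave: "range (interleave f g) = range f \<union> range g"
proof -
  have "f n = interleave f g (2 * n)" "g n = interleave f g (2 * n + 1)" for n
    by (simp_all add: interleave_def)
  then have "range f \<union> range g \<subseteq> range (interleave f g)" by blast
  then show ?thesis by (auto simp: interleave_def)
qed

lemma inj_interleave:
  assumes "inj f" "inj g" "range f \<inter> range g = {}"
  shows "inj (interleave f g)"
proof (rule injI)
  fix m n assume "interleave f g m = interleave f g n"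
  moreover have "f i \<noteq> g j" for i j using assms(3) by blast
  ultimately have "even m = even n \<and> m div 2 = n div 2"
    using assms(1,2) by (auto simp: interleave_def dest: injD split: if_splits) metis+
  then show "m = n" by (metis div_mult_mod_eq mod2_eq_if)
qed

lemma has_sum_interleave:
  fixes f g :: "nat \<Rightarrow> 'a::topological_comm_monoid_add"
  assumes "(f has_sum a) UNIV" "(g has_sum b) UNIV"
  shows "(interleave f g has_sum (a + b)) UNIV"
proof -
  have UN: "UNIV = range (\<lambda>n::nat. 2 * n) \<union> range (\<lambda>n. 2 * n + 1)"
    by (auto elim: evenE oddE) (metis evenE oddE Suc_eq_plus1 rangeI)
  have "(interleave f g has_sum a) (range (\<lambda>n. 2 * n))"
    using assms(1) by (subst has_sum_reindex) (auto simp: inj_def interleave_def o_def)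
  moreover have "(interleave f g has_sum b) (range (\<lambda>n. 2 * n + 1))"
    using assms(2) by (subst has_sum_reindex) (auto simp: inj_def interleave_def o_def)
  moreover have "range (\<lambda>n::nat. 2 * n) \<inter> range (\<lambda>n. 2 * n + 1) = {}"
    by auto presburger
  ultimately show ?thesis by (subst UN) (rule has_sum_Un_disjoint)
qed

lemma summable_interleave:
  fixes f g :: "nat \<Rightarrow> real"
  assumes "summable f" "summable g" "\<And>n. 0 \<le> f n" "\<And>n. 0 \<le> g n"
  shows "summable (interleave f g)"
proof -
  have "(f has_sum suminf f) UNIV" "(g has_sum suminf g) UNIV"
    using assms by (auto intro!: norm_summable_imp_has_sum summable_sums)
  from has_sum_imp_sums[OF has_sum_interleave[OF this]] show ?thesis
    by (rule sums_summable)
qed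

lemma sums_interleave:
  fixes f g :: "nat \<Rightarrow> 'a::banach"
  assumes "f sums a" "g sums b" "summable (\<lambda>n. norm (f n))" "summable (\<lambda>n. norm (g n))"
  shows "interleave f g sums (a + b)"
  by (rule has_sum_imp_sums[OF has_sum_interleave[OF
        norm_summable_imp_has_sum[OF assms(3,1)] norm_summable_imp_has_sum[OF assms(4,2)]]])

instance chilbert_space \<subseteq> banach ..

lemma trace_classI:
  assumes "bounded_clinear T" "summable (\<lambda>n. norm (x n) * norm (y n))"
    "\<And>v. (\<lambda>n. cinner (y n) v *\<^sub>C x n) sums T v"
  shows "trace_class T"
  using assms unfolding trace_class_def by blast

lemma trace_classE:
  assumes "trace_class T"
  obtains x y where "summable (\<lambda>n. norm (x n) * norm (y n))" "\<And>v. (\<lambda>n. cinner (y n) v *\<^sub>C x n) sums T v"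
  using assms unfolding trace_class_def by blast

lemma nuclear_terms_summable:
  fixes x :: "nat \<Rightarrow> 'h::chilbert_space" and y :: "nat \<Rightarrow> 'g::chilbert_space"
  assumes "summable (\<lambda>n. norm (x n) * norm (y n))"
  shows "summable (\<lambda>n. norm (cinner (y n) v *\<^sub>C x n))"
proof (rule summable_comparison_test')
  show "summable (\<lambda>n. norm v * (norm (x n) * norm (y n)))" using assms by (rule summable_mult)
  show "norm (norm (cinner (y n) v *\<^sub>C x n)) \<le> norm v * (norm (x n) * norm (y n))" for n
    using mult_right_mono[OF norm_cinner_le[of "y n" v] norm_ge_zero[of "x n"]]
    by (simp add: mult_ac)
qed

lemma bounded_clinear_add:
  assumes "bounded_clinear S" "bounded_clinear T"
  shows "bounded_clinear (\<lambda>v. S v + T v)"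
  using assms by (auto simp: bounded_clinear_def bounded_linear_add scaleC_add_right)

lemma trace_class_add:
  assumes "trace_class S" "trace_class T"
  shows "trace_class (\<lambda>v. S v + T v)"
proof -
  obtain x y where xy: "summable (\<lambda>n. norm (x n) * norm (y n))" "\<And>v. (\<lambda>n. cinner (y n) v *\<^sub>C x n) sums S v"
    using assms(1) by (rule trace_classE) blast
  obtain x' y' where xy': "summable (\<lambda>n. norm (x' n) * norm (y' n))" "\<And>v. (\<lambda>n. cinner (y' n) v *\<^sub>C x' n) sums T v"
    using assms(2) by (rule trace_classE) blast
  show ?thesis
  proof (rule trace_classI)
    show "bounded_clinear (\<lambda>v. S v + T v)"
      using assms by (simp add: trace_class_def bounded_clinear_add)
    have "(\<lambda>n. norm (interleave x x' n) * norm (interleave y y' n))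
        = interleave (\<lambda>n. norm (x n) * norm (y n)) (\<lambda>n. norm (x' n) * norm (y' n))"
      by (simp add: interleave_def fun_eq_iff)
    then show "summable (\<lambda>n. norm (interleave x x' n) * norm (interleave y y' n))"
      using summable_interleave[OF xy(1) xy'(1)] by simp
  next
    fix v
    have "(\<lambda>n. cinner (interleave y y' n) v *\<^sub>C interleave x x' n)
        = interleave (\<lambda>n. cinner (y n) v *\<^sub>C x n) (\<lambda>n. cinner (y' n) v *\<^sub>C x' n)"
      by (simp add: interleave_def fun_eq_iff)
    then show "(\<lambda>n. cinner (interleave y y' n) v *\<^sub>C interleave x x' n) sums (S v + T v)"
      using sums_interleave[OF xy(2) xy'(2) nuclear_terms_summable[OF xy(1)] nuclear_terms_summable[OF xy'(1)]]
      by simp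
  qed
qed

text \<open>Stability under composition with bounded operators on both sides.  The spaces may differ, so
  that blocks of an operator matrix are covered; \<open>V'\<close> is the adjoint of \<open>V\<close>.\<close>

lemma trace_class_sandwich:
  fixes T :: "'g::chilbert_space \<Rightarrow> 'g" and U :: "'g \<Rightarrow> 'h::chilbert_space" and V :: "'h \<Rightarrow> 'g"
  assumes T: "trace_class T"
    and U: "bounded_linear U" "\<And>c x. U (c *\<^sub>C x) = c *\<^sub>C U x"
    and V: "bounded_linear V" "\<And>c x. V (c *\<^sub>C x) = c *\<^sub>C V x"
    and V': "bounded_linear V'" "\<And>y v. cinner (V' y) v = cinner y (V v)"
  shows "trace_class (\<lambda>v. U (T (V v)))"
proof -
  obtain x y where xy: "summable (\<lambda>n. norm (x n) * norm (y n))" "\<And>v. (\<lambda>n. cinner (y n) v *\<^sub>C x n) sums T v"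
    using T by (rule trace_classE) blast
  obtain K where K: "\<And>x. norm (U x) \<le> norm x * K" "0 \<le> K"
    using bounded_linear.nonneg_bounded[OF U(1)] by blast
  obtain L where L: "\<And>x. norm (V' x) \<le> norm x * L" "0 \<le> L"
    using bounded_linear.nonneg_bounded[OF V'(1)] by blast
  have bc: "bounded_clinear T" using T by (simp add: trace_class_def)
  have "bounded_clinear (\<lambda>v. U (T (V v)))"
    using bc bounded_linear_compose[OF U(1) bounded_linear_compose[OF _ V(1)], of T]
    by (simp add: bounded_clinear_def U V)
  moreover have "summable (\<lambda>n. norm (U (x n)) * norm (V' (y n)))"
  proof (rule summable_comparison_test')
    show "summable (\<lambda>n. K * L * (norm (x n) * norm (y n)))" using xy(1) by (rule summable_mult)
    show "norm (norm (U (x n)) * norm (V' (y n))) \<le> K * L * (norm (x n) * norm (y n))" for n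
      using mult_mono[OF K(1)[of "x n"] L(1)[of "y n"]] K(2) by (simp add: mult_ac)
  qed
  moreover have "(\<lambda>n. cinner (V' (y n)) v *\<^sub>C U (x n)) sums U (T (V v))" for v
    using bounded_linear.sums[OF U(1) xy(2)[of "V v"]] by (simp add: U V')
  ultimately show ?thesis by (rule trace_classI)
qed

lemma trace_class_zero: "trace_class (\<lambda>v. 0)"
  unfolding trace_class_def bounded_clinear_def
  by (auto intro!: exI[of _ "\<lambda>_. 0"] bounded_linear_zero)

text \<open>The adjoint of \<open>\<Sum>n. |x\<^sub>n\<rangle>\<langle>y\<^sub>n|\<close> is \<open>\<Sum>n. |y\<^sub>n\<rangle>\<langle>x\<^sub>n|\<close>; the swapped series converges in norm, and its sum
  is identified by testing against all vectors.\<close>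

lemma trace_class_adjoint:
  assumes T: "trace_class T" and S: "bounded_clinear S"
    and adj: "\<And>v w. cinner (S v) w = cinner v (T w)"
  shows "trace_class S"
proof -
  obtain x y where xy: "summable (\<lambda>n. norm (x n) * norm (y n))" "\<And>v. (\<lambda>n. cinner (y n) v *\<^sub>C x n) sums T v"
    using T by (rule trace_classE) blast
  have yx: "summable (\<lambda>n. norm (y n) * norm (x n))" using xy(1) by (simp add: mult.commute)
  have "(\<lambda>n. cinner (x n) v *\<^sub>C y n) sums S v" for v
  proof -
    have "summable (\<lambda>n. cinner (x n) v *\<^sub>C y n)"
      by (rule summable_norm_cancel[OF nuclear_terms_summable[OF yx]])
    then obtain z where z: "(\<lambda>n. cinner (x n) v *\<^sub>C y n) sums z" by (auto simp: summable_def)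
    have "cinner w z = cinner w (S v)" for w
    proof -
      have "(\<lambda>n. cnj (cinner (y n) w * cinner v (x n))) sums cnj (cinner v (T w))"
        using bounded_linear.sums[OF bounded_linear_cnj
          bounded_linear.sums[OF bounded_linear_cinner_right[of v] xy(2)[of w]]]
        by (simp add: cinner_scaleC_right)
      also have "(\<lambda>n. cnj (cinner (y n) w * cinner v (x n))) = (\<lambda>n. cinner w (cinner (x n) v *\<^sub>C y n))"
        by (rule ext) (metis cinner_commute cinner_scaleC_right complex_cnj_mult mult.commute)
      also have "cnj (cinner v (T w)) = cinner w (S v)"
        by (metis adj cinner_commute)
      finally have "(\<lambda>n. cinner w (cinner (x n) v *\<^sub>C y n)) sums cinner w (S v)" .
      with bounded_linear.sums[OF bounded_linear_cinner_right[of w] z]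
      show ?thesis by (rule sums_unique2)
    qed
    with z show ?thesis by (metis cinner_ext)
  qed
  with S yx show ?thesis by (rule trace_classI)
qed

text \<open>Applying \<open>T\<close> to the expansion of \<open>v\<close> in the basis \<open>f\<close> shows \<open>T = \<Sum>n. |T f\<^sub>n\<rangle>\<langle>f\<^sub>n|\<close>.\<close>

lemma trace_class_of_summable_columns:
  fixes f :: "nat \<Rightarrow> 'h::chilbert_space"
  assumes f: "inj f" "orthonormal_basis (range f)" and T: "bounded_clinear T"
    and sm: "summable (\<lambda>n. norm (T (f n)))"
  shows "trace_class T"
proof -
  have nf: "norm (f n) = 1" for n using norm_orthonormal_basis[OF f(2)] by blast
  have "(\<lambda>n. cinner (f n) v *\<^sub>C T (f n)) sums T v" for v
  proof -
    have "((\<lambda>e. cinner e v *\<^sub>C T e) has_sum T v) (range f)"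
      using has_sum_bounded_linear[OF _ orthonormal_expansion[OF f(2), of v], of T] T
      by (simp add: bounded_clinear_def)
    then show ?thesis
      by (intro has_sum_imp_sums) (simp add: has_sum_reindex[OF f(1)] o_def)
  qed
  with T sm show ?thesis by (intro trace_classI[of T "\<lambda>n. T (f n)" f]) (simp_all add: nf)
qed

text \<open>The image of the unit ball under a nuclear operator lies, up to an arbitrarily small tail, in
  a finite sum of compact discs, hence it is totally bounded.\<close>

lemma trace_class_imp_compact_operator:
  fixes T :: "'h::chilbert_space \<Rightarrow> 'h"
  assumes T: "trace_class T"
  shows "compact_operator T"
proof -
  obtain x y where xy: "summable (\<lambda>n. norm (x n) * norm (y n))" "\<And>v. (\<lambda>n. cinner (y n) v *\<^sub>C x n) sums T v"
    using T by (rule trace_classE) blast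
  have cpt: "\<exists>K. compact K \<and> (\<forall>c. (\<forall>n. cmod (c n) \<le> norm (y n)) \<longrightarrow> (\<Sum>n<N. c n *\<^sub>C x n) \<in> K)" for N
  proof (induction N)
    case 0
    show ?case by (intro exI[of _ "{0}"]) auto
  next
    case (Suc N)
    then obtain K where K: "compact K"
      "\<And>c. (\<forall>n. cmod (c n) \<le> norm (y n)) \<Longrightarrow> (\<Sum>n<N. c n *\<^sub>C x n) \<in> K" by blast
    have "compact ((\<lambda>c. c *\<^sub>C x N) ` cball 0 (norm (y N)))"
      by (intro compact_continuous_image linear_continuous_on bounded_linear_scaleC_left compact_cball)
    from compact_sums[OF K(1) this] show ?case
    proof (intro exI conjI allI impI, assumption, intro CollectI exI conjI)
      fix c :: "nat \<Rightarrow> complex" assume c: "\<forall>n. cmod (c n) \<le> norm (y n)"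
      show "(\<Sum>n<Suc N. c n *\<^sub>C x n) = (\<Sum>n<N. c n *\<^sub>C x n) + c N *\<^sub>C x N" by simp
      show "(\<Sum>n<N. c n *\<^sub>C x n) \<in> K" using c by (rule K(2))
      show "c N *\<^sub>C x N \<in> (\<lambda>c. c *\<^sub>C x N) ` cball 0 (norm (y N))" using c by simp
    qed
  qed
  have near: "\<exists>K. compact K \<and> (\<forall>v\<in>cball 0 1. \<exists>k\<in>K. dist k (T v) < \<epsilon>)" if \<epsilon>: "0 < \<epsilon>" for \<epsilon>
  proof -
    obtain N where N: "norm (suminf (\<lambda>i. norm (x (i + N)) * norm (y (i + N)))) < \<epsilon>"
      using suminf_exist_split[OF \<epsilon> xy(1)] by blast
    obtain K where K: "compact K"
      "\<And>c. (\<forall>n. cmod (c n) \<le> norm (y n)) \<Longrightarrow> (\<Sum>n<N. c n *\<^sub>C x n) \<in> K" using cpt[of N] by blast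
    have "\<exists>k\<in>K. dist k (T v) < \<epsilon>" if v: "v \<in> cball 0 1" for v
    proof (rule bexI)
      have cb: "cmod (cinner (y n) v) \<le> norm (y n)" for n
        using norm_cinner_le[of "y n" v] mult_left_mono[of "norm v" 1 "norm (y n)"] v by simp
      show "(\<Sum>n<N. cinner (y n) v *\<^sub>C x n) \<in> K" using cb by (intro K(2)) blast
      have tail: "(\<lambda>i. cinner (y (i + N)) v *\<^sub>C x (i + N)) sums (T v - (\<Sum>n<N. cinner (y n) v *\<^sub>C x n))"
        using sums_split_initial_segment[OF xy(2)[of v], of N] .
      have sm: "summable (\<lambda>i. norm (x (i + N)) * norm (y (i + N)))"
        using summable_ignore_initial_segment[OF xy(1), of N] .
      have "norm (suminf (\<lambda>i. cinner (y (i + N)) v *\<^sub>C x (i + N))) \<le> suminf (\<lambda>i. norm (x (i + N)) * norm (y (i + N)))"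
        using cb by (intro norm_suminf_le sm) (simp add: mult.commute mult_left_mono)
      also have "\<dots> < \<epsilon>" using N by simp
      finally show "dist (\<Sum>n<N. cinner (y n) v *\<^sub>C x n) (T v) < \<epsilon>"
        using sums_unique[OF tail] by (simp add: dist_norm norm_minus_commute)
    qed
    with K(1) show ?thesis by blast
  qed
  have "compact (closure (T ` cball 0 1))"
    unfolding compact_eq_totally_bounded
  proof (intro conjI allI impI)
    show "complete (closure (T ` cball 0 1))" by (simp add: complete_eq_closed)
    fix \<epsilon> :: real assume \<epsilon>: "0 < \<epsilon>"
    obtain K where K: "compact K" "\<And>v. v \<in> cball 0 1 \<Longrightarrow> \<exists>k\<in>K. dist k (T v) < \<epsilon> / 3"
      using near[of "\<epsilon> / 3"] \<epsilon> by auto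
    obtain C where C: "finite C" "K \<subseteq> (\<Union>c\<in>C. ball c (\<epsilon> / 3))"
      using K(1) \<epsilon> unfolding compact_eq_totally_bounded by (metis zero_less_divide_iff zero_less_numeral)
    have "closure (T ` cball 0 1) \<subseteq> (\<Union>c\<in>C. ball c \<epsilon>)"
    proof
      fix z assume "z \<in> closure (T ` cball 0 1)"
      then obtain v where v: "v \<in> cball 0 1" "dist (T v) z < \<epsilon> / 3"
        using \<epsilon> unfolding closure_approachable by (metis (no_types, lifting) imageE zero_less_divide_iff zero_less_numeral)
      obtain k where k: "k \<in> K" "dist k (T v) < \<epsilon> / 3" using K(2) v(1) by blast
      obtain c where c: "c \<in> C" "dist c k < \<epsilon> / 3" using C(2) k(1) by auto
      have "dist c z \<le> dist c k + dist k (T v) + dist (T v) z"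
        using dist_triangle[of c z k] dist_triangle[of k z "T v"] by simp
      then show "z \<in> (\<Union>c\<in>C. ball c \<epsilon>)" using c k v by (auto intro!: bexI[of _ c])
    qed
    with C(1) show "\<exists>k. finite k \<and> closure (T ` cball 0 1) \<subseteq> (\<Union>x\<in>k. ball x \<epsilon>)" by blast
  qed
  with T show ?thesis by (simp add: compact_operator_def trace_class_def)
qed

text \<open>For \<open>T = \<Sum>n. |x\<^sub>n\<rangle>\<langle>y\<^sub>n|\<close> the trace in any orthonormal basis is \<open>\<Sum>n. \<langle>y\<^sub>n, x\<^sub>n\<rangle>\<close>: the double
  series converges absolutely, and its inner sums are Parseval's identity.\<close>

lemma trace_nuclear:
  fixes T :: "'h::chilbert_space \<Rightarrow> 'h"
  assumes E: "orthonormal_basis E" and xy: "summable (\<lambda>n. norm (x n) * norm (y n))"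
    and T: "\<And>v. (\<lambda>n. cinner (y n) v *\<^sub>C x n) sums T v"
  shows "(\<Sum>\<^sub>\<infinity>e\<in>E. cinner e (T e)) = (\<Sum>\<^sub>\<infinity>n. cinner (y n) (x n))"
proof -
  define g where "g n e = cinner (y n) e * cinner e (x n)" for n e
  have fin: "(\<Sum>e\<in>G. cmod (g n e)) \<le> norm (y n) * norm (x n)" if "finite G" "G \<subseteq> E" for G n
    unfolding g_def using sum_cinner_products_le[OF E that] by blast
  have ab: "(\<lambda>e. cmod (g n e)) summable_on E" for n
    using fin by (intro nonneg_bdd_above_summable_on bdd_aboveI[of _ "norm (y n) * norm (x n)"]) auto
  have "(\<lambda>n. \<Sum>\<^sub>\<infinity>e\<in>E. cmod (g n e)) summable_on UNIV"
  proof (rule summable_on_comparison_test)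
    show "(\<lambda>n. norm (x n) * norm (y n)) summable_on UNIV"
      using xy by (simp add: summable_on_UNIV_nonneg_real_iff)
    show "(\<Sum>\<^sub>\<infinity>e\<in>E. cmod (g n e)) \<le> norm (x n) * norm (y n)" for n
      using fin by (intro infsum_le_finite_sums ab) (auto simp: mult.commute)
  qed (auto intro: infsum_nonneg)
  then have "(\<lambda>p. cmod (case p of (n, e) \<Rightarrow> g n e)) summable_on (UNIV \<times> E)"
    unfolding Infinite_Sum.abs_summable_on_Sigma_iff using ab by (simp add: infsum_nonneg)
  then have swap: "(\<Sum>\<^sub>\<infinity>n. \<Sum>\<^sub>\<infinity>e\<in>E. g n e) = (\<Sum>\<^sub>\<infinity>e\<in>E. \<Sum>\<^sub>\<infinity>n. g n e)"
    by (rule infsum_swap_banach[OF Infinite_Sum.abs_summable_summable])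
  have "(\<Sum>\<^sub>\<infinity>e\<in>E. cinner e (T e)) = (\<Sum>\<^sub>\<infinity>e\<in>E. \<Sum>\<^sub>\<infinity>n. g n e)"
  proof (rule infsum_cong)
    fix e assume e: "e \<in> E"
    have "(\<lambda>n. g n e) sums cinner e (T e)"
      using bounded_linear.sums[OF bounded_linear_cinner_right[of e] T[of e]]
      by (simp add: g_def cinner_scaleC_right)
    moreover have "summable (\<lambda>n. norm (g n e))"
    proof (rule summable_comparison_test'[OF xy])
      show "norm (norm (g n e)) \<le> norm (x n) * norm (y n)" for n
        using mult_mono[OF norm_cinner_le[of "y n" e] norm_cinner_le[of e "x n"]] norm_orthonormal_basis[OF E e]
        by (simp add: g_def norm_mult mult.commute)
    qed
    ultimately show "cinner e (T e) = (\<Sum>\<^sub>\<infinity>n. g n e)"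
      by (intro infsumI[symmetric] norm_summable_imp_has_sum)
  qed
  also have "\<dots> = (\<Sum>\<^sub>\<infinity>n. \<Sum>\<^sub>\<infinity>e\<in>E. g n e)" by (rule swap[symmetric])
  also have "\<dots> = (\<Sum>\<^sub>\<infinity>n. cinner (y n) (x n))"
    using infsumI[OF parseval[OF E]] by (simp add: g_def)
  finally show ?thesis .
qed

text \<open>\<^const>\<open>op_trace\<close> uses an unspecified orthonormal basis; by the previous lemma any other one gives the
  same value.\<close>

lemma op_trace_eqI:
  assumes T: "trace_class T" and E: "orthonormal_basis E"
    and s: "((\<lambda>e. cinner e (T e)) has_sum s) E"
  shows "op_trace T = s"
proof -
  obtain x y where xy: "summable (\<lambda>n. norm (x n) * norm (y n))" "\<And>v. (\<lambda>n. cinner (y n) v *\<^sub>C x n) sums T v"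
    using T by (rule trace_classE) blast
  have "orthonormal_basis (SOME E::'a set. orthonormal_basis E)"
    using E by (rule someI)
  from trace_nuclear[OF this xy] trace_nuclear[OF E xy] infsumI[OF s]
  show ?thesis by (simp add: op_trace_def)
qed

section \<open>Representations and Fredholm modules\<close>

lemma trace_class_prod_of_summable_columns:
  fixes e :: "nat \<Rightarrow> 'h::chilbert_space"
  assumes e: "inj e" "orthonormal_basis (range e)" and T: "bounded_clinear T"
    and "summable (\<lambda>n. norm (T (e n, 0)))" "summable (\<lambda>n. norm (T (0, e n)))"
  shows "trace_class T"
proof (rule trace_class_of_summable_columns)
  let ?f = "interleave (\<lambda>n. (e n, 0)) (\<lambda>n. (0, e n))"
  have "range ?f = (\<lambda>x. (x, 0)) ` range e \<union> (\<lambda>x. (0, x)) ` range e"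
    by (simp add: range_interleave image_image)
  then show "orthonormal_basis (range ?f)"
    using orthonormal_basis_prod[OF e(2,2)] by simp
  have "e n \<noteq> 0" for n using norm_orthonormal_basis[OF e(2), of "e n"] by auto
  then show "inj ?f"
    by (intro inj_interleave) (auto simp: inj_def dest: injD[OF e(1)])
  have "(\<lambda>n. norm (T (?f n))) = interleave (\<lambda>n. norm (T (e n, 0))) (\<lambda>n. norm (T (0, e n)))"
    by (simp add: interleave_def fun_eq_iff)
  then show "summable (\<lambda>n. norm (T (?f n)))"
    using assms(4,5) by (simp add: summable_interleave)
qed (rule T)

lemma star_repD:
  assumes "star_rep R \<pi>"
  shows "x \<in> carrier R \<Longrightarrow> bounded_clinear (\<pi> x)"
    and "\<pi> \<one>\<^bsub>R\<^esub> = id"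
    and "x \<in> carrier R \<Longrightarrow> y \<in> carrier R \<Longrightarrow> \<pi> (x \<oplus>\<^bsub>R\<^esub> y) v = \<pi> x v + \<pi> y v"
    and "x \<in> carrier R \<Longrightarrow> y \<in> carrier R \<Longrightarrow> \<pi> (x \<otimes>\<^bsub>R\<^esub> y) v = \<pi> x (\<pi> y v)"
    and "x \<in> carrier R \<Longrightarrow> \<pi> (c \<odot>\<^bsub>R\<^esub> x) v = c *\<^sub>C \<pi> x v"
    and "x \<in> carrier R \<Longrightarrow> cinner (\<pi> (star R x) v) w = cinner v (\<pi> x w)"
  using assms unfolding star_rep_def by (auto simp: fun_eq_iff)

lemma bounded_clinear_rep_sum:
  assumes "bounded_clinear (\<pi> x)" "bounded_clinear (\<sigma> x)"
  shows "bounded_clinear (rep_sum \<pi> \<sigma> x)"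
  using assms
  by (auto simp: bounded_clinear_def rep_sum_def case_prod_unfold scaleC_prod_def
      intro!: bounded_linear_Pair bounded_linear_compose[OF _ bounded_linear_fst]
        bounded_linear_compose[OF _ bounded_linear_snd])

lemma star_rep_rep_sum:
  assumes "star_rep R \<pi>" "star_rep R \<sigma>"
  shows "star_rep R (rep_sum \<pi> \<sigma>)"
  unfolding star_rep_def
proof (intro conjI ballI allI)
  show "bounded_clinear (rep_sum \<pi> \<sigma> x)" if "x \<in> carrier R" for x
    using that by (intro bounded_clinear_rep_sum star_repD(1)[OF assms(1)] star_repD(1)[OF assms(2)])
qed (auto simp: rep_sum_def fun_eq_iff scaleC_prod_def cinner_prod_def
       star_repD[OF assms(1)] star_repD[OF assms(2)])

lemma bounded_clinear_diff:
  assumes "bounded_clinear S" "bounded_clinear T"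
  shows "bounded_clinear (\<lambda>v. S v - T v)"
  using assms by (auto simp: bounded_clinear_def bounded_linear_sub scaleC_diff_right)

lemma commutator_flip:
  "commutator flip_op (rep_sum \<pi> \<sigma> x)
    = (\<lambda>z. (0, \<pi> x (fst z) - \<sigma> x (fst z)) + (- (\<pi> x (snd z) - \<sigma> x (snd z)), 0))"
  by (auto simp: commutator_def flip_op_def rep_sum_def fun_eq_iff)

text \<open>The commutator with the flip has the difference of the two representations as its only
  off-diagonal entries, up to sign.\<close>

lemma fredholm_module_of_trace_class_difference:
  fixes \<pi> \<sigma> :: "'a \<Rightarrow> 'h::chilbert_space \<Rightarrow> 'h"
  assumes rep: "star_rep R \<pi>" "star_rep R \<sigma>"
    and D: "\<And>x. x \<in> carrier R \<Longrightarrow> trace_class (\<lambda>v. \<pi> x v - \<sigma> x v)"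
  shows "even_fredholm_module R (rep_sum \<pi> \<sigma>) flip_op grading_op"
    and "one_summable R (rep_sum \<pi> \<sigma>) flip_op"
proof -
  have tc: "trace_class (commutator flip_op (rep_sum \<pi> \<sigma> x))" if x: "x \<in> carrier R" for x
    unfolding commutator_flip
  proof (rule trace_class_add)
    show "trace_class (\<lambda>z. (0::'h, \<pi> x (fst z) - \<sigma> x (fst z)))"
      by (rule trace_class_sandwich[OF D[OF x], of "\<lambda>d. (0, d)" fst "\<lambda>y. (y, 0)"])
         (auto simp: scaleC_prod_def cinner_prod_def intro!: bounded_linear_fst bounded_linear_Pair
            bounded_linear_zero bounded_linear_ident)
    show "trace_class (\<lambda>z. (- (\<pi> x (snd z) - \<sigma> x (snd z)), 0::'h))"
      by (rule trace_class_sandwich[OF D[OF x], of "\<lambda>d. (- d, 0)" snd "\<lambda>y. (0, y)"])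
         (auto simp: scaleC_prod_def cinner_prod_def scaleC_minus_right intro!: bounded_linear_snd
            bounded_linear_Pair bounded_linear_zero bounded_linear_ident bounded_linear_minus)
  qed
  then show "one_summable R (rep_sum \<pi> \<sigma>) flip_op" by (simp add: one_summable_def)
  have "bounded_clinear (flip_op :: 'h \<times> 'h \<Rightarrow> _)" "bounded_clinear (grading_op :: 'h \<times> 'h \<Rightarrow> _)"
    by (auto simp: bounded_clinear_def flip_op_def grading_op_def case_prod_unfold scaleC_prod_def
        scaleC_minus_right intro!: bounded_linear_Pair bounded_linear_minus bounded_linear_fst bounded_linear_snd)
  then show "even_fredholm_module R (rep_sum \<pi> \<sigma>) flip_op grading_op"
    unfolding even_fredholm_module_def
    by (auto simp: star_rep_rep_sum[OF rep] tc trace_class_imp_compact_operator)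
       (auto simp: flip_op_def grading_op_def fun_eq_iff cinner_prod_def)
qed

locale star_algebra = Group.monoid R for R :: "'a star_alg" (structure) +
  assumes star_closed: "x \<in> carrier R \<Longrightarrow> star R x \<in> carrier R"
begin

lemma sharp_power_closed: "x \<in> carrier R \<Longrightarrow> sharp_power R x \<mu> \<in> carrier R"
  by (cases "\<mu> \<ge> 0") (simp_all only: sharp_power_def if_True if_False star_closed nat_pow_closed)

lemma rep_pow:
  assumes "star_rep R \<pi>" "x \<in> carrier R"
  shows "\<pi> (x [^] (n::nat)) = \<pi> x ^^ n"
proof (induction n)
  case (Suc n)
  then show ?case
    using assms by (simp add: fun_eq_iff star_repD[OF assms(1)] funpow_swap1)
qed (simp add: star_repD[OF assms(1)] id_def)

text \<open>The difference of two representations behaves like a derivation,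
  \<open>D(xy) = D(x) \<pi>(y) + \<sigma>(x) D(y)\<close>, so trace class differences are stable under products.\<close>

lemma trace_class_difference_mult:
  assumes rep: "star_rep R \<pi>" "star_rep R \<sigma>" and xy: "x \<in> carrier R" "y \<in> carrier R"
    and D: "trace_class (\<lambda>v. \<pi> x v - \<sigma> x v)" "trace_class (\<lambda>v. \<pi> y v - \<sigma> y v)"
  shows "trace_class (\<lambda>v. \<pi> (x \<otimes> y) v - \<sigma> (x \<otimes> y) v)"
proof -
  have bc: "bounded_clinear (\<pi> y)" "bounded_clinear (\<pi> (star R y))" "bounded_clinear (\<sigma> x)"
    using xy by (auto intro!: star_repD(1)[OF rep(1)] star_repD(1)[OF rep(2)] star_closed)
  have "trace_class (\<lambda>v. \<pi> x (\<pi> y v) - \<sigma> x (\<pi> y v))"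
    using trace_class_sandwich[OF D(1), of "\<lambda>v. v" "\<pi> y" "\<pi> (star R y)"] bc xy
    by (simp add: bounded_clinear_def star_repD(6)[OF rep(1)] bounded_linear_ident)
  moreover have "trace_class (\<lambda>v. \<sigma> x (\<pi> y v - \<sigma> y v))"
    using trace_class_sandwich[OF D(2), of "\<sigma> x" "\<lambda>v. v" "\<lambda>v. v"] bc xy
    by (simp add: bounded_clinear_def bounded_linear_ident)
  moreover have "\<sigma> x (\<pi> y v - \<sigma> y v) = \<sigma> x (\<pi> y v) - \<sigma> x (\<sigma> y v)" for v
    using bc(3) by (simp add: bounded_clinear_def bounded_linear.linear linear_diff)
  ultimately have "trace_class (\<lambda>v. (\<pi> x (\<pi> y v) - \<sigma> x (\<pi> y v)) + (\<sigma> x (\<pi> y v) - \<sigma> x (\<sigma> y v)))"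
    by (intro trace_class_add) simp_all
  then show ?thesis using xy by (simp add: star_repD[OF rep(1)] star_repD[OF rep(2)])
qed

lemma trace_class_difference_star:
  assumes rep: "star_rep R \<pi>" "star_rep R \<sigma>" and x: "x \<in> carrier R"
    and D: "trace_class (\<lambda>v. \<pi> x v - \<sigma> x v)"
  shows "trace_class (\<lambda>v. \<pi> (star R x) v - \<sigma> (star R x) v)"
  using x
  by (intro trace_class_adjoint[OF D] bounded_clinear_diff star_repD(1)[OF rep(1)] star_repD(1)[OF rep(2)])
     (simp_all add: star_closed cinner_diff_left cinner_diff_right star_repD(6)[OF rep(1)] star_repD(6)[OF rep(2)])

lemma cinner_rep_star:
  assumes "star_rep R \<pi>" "x \<in> carrier R"
  shows "cinner v (\<pi> (star R x) w) = cinner (\<pi> x v) w"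
  by (metis star_repD(6)[OF assms] cinner_commute)

text \<open>This settles all traces except for the geometric series.  If \<open>X\<close> acts diagonally and \<open>C\<close> moves
  every basis vector by the nonzero amount \<open>\<delta>\<close> with respect to an integer grading \<open>h\<close> of the index set,
  then \<open>X\<^sup>n C\<^sup>#\<^sup>\<mu>\<close> can have a nonzero diagonal only for \<open>\<mu> = 0\<close>.  Negative \<open>\<mu>\<close> are reduced to positive
  ones by taking adjoints.\<close>

lemma diagonal_entry_sharp_power:
  fixes f :: "'i \<Rightarrow> 'h::chilbert_space" and h :: "'i \<Rightarrow> int"
  assumes rep: "star_rep R \<pi>" and X: "X \<in> carrier R" "star R X = X" and C: "C \<in> carrier R"
    and f: "\<And>i j. cinner (f i) (f j) = (if i = j then 1 else 0)"
    and Xf: "\<And>i. \<pi> X (f i) = d i *\<^sub>R f i"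
    and Cf: "\<And>i. \<pi> C (f i) = 0 \<or> (\<exists>r j. h j = h i + \<delta> \<and> \<pi> C (f i) = r *\<^sub>R f j)"
    and \<delta>: "\<delta> \<noteq> 0"
  shows "cinner (f i) (\<pi> (X [^] (n::nat) \<otimes> sharp_power R C \<mu>) (f i))
    = (if \<mu> = 0 then complex_of_real (d i ^ n) else 0)"
proof -
  have "(\<pi> C ^^ m) (f i) = 0 \<or> (\<exists>r j. h j = h i + int m * \<delta> \<and> (\<pi> C ^^ m) (f i) = r *\<^sub>R f j)" for m
  proof (induction m)
    case 0
    show ?case by (auto intro!: exI[of _ 1] exI[of _ i])
  next
    case (Suc m)
    have lin: "linear (\<pi> C)"
      using star_repD(1)[OF rep C] by (simp add: bounded_clinear_def bounded_linear.linear)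
    from Suc show ?case
    proof (elim disjE exE conjE)
      assume "(\<pi> C ^^ m) (f i) = 0"
      then show ?thesis using linear_0[OF lin] by simp
    next
      fix r j assume j: "h j = h i + int m * \<delta>" "(\<pi> C ^^ m) (f i) = r *\<^sub>R f j"
      have eq: "(\<pi> C ^^ Suc m) (f i) = r *\<^sub>R \<pi> C (f j)"
        using j(2) by (simp add: linear_scale[OF lin])
      from Cf[of j] show ?thesis
      proof (elim disjE exE conjE)
        assume "\<pi> C (f j) = 0"
        then show ?thesis by (simp only: eq scaleR_zero_right simp_thms)
      next
        fix r' j' assume j': "h j' = h j + \<delta>" "\<pi> C (f j) = r' *\<^sub>R f j'"
        have "h j' = h i + int (Suc m) * \<delta>" using j(1) j'(1) by (simp add: algebra_simps)
        moreover have "(\<pi> C ^^ Suc m) (f i) = (r * r') *\<^sub>R f j'" by (simp only: eq j'(2) scaleR_scaleR)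
        ultimately show ?thesis by blast
      qed
    qed
  qed
  note moved = this
  have shift: "cinner (f i) ((\<pi> C ^^ m) (f i)) = (if m = 0 then 1 else 0)" for m
  proof (cases "m = 0 \<or> (\<pi> C ^^ m) (f i) = 0")
    case False
    with moved[of m] obtain r j where "h j = h i + int m * \<delta>" "(\<pi> C ^^ m) (f i) = r *\<^sub>R f j" by blast
    moreover from this False \<delta> have "j \<noteq> i" by auto
    ultimately show ?thesis using False f[of i j] by (auto simp: cinner_scaleR_right)
  qed (use f[of i i] in auto)
  have shift': "cinner (f i) ((\<pi> (star R C) ^^ m) (f i)) = cinner ((\<pi> C ^^ m) (f i)) (f i)" for m
  proof -
    have "cinner v ((\<pi> (star R C) ^^ m) w) = cinner ((\<pi> C ^^ m) v) w" for v w
      by (induction m arbitrary: v) (simp_all add: cinner_rep_star[OF rep C] funpow_swap1[of "\<pi> C"])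
    then show ?thesis .
  qed
  have "cinner (f i) (\<pi> (sharp_power R C \<mu>) (f i)) = (if \<mu> = 0 then 1 else 0)"
  proof (cases "\<mu> \<ge> 0")
    case True
    then have "\<pi> (sharp_power R C \<mu>) = \<pi> C ^^ nat \<mu>"
      by (simp only: sharp_power_def if_True rep_pow[OF rep C])
    then show ?thesis using shift[of "nat \<mu>"] True by simp
  next
    case False
    then have "cinner (f i) (\<pi> (sharp_power R C \<mu>) (f i)) = cinner ((\<pi> C ^^ nat \<bar>\<mu>\<bar>) (f i)) (f i)"
      by (simp only: sharp_power_def if_False rep_pow[OF rep star_closed[OF C]] shift')
    also have "\<dots> = cnj (cinner (f i) ((\<pi> C ^^ nat \<bar>\<mu>\<bar>) (f i)))" by (rule cinner_commute)
    finally show ?thesis using False by (simp add: shift)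
  qed
  moreover have "cinner (f i) ((\<pi> X ^^ n) w) = complex_of_real (d i ^ n) * cinner (f i) w" for w
  proof (induction n)
    case (Suc n)
    have "cinner (f i) (\<pi> X v) = complex_of_real (d i) * cinner (f i) v" for v
      using star_repD(6)[OF rep X(1), of "f i" v] X(2) by (simp add: Xf cinner_scaleR_left)
    then show ?case using Suc by simp
  qed simp
  ultimately show ?thesis
    using X C by (simp add: star_repD(4)[OF rep] sharp_power_closed rep_pow[OF rep])
qed

end

section \<open>Estimates for the weights\<close>

text \<open>Each factor satisfies \<open>1 - y \<le> sqrt (1 - y) \<le> 1\<close>, and the defects of factors in \<open>[0, 1]\<close> add up at most
  linearly under multiplication.\<close>

lemma abs_one_minus_prod_sqrt_le:
  fixes y :: "'i \<Rightarrow> real"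
  assumes "finite I" "\<And>i. i \<in> I \<Longrightarrow> 0 \<le> y i \<and> y i \<le> 1"
  shows "\<bar>1 - (\<Prod>i\<in>I. sqrt (1 - y i))\<bar> \<le> (\<Sum>i\<in>I. y i)"
proof -
  have "0 \<le> (\<Prod>i\<in>I. sqrt (1 - y i)) \<and> (\<Prod>i\<in>I. sqrt (1 - y i)) \<le> 1 \<and>
      1 - (\<Sum>i\<in>I. y i) \<le> (\<Prod>i\<in>I. sqrt (1 - y i))"
    using assms
  proof (induction I rule: finite_induct)
    case (insert j J)
    define P where "P = (\<Prod>i\<in>J. sqrt (1 - y i))"
    have P: "0 \<le> P" "P \<le> 1" "1 - (\<Sum>i\<in>J. y i) \<le> P" and y: "0 \<le> y j" "y j \<le> 1"
      using insert by (auto simp: P_def)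
    have s: "1 - y j \<le> sqrt (1 - y j)" "sqrt (1 - y j) \<le> 1"
      using y by (auto intro!: real_le_rsqrt simp: power2_eq_square mult_left_le)
    have "(1 - y j) * P \<le> sqrt (1 - y j) * P" using s P by (intro mult_right_mono)
    moreover have "P - y j \<le> (1 - y j) * P" using P y mult_left_le[of P "y j"] by (simp add: algebra_simps)
    ultimately have "1 - (y j + (\<Sum>i\<in>J. y i)) \<le> sqrt (1 - y j) * P" using P by linarith
    then show ?case using insert(1,2) P s y
      by (simp add: P_def[symmetric] mult_le_one)
  qed simp
  then show ?thesis by simp
qed

lemma summable_power_progression:
  fixes p :: real
  assumes "0 < p" "p < 1" "0 < L"
  shows "summable (\<lambda>n. p ^ (i + n * L + s))"
proof -
  have "summable (\<lambda>n. p ^ (i + s) * (p ^ L) ^ n)"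
    using assms by (intro summable_mult summable_geometric) (simp add: power_less_one_iff)
  then show ?thesis by (simp add: power_add power_mult mult_ac flip: power_mult)
qed

lemma summable_weight_defect:
  fixes p :: real
  assumes "0 < p" "p < 1" "0 < L"
  shows "summable (\<lambda>n. \<bar>1 - (\<Prod>i=1..L. sqrt (1 - p ^ (i + n * L + s)))\<bar>)"
proof (rule summable_comparison_test')
  show "summable (\<lambda>n. \<Sum>i=1..L. p ^ (i + n * L + s))"
    by (intro summable_sum summable_power_progression assms)
  show "norm \<bar>1 - (\<Prod>i=1..L. sqrt (1 - p ^ (i + n * L + s)))\<bar> \<le> (\<Sum>i=1..L. p ^ (i + n * L + s))" for n
    using assms abs_one_minus_prod_sqrt_le[of "{1..L}" "\<lambda>i. p ^ (i + n * L + s)"]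
    by (simp add: power_le_one)
qed

lemma has_sum_geometric_progression:
  fixes p :: real
  assumes "0 < p" "p < 1" "0 < L" "0 < n"
  shows "((\<lambda>m. complex_of_real ((p ^ (m * L + s)) ^ n)) has_sum
    complex_of_real (p ^ (n * s) / (1 - p ^ (n * L)))) UNIV"
proof (rule norm_summable_imp_has_sum)
  have r: "norm (p ^ (n * L)) < 1" "norm (p ^ (n * L)) = p ^ (n * L)"
    using assms by (auto simp: power_less_one_iff)
  have eq: "(p ^ (m * L + s)) ^ n = p ^ (n * s) * (p ^ (n * L)) ^ m" for m
    by (simp add: power_add power_mult_distrib mult_ac flip: power_mult)
  have "(\<lambda>m. p ^ (n * s) * (p ^ (n * L)) ^ m) sums (p ^ (n * s) * (1 / (1 - p ^ (n * L))))"
    using r by (intro sums_mult geometric_sums)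
  then show "(\<lambda>m. complex_of_real ((p ^ (m * L + s)) ^ n)) sums complex_of_real (p ^ (n * s) / (1 - p ^ (n * L)))"
    unfolding eq sums_of_real_iff by simp
  have "summable (\<lambda>m. p ^ (n * s) * (p ^ (n * L)) ^ m)"
    using r by (intro summable_mult summable_geometric)
  then show "summable (\<lambda>m. norm (complex_of_real ((p ^ (m * L + s)) ^ n)))"
    unfolding norm_of_real eq using assms by (simp add: abs_mult)
qed

section \<open>The free *-algebra\<close>

lemma free_elem_expand:
  fixes x :: free_elem
  assumes "finite W" "Poly_Mapping.keys x \<subseteq> W"
  shows "x = (\<Sum>w\<in>W. Poly_Mapping.single w (Poly_Mapping.lookup x w))"
proof (rule poly_mapping_eqI)
  fix v
  have "Poly_Mapping.lookup (\<Sum>w\<in>W. Poly_Mapping.single w (Poly_Mapping.lookup x w)) v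
      = (\<Sum>w\<in>W. if w = v then Poly_Mapping.lookup x v else 0)"
    unfolding lookup_sum by (intro sum.cong refl) (simp add: lookup_single when_def)
  also have "\<dots> = Poly_Mapping.lookup x v"
    using assms by (auto simp: in_keys_iff)
  finally show "Poly_Mapping.lookup x v
      = Poly_Mapping.lookup (\<Sum>w\<in>W. Poly_Mapping.single w (Poly_Mapping.lookup x w)) v" ..
qed

lemma free_elem_induct [case_names monomial add]:
  fixes x :: free_elem
  assumes monomial: "\<And>w c. P (Poly_Mapping.single w c)"
    and add: "\<And>x y. P x \<Longrightarrow> P y \<Longrightarrow> P (x + y)"
  shows "P x"
proof -
  have "P (\<Sum>w\<in>W. Poly_Mapping.single w (Poly_Mapping.lookup x w))" if "finite W" for W
    using that
  proof (induction W rule: finite_induct)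
    case empty
    show ?case using monomial[of 0 0] by simp
  qed (simp add: monomial add)
  from this[of "Poly_Mapping.keys x"] show ?thesis
    using free_elem_expand[of "Poly_Mapping.keys x" x] by simp
qed

lemma word_star_add: "word_star (v + w) = word_star w + word_star v"
  by (simp add: word_star_def plus_star_word_def)

lemma word_star_word_star: "word_star (word_star w) = w"
  by (cases w) (simp add: word_star_def rev_map[symmetric] o_def case_prod_unfold)

lemma free_star_eq_sum:
  assumes "finite W" "Poly_Mapping.keys x \<subseteq> W"
  shows "free_star x = (\<Sum>w\<in>W. Poly_Mapping.single (word_star w) (cnj (Poly_Mapping.lookup x w)))"
  unfolding free_star_def using assms
  by (intro sum.mono_neutral_left) (auto simp: in_keys_iff)

lemma free_star_add: "free_star (x + y) = free_star x + free_star y"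
proof -
  let ?W = "Poly_Mapping.keys x \<union> Poly_Mapping.keys y"
  have "finite ?W" by simp
  then show ?thesis
    using keys_add[of x y]
    by (simp add: free_star_eq_sum[of ?W] lookup_add single_add sum.distrib)
qed

lemma free_star_single: "free_star (Poly_Mapping.single w c) = Poly_Mapping.single (word_star w) (cnj c)"
  by (subst free_star_eq_sum[of "{w}"]) auto

lemma free_star_free_star: "free_star (free_star x) = x"
  by (induction x rule: free_elem_induct) (simp_all add: free_star_single free_star_add word_star_word_star)

lemma free_star_mult: "free_star (x * y) = free_star y * free_star x"
proof (induction x rule: free_elem_induct)
  case (monomial w c)
  show ?case
    by (induction y rule: free_elem_induct)
       (simp_all add: mult_single free_star_single free_star_add word_star_add distrib_left distrib_right mult.commute)
qed (simp add: free_star_add distrib_left distrib_right)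

lemma free_star_0: "free_star 0 = 0"
  using free_star_add[of 0 0] by simp

lemma free_star_uminus: "free_star (- x) = - free_star x"
  using free_star_add[of x "- x"] by (simp add: free_star_0 add_eq_0_iff)

lemma free_star_diff: "free_star (x - y) = free_star x - free_star y"
  using free_star_add[of x "- y"] by (simp add: free_star_uminus)

lemma free_star_scalar: "free_star (scalar c) = scalar (cnj c)"
  by (simp add: scalar_def free_star_single word_star_def zero_star_word_def)

lemma scalar_1: "scalar 1 = 1"
  by (simp add: scalar_def)

lemma free_star_1: "free_star 1 = 1"
  using free_star_scalar[of 1] by (simp add: scalar_1)

lemma free_star_letter: "free_star (letter g s) = letter g (\<not> s)"
  by (simp add: letter_def free_star_single word_star_def)

lemma free_star_power: "free_star (x ^ n) = free_star x ^ n"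
  by (induction n) (simp_all add: free_star_1 free_star_mult power_commutes)

lemma scalar_mult: "scalar (c * d) = scalar c * scalar d"
  by (simp add: scalar_def mult_single)

lemma scalar_0: "scalar 0 = 0"
  by (simp add: scalar_def)

lemma scalar_minus: "scalar (- c) = - scalar c"
  by (simp add: scalar_def single_uminus)

lemma scalar_diff: "scalar (c - d) = scalar c - scalar d"
  by (simp add: scalar_def single_diff)

lemma scalar_central: "x * scalar c = scalar c * x"
  by (induction x rule: free_elem_induct)
     (simp_all add: scalar_def mult_single distrib_left distrib_right mult.commute)

lemma scalar_central_left: "x * (scalar c * y) = scalar c * (x * y)"
  by (metis mult.assoc scalar_central)

lemma scalar_scalar: "scalar c * (scalar d * x) = scalar (c * d) * x"
  by (simp only: scalar_mult mult.assoc)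

lemma single_eq_scalar_mult: "Poly_Mapping.single w c = scalar c * Poly_Mapping.single w 1"
  by (simp add: scalar_def mult_single)

lemma free_star_alg_simps [simp]:
  "carrier free_star_alg = UNIV" "mult free_star_alg = (*)" "one free_star_alg = 1"
  "zero free_star_alg = 0" "add free_star_alg = (+)"
  "smult free_star_alg = (\<lambda>c x. scalar c * x)" "star free_star_alg = free_star"
  by (simp_all add: free_star_alg_def)

lemma ring_free_star_alg: "ring free_star_alg"
proof (rule ringI)
  show "abelian_group free_star_alg"
  proof (rule abelian_groupI)
    show "\<exists>y\<in>carrier free_star_alg. y \<oplus>\<^bsub>free_star_alg\<^esub> x = \<zero>\<^bsub>free_star_alg\<^esub>" for x
      by (auto intro: exI[of _ "- x"])
  qed (simp_all add: ac_simps)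
  show "Group.monoid free_star_alg"
    by (rule monoidI) (simp_all add: mult.assoc)
qed (simp_all add: algebra_simps)

lemma ideal_free_star_algI:
  assumes "0 \<in> I" "\<And>x y. x \<in> I \<Longrightarrow> y \<in> I \<Longrightarrow> x + y \<in> I"
    and "\<And>x r. x \<in> I \<Longrightarrow> r * x \<in> I" "\<And>x r. x \<in> I \<Longrightarrow> x * r \<in> I"
  shows "ideal I free_star_alg"
proof (rule idealI[OF ring_free_star_alg])
  interpret ring free_star_alg by (rule ring_free_star_alg)
  have inv: "inv\<^bsub>add_monoid free_star_alg\<^esub> x = - x" for x
    unfolding a_inv_def[symmetric] using add.inv_equality[of "- x" x] by simp
  show "subgroup I (add_monoid free_star_alg)"
  proof
    show "inv\<^bsub>add_monoid free_star_alg\<^esub> x \<in> I" if "x \<in> I" for x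
      unfolding inv using assms(3)[OF that, of "- 1"] by simp
  qed (use assms in auto)
qed (use assms in auto)

section \<open>The quantum 3-sphere as a quotient\<close>

locale quantum_sphere =
  fixes p q \<theta> :: real
  assumes p: "0 < p" and q: "0 < q"
begin

abbreviation "J \<equiv> S3_ideal p q \<theta>"
abbreviation "S \<equiv> S3 p q \<theta>"
abbreviation "a \<equiv> letter GenA False"
abbreviation "a' \<equiv> letter GenA True"
abbreviation "b \<equiv> letter GenB False"
abbreviation "b' \<equiv> letter GenB True"

definition cl :: "free_elem \<Rightarrow> free_elem set" where
  "cl x = J +>\<^bsub>free_star_alg\<^esub> x"

lemma ideal_J: "ideal J free_star_alg"
  unfolding S3_ideal_def by (rule ring.genideal_ideal[OF ring_free_star_alg]) simp

lemma J_add: "x \<in> J \<Longrightarrow> y \<in> J \<Longrightarrow> x + y \<in> J"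
  using additive_subgroup.a_closed[OF ideal.axioms(1)[OF ideal_J]] by simp

lemma J_mult_left: "x \<in> J \<Longrightarrow> r * x \<in> J"
  using ideal.I_l_closed[OF ideal_J] by simp

lemma J_mult_right: "x \<in> J \<Longrightarrow> x * r \<in> J"
  using ideal.I_r_closed[OF ideal_J] by simp

lemma J_0: "0 \<in> J"
  using additive_subgroup.zero_closed[OF ideal.axioms(1)[OF ideal_J]] by simp

lemma J_uminus: "x \<in> J \<Longrightarrow> - x \<in> J"
  using J_mult_left[of x "- 1"] by simp

lemma J_diff: "x \<in> J \<Longrightarrow> y \<in> J \<Longrightarrow> x - y \<in> J"
  using J_add[of x "- y"] J_uminus by simp

lemma J_relator: "x \<in> S3_relators p q \<theta> \<Longrightarrow> x \<in> J"
  unfolding S3_ideal_def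
  using ring.genideal_self[OF ring_free_star_alg, of "S3_relators p q \<theta> \<union> free_star ` S3_relators p q \<theta>"]
  by auto

text \<open>The ideal is generated by a set that is stable under the star, and its preimage under the star is
  again an ideal; this preimage contains the generators.\<close>

lemma J_star: "x \<in> J \<Longrightarrow> free_star x \<in> J"
proof -
  have "ideal {x. free_star x \<in> J} free_star_alg"
    by (rule ideal_free_star_algI)
       (auto simp: free_star_0 free_star_add free_star_mult J_0 J_add J_mult_left J_mult_right)
  moreover have "S3_relators p q \<theta> \<union> free_star ` S3_relators p q \<theta> \<subseteq> {x. free_star x \<in> J}"
    unfolding S3_ideal_def
    using ring.genideal_self[OF ring_free_star_alg, of "S3_relators p q \<theta> \<union> free_star ` S3_relators p q \<theta>"]
    by (auto simp: free_star_free_star)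
  ultimately have "J \<subseteq> {x. free_star x \<in> J}"
    by (subst S3_ideal_def) (rule ring.genideal_minimal[OF ring_free_star_alg])
  then show "x \<in> J \<Longrightarrow> free_star x \<in> J" by blast
qed

lemma in_cl_iff: "y \<in> cl x \<longleftrightarrow> y - x \<in> J"
  unfolding cl_def a_r_coset_def r_coset_def
  by (auto simp: algebra_simps) (metis add.commute diff_add_cancel)

lemma cl_eq_iff: "cl x = cl y \<longleftrightarrow> x - y \<in> J"
proof
  assume "cl x = cl y"
  then show "x - y \<in> J" using in_cl_iff[of x x] in_cl_iff[of x y] J_0 by simp
next
  assume xy: "x - y \<in> J"
  have "z - x \<in> J \<longleftrightarrow> z - y \<in> J" for z
    using J_add[OF _ xy, of "z - x"] J_diff[OF _ xy, of "z - y"] by auto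
  then show "cl x = cl y" by (auto simp: in_cl_iff)
qed

lemma carrier_S: "carrier S = range cl"
  by (auto simp: S3_def quot_star_alg_def FactRing_def A_RCOSETS_def RCOSETS_def cl_def a_r_coset_def)

lemma S_mult: "cl x \<otimes>\<^bsub>S\<^esub> cl y = cl (x * y)"
  using ideal.rcoset_mult_add[OF ideal_J, of x y]
  by (simp add: S3_def quot_star_alg_def FactRing_def cl_def)

lemma S_add: "cl x \<oplus>\<^bsub>S\<^esub> cl y = cl (x + y)"
  using ideal.a_rcos_sum[OF ideal_J, of x y]
  by (simp add: S3_def quot_star_alg_def FactRing_def cl_def)

lemma S_one: "\<one>\<^bsub>S\<^esub> = cl 1"
  by (simp add: S3_def quot_star_alg_def FactRing_def cl_def)

lemma S_zero: "\<zero>\<^bsub>S\<^esub> = cl 0"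
proof -
  have "J = cl 0" by (auto simp: in_cl_iff)
  then show ?thesis by (simp add: S3_def quot_star_alg_def FactRing_def)
qed

lemma S_smult: "c \<odot>\<^bsub>S\<^esub> cl x = cl (scalar c * x)"
proof -
  have "cl (scalar c * y) = cl (scalar c * x)" if "y \<in> cl x" for y
    using that J_mult_left[of "y - x" "scalar c"] by (simp add: in_cl_iff cl_eq_iff right_diff_distrib)
  moreover have "x \<in> cl x" by (simp add: in_cl_iff J_0)
  ultimately have "(\<Union>y\<in>cl x. cl (scalar c * y)) = cl (scalar c * x)" by blast
  then show ?thesis by (simp add: S3_def quot_star_alg_def cl_def)
qed

lemma S_star: "star S (cl x) = cl (free_star x)"
proof -
  have "y \<in> free_star ` cl x \<longleftrightarrow> y \<in> cl (free_star x)" for y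
  proof
    assume "y \<in> free_star ` cl x"
    then show "y \<in> cl (free_star x)"
      using J_star by (auto simp: in_cl_iff simp flip: free_star_diff)
  next
    assume "y \<in> cl (free_star x)"
    then have "free_star (y - free_star x) \<in> J" using J_star by (auto simp: in_cl_iff)
    then have "free_star y \<in> cl x" by (simp add: free_star_diff free_star_free_star in_cl_iff)
    then show "y \<in> free_star ` cl x" by (metis free_star_free_star image_eqI)
  qed
  then show ?thesis by (auto simp: S3_def quot_star_alg_def)
qed

lemma S3_a_eq: "S3_a p q \<theta> = cl a" and S3_b_eq: "S3_b p q \<theta> = cl b"
  by (simp_all add: S3_a_def S3_b_def cl_def)

lemma abelian_group_S: "abelian_group S"
proof (rule abelian_groupI)
  show "\<exists>y\<in>carrier S. y \<oplus>\<^bsub>S\<^esub> x = \<zero>\<^bsub>S\<^esub>" if x: "x \<in> carrier S" for x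
  proof -
    obtain y where y: "x = cl y" using x by (auto simp: carrier_S)
    have "cl (- y) \<oplus>\<^bsub>S\<^esub> x = \<zero>\<^bsub>S\<^esub>" by (simp add: y S_add S_zero)
    then show ?thesis unfolding carrier_S by blast
  qed
qed (auto simp: carrier_S S_add S_zero add_ac)

lemma S_minus: "cl x \<ominus>\<^bsub>S\<^esub> cl y = cl (x - y)"
proof -
  interpret abelian_group S by (rule abelian_group_S)
  have "\<ominus>\<^bsub>S\<^esub> cl y = cl (- y)"
    by (rule minus_equality) (simp_all add: carrier_S S_add S_zero)
  then show ?thesis by (simp add: a_minus_def S_add)
qed

lemma S_power: "cl x [^]\<^bsub>S\<^esub> (n::nat) = cl (x ^ n)"
  by (induction n) (simp_all add: nat_pow_def S_one S_mult power_commutes)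

section \<open>Normal forms modulo the relations\<close>

definition cong :: "free_elem \<Rightarrow> free_elem \<Rightarrow> bool" (infix \<open>\<sim>\<^sub>J\<close> 50) where
  "x \<sim>\<^sub>J y \<longleftrightarrow> x - y \<in> J"

lemma cong_refl [simp]: "x \<sim>\<^sub>J x"
  by (simp add: cong_def J_0)

lemma cong_sym: "x \<sim>\<^sub>J y \<Longrightarrow> y \<sim>\<^sub>J x"
  using J_uminus[of "x - y"] by (simp add: cong_def)

lemma cong_trans [trans]: "x \<sim>\<^sub>J y \<Longrightarrow> y \<sim>\<^sub>J z \<Longrightarrow> x \<sim>\<^sub>J z"
  using J_add[of "x - y" "y - z"] by (simp add: cong_def)

lemma cong_add: "x \<sim>\<^sub>J x' \<Longrightarrow> y \<sim>\<^sub>J y' \<Longrightarrow> x + y \<sim>\<^sub>J x' + y'"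
  using J_add[of "x - x'" "y - y'"] by (simp add: cong_def algebra_simps)

lemma cong_diff: "x \<sim>\<^sub>J x' \<Longrightarrow> y \<sim>\<^sub>J y' \<Longrightarrow> x - y \<sim>\<^sub>J x' - y'"
  using J_diff[of "x - x'" "y - y'"] by (simp add: cong_def algebra_simps)

lemma cong_mult: "x \<sim>\<^sub>J x' \<Longrightarrow> y \<sim>\<^sub>J y' \<Longrightarrow> x * y \<sim>\<^sub>J x' * y'"
  using J_add[OF J_mult_right[of "x - x'" y] J_mult_left[of "y - y'" x']]
  by (simp add: cong_def algebra_simps)

lemma cong_left: "y \<sim>\<^sub>J y' \<Longrightarrow> x * y \<sim>\<^sub>J x * y'"
  by (rule cong_mult[OF cong_refl])

lemma cong_right: "x \<sim>\<^sub>J x' \<Longrightarrow> x * y \<sim>\<^sub>J x' * y"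
  by (rule cong_mult[OF _ cong_refl])

lemma scalar_inverse_left: "c \<noteq> 0 \<Longrightarrow> scalar (1 / c) * (scalar c * x) = x"
  by (simp add: scalar_scalar scalar_1)

definition commutes_up_to :: "complex \<Rightarrow> free_elem \<Rightarrow> free_elem \<Rightarrow> bool" where
  "commutes_up_to c x y \<longleftrightarrow> x * y \<sim>\<^sub>J scalar c * (y * x)"

lemma commutes_up_to_sym:
  assumes "commutes_up_to c x y" "c \<noteq> 0"
  shows "commutes_up_to (1 / c) y x"
proof -
  have "y * x = scalar (1 / c) * (scalar c * (y * x))"
    by (rule scalar_inverse_left[OF assms(2), symmetric])
  also have "\<dots> \<sim>\<^sub>J scalar (1 / c) * (x * y)"
    using cong_left[OF cong_sym[OF assms(1)[unfolded commutes_up_to_def]]] .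
  finally show ?thesis by (simp add: commutes_up_to_def)
qed

lemma commutes_up_to_mult:
  assumes "commutes_up_to c x z" "commutes_up_to d y z"
  shows "commutes_up_to (c * d) (x * y) z"
proof -
  have "x * y * z = x * (y * z)" by (simp add: mult.assoc)
  also have "\<dots> \<sim>\<^sub>J x * (scalar d * (z * y))"
    using assms(2) by (intro cong_left cong_right) (simp add: commutes_up_to_def)
  also have "\<dots> = scalar d * ((x * z) * y)" by (simp add: scalar_central_left mult.assoc)
  also have "\<dots> \<sim>\<^sub>J scalar d * ((scalar c * (z * x)) * y)"
    using assms(1) by (intro cong_left cong_right) (simp add: commutes_up_to_def)
  also have "\<dots> = scalar (c * d) * (z * (x * y))"
    by (simp add: mult.assoc scalar_scalar mult.commute)
  finally show ?thesis by (simp add: commutes_up_to_def)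
qed

text \<open>Inverse phases cancel in \<open>x y\<close>.  With \<open>y = x\<^sup>*\<close> this makes \<open>B\<close> commute exactly with \<open>a\<close> and \<open>a\<^sup>*\<close>.\<close>

lemma commutes_one_minus:
  assumes "commutes_up_to c x z" "commutes_up_to (1 / c) y z" "c \<noteq> 0"
  shows "commutes_up_to 1 (1 - x * y) z"
proof -
  have "x * y * z \<sim>\<^sub>J z * (x * y)"
    using commutes_up_to_mult[OF assms(1,2)] assms(3) by (simp add: commutes_up_to_def scalar_1)
  then have "z - x * y * z \<sim>\<^sub>J z - z * (x * y)" by (intro cong_diff cong_refl)
  then show ?thesis by (simp add: commutes_up_to_def scalar_1 left_diff_distrib right_diff_distrib)
qed

text \<open>Where only reordering matters the factor is kept anonymous; it has to be nonzero to make the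
  relation symmetric.\<close>

definition phase_commute :: "free_elem \<Rightarrow> free_elem \<Rightarrow> bool" where
  "phase_commute x y \<longleftrightarrow> (\<exists>c. c \<noteq> 0 \<and> commutes_up_to c x y)"

lemma phase_commuteI: "commutes_up_to c x y \<Longrightarrow> c \<noteq> 0 \<Longrightarrow> phase_commute x y"
  by (auto simp: phase_commute_def)

lemma phase_commute_sym: "phase_commute x y \<Longrightarrow> phase_commute y x"
  unfolding phase_commute_def using commutes_up_to_sym by (metis divide_eq_0_iff one_neq_zero)

lemma phase_commute_mult: "phase_commute x z \<Longrightarrow> phase_commute y z \<Longrightarrow> phase_commute (x * y) z"
  unfolding phase_commute_def using commutes_up_to_mult by (metis mult_eq_0_iff)

lemma phase_commute_power: "phase_commute x z \<Longrightarrow> phase_commute (x ^ n) z"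
proof (induction n)
  case 0
  show ?case by (rule phase_commuteI[of 1]) (simp_all add: commutes_up_to_def scalar_1)
qed (simp add: phase_commute_mult)

lemma phase_commute_powers: "phase_commute x y \<Longrightarrow> phase_commute (x ^ m) (y ^ n)"
  using phase_commute_power phase_commute_sym by blast

lemma power_phase_commute:
  assumes "phase_commute x y"
  shows "\<exists>c. c \<noteq> 0 \<and> (x * y) ^ n \<sim>\<^sub>J scalar c * (x ^ n * y ^ n)"
proof (induction n)
  case 0
  show ?case by (intro exI[of _ 1]) (simp add: scalar_1)
next
  case (Suc n)
  then obtain c where c: "c \<noteq> 0" "(x * y) ^ n \<sim>\<^sub>J scalar c * (x ^ n * y ^ n)" by blast
  obtain d where d: "d \<noteq> 0" "y * x ^ n \<sim>\<^sub>J scalar d * (x ^ n * y)"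
    using phase_commute_sym[OF phase_commute_power[OF assms, of n]]
    by (auto simp: phase_commute_def commutes_up_to_def)
  have "(x * y) ^ Suc n \<sim>\<^sub>J (x * y) * (scalar c * (x ^ n * y ^ n))"
    unfolding power_Suc using c(2) by (rule cong_left)
  also have "\<dots> = scalar c * (x * (y * x ^ n) * y ^ n)"
    by (simp add: scalar_central_left[of x] scalar_central_left[of y] mult.assoc)
  also have "\<dots> \<sim>\<^sub>J scalar c * (x * (scalar d * (x ^ n * y)) * y ^ n)"
    using d(2) by (intro cong_left cong_right)
  also have "\<dots> = scalar (c * d) * (x ^ Suc n * y ^ Suc n)"
    by (simp add: scalar_central_left[of x] mult.assoc scalar_scalar)
  finally show ?case using c(1) d(1) by (intro exI[of _ "c * d"]) simp
qed

text \<open>The power \<open>x\<^sup>#\<^sup>m\<close>, where \<open>x'\<close> stands for \<open>x\<^sup>*\<close>.\<close>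

definition sharp :: "free_elem \<Rightarrow> free_elem \<Rightarrow> int \<Rightarrow> free_elem" where
  "sharp x x' m = (if m \<ge> 0 then x ^ nat m else x' ^ nat (- m))"

lemma sharp_of_nat: "sharp x x' (int n) = x ^ n"
  by (simp add: sharp_def)

lemma sharp_minus_of_nat: "sharp x x' (- int n) = x' ^ n"
  by (cases "n = 0") (simp_all add: sharp_def)

lemma phase_commute_sharp:
  "phase_commute x z \<Longrightarrow> phase_commute x' z \<Longrightarrow> phase_commute (sharp x x' m) z"
  by (simp add: sharp_def phase_commute_power)

text \<open>The relation \<open>x\<^sup>* x = r x x\<^sup>* + 1 - r\<close> of the quantum disc expresses \<open>x\<^sup>* x\<close> as well as \<open>x x\<^sup>*\<close> by
  \<open>X = 1 - x x\<^sup>*\<close>.  Multiplying it by \<open>x\<close> on the left or by \<open>x\<^sup>*\<close> on the right shows that \<open>X\<close> passes these letters at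
  the cost of a factor \<open>r\<close>.\<close>

lemma disc_relations:
  assumes rel: "x' * x - scalar r * x * x' - scalar (1 - r) \<in> J"
  defines "X \<equiv> 1 - x * x'"
  shows "x' * x \<sim>\<^sub>J 1 - scalar r * X"
    and "commutes_up_to r X x"
    and "commutes_up_to r x' X"
proof -
  show 1: "x' * x \<sim>\<^sub>J 1 - scalar r * X"
    using rel by (simp add: cong_def X_def scalar_diff scalar_1 algebra_simps)
  have "X * x = x - x * (x' * x)" by (simp add: X_def algebra_simps)
  also have "\<dots> \<sim>\<^sub>J x - x * (1 - scalar r * X)" by (rule cong_diff[OF cong_refl cong_left[OF 1]])
  also have "\<dots> = scalar r * (x * X)" by (simp add: right_diff_distrib scalar_central_left[of x])
  finally show "commutes_up_to r X x" by (simp add: commutes_up_to_def)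
  have "x' * X = x' - (x' * x) * x'" by (simp add: X_def algebra_simps)
  also have "\<dots> \<sim>\<^sub>J x' - (1 - scalar r * X) * x'" by (rule cong_diff[OF cong_refl cong_right[OF 1]])
  also have "\<dots> = scalar r * (X * x')" by (simp add: left_diff_distrib mult.assoc)
  finally show "commutes_up_to r x' X" by (simp add: commutes_up_to_def)
qed

lemma disc_step_aux:
  assumes "phase_commute y X" "z \<sim>\<^sub>J 1 - scalar r * X"
  shows "\<exists>\<alpha> \<beta>. y * z \<sim>\<^sub>J (scalar \<alpha> + scalar \<beta> * X) * y"
proof -
  obtain c where c: "y * X \<sim>\<^sub>J scalar c * (X * y)"
    using assms(1) by (auto simp: phase_commute_def commutes_up_to_def)
  have "y * z \<sim>\<^sub>J y * (1 - scalar r * X)" using assms(2) by (intro cong_left cong_right)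
  also have "\<dots> = y - scalar r * (y * X)" by (simp add: right_diff_distrib scalar_central_left[of y])
  also have "\<dots> \<sim>\<^sub>J y - scalar r * (scalar c * (X * y))" by (rule cong_diff[OF cong_refl cong_left[OF c]])
  also have "\<dots> = (scalar 1 + scalar (- (r * c)) * X) * y"
    by (simp add: scalar_1 scalar_minus scalar_scalar left_diff_distrib mult.assoc)
  finally show ?thesis by blast
qed

text \<open>Appending a letter to \<open>x\<^sup>#\<^sup>m\<close> either lengthens the power or cancels against its last letter; the
  cancellation leaves a polynomial in \<open>X\<close>, which can be moved to the front.\<close>

lemma disc_step:
  assumes rel: "x' * x - scalar r * x * x' - scalar (1 - r) \<in> J" and r: "r \<noteq> 0"
  shows "\<exists>\<alpha> \<beta>. sharp x x' m * x \<sim>\<^sub>J (scalar \<alpha> + scalar \<beta> * (1 - x * x')) * sharp x x' (m + 1)"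
    and "\<exists>\<alpha> \<beta>. sharp x x' m * x' \<sim>\<^sub>J (scalar \<alpha> + scalar \<beta> * (1 - x * x')) * sharp x x' (m - 1)"
proof -
  note D = disc_relations[OF rel]
  have pc: "phase_commute (x' ^ j) (1 - x * x')" "phase_commute (x ^ j) (1 - x * x')" for j
    using phase_commuteI[OF D(3) r] phase_commuteI[OF commutes_up_to_sym[OF D(2) r]] r
    by (auto intro: phase_commute_power)
  have triv: "\<exists>\<alpha> \<beta>. y \<sim>\<^sub>J (scalar \<alpha> + scalar \<beta> * (1 - x * x')) * y" for y
    by (intro exI[of _ 1] exI[of _ 0]) (simp add: scalar_1 scalar_0)
  show "\<exists>\<alpha> \<beta>. sharp x x' m * x \<sim>\<^sub>J (scalar \<alpha> + scalar \<beta> * (1 - x * x')) * sharp x x' (m + 1)"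
  proof (cases "m \<ge> 0")
    case True
    then obtain n where n: "m = int n" using zero_le_imp_eq_int by blast
    have "sharp x x' m * x = sharp x x' (m + 1)"
      using sharp_of_nat[of x x' n] sharp_of_nat[of x x' "Suc n"]
      by (simp only: n of_nat_Suc power_Suc2 add.commute)
    then show ?thesis using triv[of "sharp x x' (m + 1)"] by simp
  next
    case False
    then obtain j where j: "m = - int (Suc j)" using int_cases[of m] by fastforce
    have "sharp x x' m * x = x' ^ j * (x' * x)"
      unfolding j sharp_minus_of_nat by (simp only: power_Suc2 mult.assoc)
    moreover have "m + 1 = - int j" by (simp add: j)
    ultimately show ?thesis
      using disc_step_aux[OF pc(1)[of j] D(1)] by (simp only: sharp_minus_of_nat)
  qed
  show "\<exists>\<alpha> \<beta>. sharp x x' m * x' \<sim>\<^sub>J (scalar \<alpha> + scalar \<beta> * (1 - x * x')) * sharp x x' (m - 1)"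
  proof (cases "m > 0")
    case True
    then obtain j where j: "m = int (Suc j)" by (metis pos_int_cases gr0_implies_Suc)
    have "sharp x x' m * x' = x ^ j * (x * x')"
      unfolding j sharp_of_nat by (simp only: power_Suc2 mult.assoc)
    moreover have "m - 1 = int j" by (simp add: j)
    moreover have "x * x' \<sim>\<^sub>J 1 - scalar 1 * (1 - x * x')" by (simp add: scalar_1)
    ultimately show ?thesis
      using disc_step_aux[OF pc(2)[of j]] by (simp only: sharp_of_nat)
  next
    case False
    then obtain n where n: "m = - int n" by (metis int_cases2 of_nat_0_less_iff less_numeral_extra(3) neq0_conv of_nat_0 minus_zero)
    have "m - 1 = - int (Suc n)" by (simp add: n)
    then have "sharp x x' m * x' = sharp x x' (m - 1)"
      by (simp only: n sharp_minus_of_nat power_Suc2)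
    then show ?thesis using triv[of "sharp x x' (m - 1)"] by simp
  qed
qed

definition letter_degree :: "gen \<Rightarrow> gen \<times> bool \<Rightarrow> int" where
  "letter_degree g x = (if fst x = g then if snd x then - 1 else 1 else 0)"

definition word_degree :: "gen \<Rightarrow> star_word \<Rightarrow> int" where
  "word_degree g w = (\<Sum>x\<leftarrow>letters w. letter_degree g x)"

definition phase :: complex where
  "phase = exp (2 * pi * \<i> * \<theta>)"

lemma phase_nonzero: "phase \<noteq> 0" and exp_phase: "exp (- (2 * pi * \<i> * \<theta>)) = 1 / phase"
  by (simp_all add: phase_def exp_minus field_simps)

lemma generator_relations:
  "commutes_up_to phase a b" "commutes_up_to (1 / phase) a b'"
  "commutes_up_to phase b a'" "commutes_up_to (1 / phase) b' a'"
  "a' * a - scalar p * a * a' - scalar (1 - complex_of_real p) \<in> J"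
  "b' * b - scalar q * b * b' - scalar (1 - complex_of_real q) \<in> J"
proof -
  have ab: "a * b - scalar phase * b * a \<in> J"
    by (rule J_relator) (simp add: S3_relators_def phase_def Let_def)
  have ab': "a * b' - scalar (1 / phase) * b' * a \<in> J"
    by (rule J_relator) (simp add: S3_relators_def Let_def flip: exp_phase)
  show "commutes_up_to phase a b" "commutes_up_to (1 / phase) a b'"
    using ab ab' by (simp_all add: commutes_up_to_def cong_def mult.assoc)
  have c: "cnj phase = 1 / phase" unfolding exp_phase[symmetric] by (simp add: phase_def exp_cnj)
  have c': "cnj (1 / phase) = phase" using c phase_nonzero by (metis complex_cnj_cnj)
  show "commutes_up_to phase b a'" "commutes_up_to (1 / phase) b' a'"
    using J_star[OF ab] J_star[OF ab']
    by (simp_all add: free_star_diff free_star_mult free_star_letter free_star_scalar c c'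
        scalar_central commutes_up_to_def cong_def mult.assoc del: complex_cnj_divide)
  show "a' * a - scalar p * a * a' - scalar (1 - complex_of_real p) \<in> J" "b' * b - scalar q * b * b' - scalar (1 - complex_of_real q) \<in> J"
    by (rule J_relator, simp add: S3_relators_def Let_def)+
qed

abbreviation "A \<equiv> 1 - a * a'"
abbreviation "B \<equiv> 1 - b * b'"

lemma phase_commute_generators:
  "phase_commute a b" "phase_commute a b'" "phase_commute a' b" "phase_commute a' b'"
  "phase_commute a B" "phase_commute a' B"
proof -
  note R = generator_relations
  note nz = phase_nonzero
  show "phase_commute a b" "phase_commute a b'" "phase_commute a' b" "phase_commute a' b'"
    using phase_commuteI[OF R(1)] phase_commuteI[OF R(2)]
      phase_commute_sym[OF phase_commuteI[OF R(3)]] phase_commute_sym[OF phase_commuteI[OF R(4)]] nz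
    by simp_all
  have Ba: "commutes_up_to 1 B a"
    using commutes_one_minus[of "1 / phase" b a b'] commutes_up_to_sym[OF R(1)] commutes_up_to_sym[OF R(2)] nz
    by simp
  have Ba': "commutes_up_to 1 B a'"
    using commutes_one_minus[of phase b a' b'] R(3,4) nz by simp
  show "phase_commute a B" "phase_commute a' B"
    using phase_commute_sym[OF phase_commuteI[OF Ba]] phase_commute_sym[OF phase_commuteI[OF Ba']]
    by simp_all
qed

abbreviation "M m n \<equiv> sharp a a' m * sharp b b' n"

text \<open>A letter \<open>a\<close> or \<open>a\<^sup>*\<close> first moves left past the \<open>b\<close>'s; a letter \<open>b\<close> or \<open>b\<^sup>*\<close> may produce a \<open>B\<close>, which
  then moves left past the \<open>a\<close>'s.\<close>

lemma M_times_letter: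
  "\<exists>\<alpha> \<beta> X. X \<in> {A, B} \<and>
     M m n * letter g s \<sim>\<^sub>J (scalar \<alpha> + scalar \<beta> * X)
       * M (m + letter_degree GenA (g, s)) (n + letter_degree GenB (g, s))"
proof -
  have pr: "complex_of_real p \<noteq> 0" "complex_of_real q \<noteq> 0" using p q by auto
  have stepA: "\<exists>\<alpha> \<beta>. sharp a a' m * letter GenA s \<sim>\<^sub>J (scalar \<alpha> + scalar \<beta> * A) * sharp a a' (m + letter_degree GenA (GenA, s))"
    using disc_step[OF generator_relations(5) pr(1), of m] by (cases s) (simp_all add: letter_degree_def)
  have stepB: "\<exists>\<alpha> \<beta>. sharp b b' n * letter GenB s \<sim>\<^sub>J (scalar \<alpha> + scalar \<beta> * B) * sharp b b' (n + letter_degree GenB (GenB, s))"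
    using disc_step[OF generator_relations(6) pr(2), of n] by (cases s) (simp_all add: letter_degree_def)
  show ?thesis
  proof (cases g)
    case GenA
    have "phase_commute (sharp b b' n) (letter GenA s)"
      using phase_commute_generators by (cases s) (auto intro!: phase_commute_sharp intro: phase_commute_sym)
    then obtain c where c: "sharp b b' n * letter GenA s \<sim>\<^sub>J scalar c * (letter GenA s * sharp b b' n)"
      by (auto simp: phase_commute_def commutes_up_to_def)
    obtain \<alpha> \<beta> where ab: "sharp a a' m * letter GenA s \<sim>\<^sub>J (scalar \<alpha> + scalar \<beta> * A) * sharp a a' (m + letter_degree GenA (GenA, s))"
      using stepA by blast
    have "M m n * letter GenA s \<sim>\<^sub>J sharp a a' m * (scalar c * (letter GenA s * sharp b b' n))"
      unfolding mult.assoc using c by (intro cong_left cong_right)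
    also have "\<dots> = scalar c * ((sharp a a' m * letter GenA s) * sharp b b' n)"
      by (simp add: scalar_central_left[of "sharp a a' m"] mult.assoc)
    also have "\<dots> \<sim>\<^sub>J scalar c * (((scalar \<alpha> + scalar \<beta> * A) * sharp a a' (m + letter_degree GenA (GenA, s))) * sharp b b' n)"
      using ab by (intro cong_left cong_right)
    also have "\<dots> = (scalar (c * \<alpha>) + scalar (c * \<beta>) * A) * M (m + letter_degree GenA (GenA, s)) n"
      unfolding scalar_mult mult.assoc distrib_left[of "scalar c", symmetric] ..
    finally show ?thesis
      unfolding GenA by (intro exI[of _ "c * \<alpha>"] exI[of _ "c * \<beta>"] exI[of _ A]) (simp add: letter_degree_def)
  next
    case GenB
    have "phase_commute (sharp a a' m) B"
      using phase_commute_generators by (intro phase_commute_sharp)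
    then obtain c where c: "sharp a a' m * B \<sim>\<^sub>J scalar c * (B * sharp a a' m)"
      by (auto simp: phase_commute_def commutes_up_to_def)
    obtain \<alpha> \<beta> where ab: "sharp b b' n * letter GenB s \<sim>\<^sub>J (scalar \<alpha> + scalar \<beta> * B) * sharp b b' (n + letter_degree GenB (GenB, s))"
      using stepB by blast
    let ?y = "sharp b b' (n + letter_degree GenB (GenB, s))"
    have "M m n * letter GenB s \<sim>\<^sub>J sharp a a' m * ((scalar \<alpha> + scalar \<beta> * B) * ?y)"
      unfolding mult.assoc using ab by (intro cong_left cong_right)
    also have "\<dots> = (scalar \<alpha> * sharp a a' m + scalar \<beta> * (sharp a a' m * B)) * ?y"
      by (simp add: distrib_left distrib_right scalar_central_left[of "sharp a a' m"] mult.assoc)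
    also have "\<dots> \<sim>\<^sub>J (scalar \<alpha> * sharp a a' m + scalar \<beta> * (scalar c * (B * sharp a a' m))) * ?y"
      using c by (intro cong_right cong_add cong_left cong_refl)
    also have "\<dots> = (scalar \<alpha> + scalar (\<beta> * c) * B) * M m (n + letter_degree GenB (GenB, s))"
      by (simp add: scalar_mult distrib_right mult.assoc)
    finally show ?thesis
      unfolding GenB by (intro exI[of _ \<alpha>] exI[of _ "\<beta> * c"] exI[of _ B]) (simp add: letter_degree_def)
  qed
qed

text \<open>Induction on the word, appending letters on the right so that the coefficient in the subalgebra \<open>G\<close>
  stays on the left and is never moved.\<close>

lemma word_normal_form:
  assumes G: "\<And>x y. x \<in> G \<Longrightarrow> y \<in> G \<Longrightarrow> x + y \<in> G" "\<And>x y. x \<in> G \<Longrightarrow> y \<in> G \<Longrightarrow> x * y \<in> G"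
    "\<And>c. scalar c \<in> G" "A \<in> G" "B \<in> G"
  shows "\<exists>f\<in>G. Poly_Mapping.single w 1 \<sim>\<^sub>J f * M (word_degree GenA w) (word_degree GenB w)"
proof -
  have "\<exists>f\<in>G. Poly_Mapping.single (Star_Word xs) 1
      \<sim>\<^sub>J f * M (word_degree GenA (Star_Word xs)) (word_degree GenB (Star_Word xs))" for xs
  proof (induction xs rule: rev_induct)
    case Nil
    have "word_degree g (Star_Word []) = 0" for g by (simp add: word_degree_def)
    moreover have "Poly_Mapping.single (Star_Word []) 1 = (1 :: free_elem)"
      by (simp flip: zero_star_word_def)
    ultimately show ?case using G(3)[of 1]
      by (intro bexI[of _ "scalar 1"]) (simp_all add: sharp_def scalar_1)
  next
    case (snoc x xs)
    obtain g s where x: "x = (g, s)" by fastforce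
    let ?m = "word_degree GenA (Star_Word xs)" and ?n = "word_degree GenB (Star_Word xs)"
    obtain f where f: "f \<in> G" "Poly_Mapping.single (Star_Word xs) 1 \<sim>\<^sub>J f * M ?m ?n"
      using snoc by blast
    obtain \<alpha> \<beta> X where X: "X \<in> {A, B}" and step: "M ?m ?n * letter g s
        \<sim>\<^sub>J (scalar \<alpha> + scalar \<beta> * X) * M (?m + letter_degree GenA (g, s)) (?n + letter_degree GenB (g, s))"
      using M_times_letter by blast
    have "Poly_Mapping.single (Star_Word (xs @ [x])) 1 = Poly_Mapping.single (Star_Word xs) (1::complex) * letter g s"
      by (simp add: letter_def mult_single plus_star_word_def x)
    also have "\<dots> \<sim>\<^sub>J (f * M ?m ?n) * letter g s" using f(2) by (intro cong_left cong_right)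
    also have "\<dots> = f * (M ?m ?n * letter g s)" by (simp add: mult.assoc)
    also have "\<dots> \<sim>\<^sub>J f * ((scalar \<alpha> + scalar \<beta> * X) * M (?m + letter_degree GenA (g, s)) (?n + letter_degree GenB (g, s)))"
      using step by (intro cong_left cong_right)
    also have "\<dots> = (f * (scalar \<alpha> + scalar \<beta> * X))
        * M (word_degree GenA (Star_Word (xs @ [x]))) (word_degree GenB (Star_Word (xs @ [x])))"
      by (simp add: word_degree_def x mult.assoc)
    finally show ?case
      using X f(1) G by (intro bexI[of _ "f * (scalar \<alpha> + scalar \<beta> * X)"]) auto
  qed
  from this[of "letters w"] show ?thesis by simp
qed

text \<open>The representative in the free algebra of the generator \<open>C\<^sub>\<plusminus>\<close>.\<close>

definition C :: "nat \<Rightarrow> int \<Rightarrow> free_elem" where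
  "C k l = (if l > 0 then a else a') ^ nat \<bar>l\<bar> * b' ^ k"

lemma free_star_C: "free_star (C k l) = b ^ k * (if l > 0 then a' else a) ^ nat \<bar>l\<bar>"
  by (simp add: C_def free_star_mult free_star_power free_star_letter)

text \<open>Both sides contain \<open>|l j|\<close> letters \<open>a\<close> or \<open>a\<^sup>*\<close> and \<open>k |j|\<close> letters \<open>b\<close> or \<open>b\<^sup>*\<close>, with the same stars,
  and differ only by reordering.\<close>

lemma M_degree_zero:
  assumes "k > 0" "l \<noteq> 0" and x: "x = (if j \<ge> 0 then C k l else free_star (C k l))"
  shows "\<exists>c. M (l * j) (- int k * j) \<sim>\<^sub>J scalar c * x ^ nat \<bar>j\<bar>"
proof -
  let ?j = "nat \<bar>j\<bar>" and ?l = "nat \<bar>l\<bar>"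
  \<comment> \<open>the letters that make up \<open>x\<close>, and hence \<open>a\<^sup>#\<^sup>l\<^sup>j\<close> and \<open>b\<^sup>#\<^sup>-\<^sup>k\<^sup>j\<close>\<close>
  define y where "y = (if (l > 0) = (j \<ge> 0) then a else a')"
  define z where "z = (if j \<ge> 0 then b' else b)"
  have yz: "phase_commute y z" using phase_commute_generators by (simp add: y_def z_def)
  have M: "M (l * j) (- int k * j) = (y ^ ?l) ^ ?j * (z ^ k) ^ ?j"
  proof -
    have "sharp a a' (l * j) = y ^ (?l * ?j)"
    proof (cases "l * j \<ge> 0")
      case True
      then have "l * j = int (?l * ?j)" by (simp add: abs_mult[symmetric] nat_mult_distrib)
      moreover from True have "j = 0 \<or> y = a" using assms(2) by (auto simp: y_def zero_le_mult_iff)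
      ultimately show ?thesis by (auto simp only: sharp_of_nat) simp
    next
      case False
      then have "l * j = - int (?l * ?j)" by (simp add: abs_mult[symmetric] nat_mult_distrib)
      moreover from False have "y = a'" using assms(2) by (auto simp: y_def zero_le_mult_iff)
      ultimately show ?thesis by (simp only: sharp_minus_of_nat)
    qed
    moreover have "sharp b b' (- int k * j) = z ^ (k * ?j)"
    proof (cases "j \<ge> 0")
      case True
      then have "- int k * j = - int (k * ?j)" by simp
      with True show ?thesis by (simp only: sharp_minus_of_nat z_def if_True)
    next
      case False
      then have "- int k * j = int (k * ?j)" by simp
      with False show ?thesis by (simp only: sharp_of_nat z_def if_False)
    qed
    ultimately show ?thesis by (simp add: power_mult)
  qed
  have pc: "phase_commute (y ^ ?l) (z ^ k)" by (rule phase_commute_powers[OF yz])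
  have "\<exists>c. c \<noteq> 0 \<and> x ^ ?j \<sim>\<^sub>J scalar c * ((y ^ ?l) ^ ?j * (z ^ k) ^ ?j)"
  proof (cases "j \<ge> 0")
    case True
    then have "x = y ^ ?l * z ^ k" by (simp add: x C_def y_def z_def)
    then show ?thesis using power_phase_commute[OF pc] by simp
  next
    case False
    then have "x = z ^ k * y ^ ?l" using assms(2) by (auto simp: x free_star_C y_def z_def)
    then obtain c where c: "c \<noteq> 0" "x ^ ?j \<sim>\<^sub>J scalar c * ((z ^ k) ^ ?j * (y ^ ?l) ^ ?j)"
      using power_phase_commute[OF phase_commute_sym[OF pc]] by blast
    obtain d where d: "d \<noteq> 0" "(z ^ k) ^ ?j * (y ^ ?l) ^ ?j \<sim>\<^sub>J scalar d * ((y ^ ?l) ^ ?j * (z ^ k) ^ ?j)"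
      using phase_commute_sym[OF phase_commute_powers[OF pc]]
      by (auto simp: phase_commute_def commutes_up_to_def)
    have "x ^ ?j \<sim>\<^sub>J scalar c * (scalar d * ((y ^ ?l) ^ ?j * (z ^ k) ^ ?j))"
      using cong_trans[OF c(2) cong_left[OF d(2)]] .
    then show ?thesis using c d by (intro exI[of _ "c * d"]) (simp add: scalar_scalar)
  qed
  then obtain c where c: "c \<noteq> 0" "x ^ ?j \<sim>\<^sub>J scalar c * ((y ^ ?l) ^ ?j * (z ^ k) ^ ?j)" by blast
  have "scalar (1 / c) * (scalar c * ((y ^ ?l) ^ ?j * (z ^ k) ^ ?j)) \<sim>\<^sub>J scalar (1 / c) * x ^ ?j"
    by (rule cong_left[OF cong_sym[OF c(2)]])
  then have "(y ^ ?l) ^ ?j * (z ^ k) ^ ?j \<sim>\<^sub>J scalar (1 / c) * x ^ ?j"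
    by (simp only: scalar_inverse_left[OF c(1)])
  then show ?thesis unfolding M by blast
qed

text \<open>Coprimality enters here: from \<open>k m + l n = 0\<close> it follows that \<open>l\<close> divides \<open>m\<close>, so the letters of the
  normal form group into whole powers of \<open>C\<close> or \<open>C\<^sup>*\<close>.\<close>

lemma degree_zero_word_generated:
  assumes kl: "k > 0" "l \<noteq> 0" "coprime (int k) l"
    and deg: "int k * word_degree GenA w + l * word_degree GenB w = 0"
    and G: "\<And>x y. x \<in> G \<Longrightarrow> x \<sim>\<^sub>J y \<Longrightarrow> y \<in> G"
      "\<And>x y. x \<in> G \<Longrightarrow> y \<in> G \<Longrightarrow> x + y \<in> G" "\<And>x y. x \<in> G \<Longrightarrow> y \<in> G \<Longrightarrow> x * y \<in> G"
      "\<And>c. scalar c \<in> G" "A \<in> G" "B \<in> G" "C k l \<in> G" "free_star (C k l) \<in> G"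
  shows "Poly_Mapping.single w c \<in> G"
proof -
  have "l dvd int k * word_degree GenA w"
    using deg by (metis add.inverse_inverse dvd_minus_iff dvd_triv_left eq_neg_iff_add_eq_0)
  then have "l dvd word_degree GenA w"
    using kl(3) by (simp add: coprime_dvd_mult_right_iff coprime_commute)
  then obtain j where j: "word_degree GenA w = l * j" by blast
  with deg kl(2) have j': "word_degree GenB w = - int k * j"
    by (metis (no_types, lifting) add.commute add_eq_0_iff mult.left_commute mult_cancel_left mult_minus_left mult_minus_right)
  define x where "x = (if j \<ge> 0 then C k l else free_star (C k l))"
  have "x \<in> G" using G by (simp add: x_def)
  have xp: "x ^ n \<in> G" for n
  proof (induction n)
    case 0
    show ?case using G(4)[of 1] by (simp add: scalar_1)
  qed (simp add: G \<open>x \<in> G\<close>)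
  obtain d where d: "M (l * j) (- int k * j) \<sim>\<^sub>J scalar d * x ^ nat \<bar>j\<bar>"
    using M_degree_zero[OF kl(1,2) x_def] by blast
  have "M (l * j) (- int k * j) \<in> G"
    using G(1)[OF G(3)[OF G(4) xp] cong_sym[OF d]] .
  moreover obtain f where f: "f \<in> G" "Poly_Mapping.single w 1 \<sim>\<^sub>J f * M (l * j) (- int k * j)"
    using word_normal_form[OF G(2,3,4,5,6), of w] by (auto simp: j j')
  ultimately have "Poly_Mapping.single w 1 \<in> G"
    using G(1)[OF G(3) cong_sym] by blast
  then have "scalar c * Poly_Mapping.single w 1 \<in> G" using G(3,4) by blast
  then show ?thesis by (simp only: single_eq_scalar_mult[of w c])
qed

end

section \<open>The fixed point algebra\<close>

locale weighted_sphere = quantum_sphere +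
  fixes k :: nat and l :: int and \<rho> :: "free_elem set \<Rightarrow> int \<Rightarrow> free_elem set"
  assumes k: "0 < k" and l: "l \<noteq> 0" and coprime: "coprime (int k) l"
    and coaction: "U1_coaction p q \<theta> k l \<rho>"
begin

abbreviation "R \<equiv> fixed_point_alg S \<rho>"

lemma rho_mult: "\<rho> (cl (x * y)) n
    = (\<Oplus>\<^bsub>S\<^esub>i\<in>{i. \<rho> (cl x) i \<noteq> \<zero>\<^bsub>S\<^esub>}. \<rho> (cl x) i \<otimes>\<^bsub>S\<^esub> \<rho> (cl y) (n - i))"
  unfolding S_mult[symmetric] using coaction
  by (simp add: U1_coaction_def star_hom_def carrier_S tensor_U1_def)

lemma rho_add: "\<rho> (cl (x + y)) n = \<rho> (cl x) n \<oplus>\<^bsub>S\<^esub> \<rho> (cl y) n"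
  and rho_scalar: "\<rho> (cl (scalar c * x)) n = c \<odot>\<^bsub>S\<^esub> \<rho> (cl x) n"
  and rho_star: "\<rho> (cl (free_star x)) n = star S (\<rho> (cl x) (- n))"
  and rho_1: "\<rho> (cl 1) n = (if n = 0 then \<one>\<^bsub>S\<^esub> else \<zero>\<^bsub>S\<^esub>)"
  unfolding S_add[symmetric] S_smult[symmetric] S_star[symmetric] S_one[symmetric]
  using coaction by (simp_all add: U1_coaction_def star_hom_def carrier_S tensor_U1_def S_one)

text \<open>The predicate depends only on the class of \<open>x\<close>.  The zero class is homogeneous of every degree.\<close>

definition homogeneous :: "free_elem \<Rightarrow> int \<Rightarrow> bool" where
  "homogeneous x m \<longleftrightarrow> \<rho> (cl x) = tensor_u S (cl x) m"

lemma homogeneous_a: "homogeneous a (int k)" and homogeneous_b: "homogeneous b l"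
  using coaction by (simp_all add: homogeneous_def U1_coaction_def S3_a_eq S3_b_eq)

lemma homogeneous_1: "homogeneous 1 0"
  by (simp add: homogeneous_def fun_eq_iff rho_1 tensor_u_def S_one)

lemma homogeneous_add: "homogeneous x m \<Longrightarrow> homogeneous y m \<Longrightarrow> homogeneous (x + y) m"
  by (simp add: homogeneous_def fun_eq_iff rho_add tensor_u_def S_zero S_add)

lemma homogeneous_scalar: "homogeneous x m \<Longrightarrow> homogeneous (scalar c * x) m"
  by (simp add: homogeneous_def fun_eq_iff rho_scalar tensor_u_def S_zero S_smult)

lemma homogeneous_diff: "homogeneous x m \<Longrightarrow> homogeneous y m \<Longrightarrow> homogeneous (x - y) m"
  using homogeneous_add[of x m "scalar (- 1) * y"] homogeneous_scalar[of y m "- 1"]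
  by (simp add: scalar_minus scalar_1)

lemma homogeneous_star: "homogeneous x m \<Longrightarrow> homogeneous (free_star x) (- m)"
  by (auto simp add: homogeneous_def fun_eq_iff rho_star tensor_u_def S_zero S_star free_star_0)

lemma homogeneous_mult:
  assumes "homogeneous x m" "homogeneous y n"
  shows "homogeneous (x * y) (m + n)"
proof -
  interpret abelian_group S by (rule abelian_group_S)
  have x: "\<rho> (cl x) = tensor_u S (cl x) m" and y: "\<rho> (cl y) = tensor_u S (cl y) n"
    using assms by (simp_all add: homogeneous_def)
  \<comment> \<open>the convolution runs over the support of \<open>\<rho> (cl x)\<close>, which is empty if \<open>cl x\<close> is zero and \<open>{m}\<close> otherwise\<close>
  have "\<rho> (cl (x * y)) j = tensor_u S (cl (x * y)) (m + n) j" for j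
  proof (cases "cl x = \<zero>\<^bsub>S\<^esub>")
    case True
    then have xy: "cl (x * y) = \<zero>\<^bsub>S\<^esub>"
      using S_mult[of x y] S_mult[of 0 y] by (simp add: S_zero)
    have "{i. tensor_u S (cl x) m i \<noteq> \<zero>\<^bsub>S\<^esub>} = {}" using True by (auto simp: tensor_u_def)
    then have "\<rho> (cl (x * y)) j = \<zero>\<^bsub>S\<^esub>"
      by (simp only: rho_mult x finsum_empty)
    then show ?thesis by (simp add: xy tensor_u_def)
  next
    case False
    then have "{i. tensor_u S (cl x) m i \<noteq> \<zero>\<^bsub>S\<^esub>} = {m}" by (auto simp: tensor_u_def)
    then have "\<rho> (cl (x * y)) j = (\<Oplus>\<^bsub>S\<^esub>i\<in>{m}. tensor_u S (cl x) m i \<otimes>\<^bsub>S\<^esub> tensor_u S (cl y) n (j - i))"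
      by (simp only: rho_mult x y)
    also have "\<dots> = cl x \<otimes>\<^bsub>S\<^esub> tensor_u S (cl y) n (j - m)"
      by (subst finsum_insert) (auto simp: tensor_u_def S_zero S_mult S_add carrier_S)
    finally show ?thesis by (auto simp: tensor_u_def S_zero S_mult)
  qed
  then show ?thesis by (simp add: homogeneous_def fun_eq_iff)
qed

lemma homogeneous_power: "homogeneous x m \<Longrightarrow> homogeneous (x ^ n) (int n * m)"
  by (induction n) (auto simp: homogeneous_1 algebra_simps dest: homogeneous_mult)

lemma homogeneous_word:
  "homogeneous (Poly_Mapping.single w c) (int k * word_degree GenA w + l * word_degree GenB w)"
proof -
  have letter: "homogeneous (letter g s) (int k * letter_degree GenA (g, s) + l * letter_degree GenB (g, s))" for g s
    using homogeneous_a homogeneous_b homogeneous_star[OF homogeneous_a] homogeneous_star[OF homogeneous_b]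
    by (cases g; cases s) (simp_all add: letter_degree_def free_star_letter)
  have "homogeneous (Poly_Mapping.single (Star_Word xs) 1)
      (int k * word_degree GenA (Star_Word xs) + l * word_degree GenB (Star_Word xs))" for xs
  proof (induction xs)
    case Nil
    have "Poly_Mapping.single (Star_Word []) 1 = (1 :: free_elem)"
      by (simp flip: zero_star_word_def)
    then show ?case using homogeneous_1 by (simp add: word_degree_def)
  next
    case (Cons x xs)
    obtain g s where x: "x = (g, s)" by fastforce
    have "Poly_Mapping.single (Star_Word (x # xs)) 1 = letter g s * Poly_Mapping.single (Star_Word xs) (1::complex)"
      by (simp add: letter_def mult_single plus_star_word_def x)
    with homogeneous_mult[OF letter[of g s] Cons] show ?case
      by (simp add: word_degree_def x algebra_simps)
  qed
  from homogeneous_scalar[OF this[of "letters w"]] show ?thesis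
    by (simp add: single_eq_scalar_mult[of w c])
qed

lemma homogeneous_A: "homogeneous A 0" and homogeneous_B: "homogeneous B 0"
  using homogeneous_mult[OF homogeneous_a homogeneous_star[OF homogeneous_a]]
    homogeneous_mult[OF homogeneous_b homogeneous_star[OF homogeneous_b]]
  by (simp_all add: free_star_letter homogeneous_diff homogeneous_1)

lemma homogeneous_C: "homogeneous (C k l) 0"
proof -
  have "homogeneous (b' ^ k) (- (int k * l))"
    using homogeneous_power[OF homogeneous_star[OF homogeneous_b], of k] by (simp add: free_star_letter)
  moreover have "homogeneous ((if l > 0 then a else a') ^ nat \<bar>l\<bar>) (int k * l)"
    using homogeneous_power[OF homogeneous_a, of "nat \<bar>l\<bar>"]
      homogeneous_power[OF homogeneous_star[OF homogeneous_a], of "nat \<bar>l\<bar>"] l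
    by (auto simp: free_star_letter mult.commute)
  ultimately show ?thesis using homogeneous_mult unfolding C_def by fastforce
qed

lemma carrier_R: "X \<in> carrier R \<longleftrightarrow> (\<exists>x. X = cl x \<and> homogeneous x 0)"
  by (auto simp: fixed_point_alg_def carrier_S homogeneous_def)

lemma cl_in_carrier_R: "cl x \<in> carrier R \<longleftrightarrow> homogeneous x 0"
  by (simp add: fixed_point_alg_def carrier_S homogeneous_def)

lemma R_simps [simp]:
  "mult R = mult S" "one R = one S" "add R = add S" "smult R = smult S" "star R = star S"
  by (simp_all add: fixed_point_alg_def)

lemma R_power: "X [^]\<^bsub>R\<^esub> (n::nat) = X [^]\<^bsub>S\<^esub> n"
  by (simp add: nat_pow_def)

lemma monoid_R: "Group.monoid R"
proof (rule monoidI)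
  show "X \<otimes>\<^bsub>R\<^esub> Y \<in> carrier R" if "X \<in> carrier R" "Y \<in> carrier R" for X Y
    using that homogeneous_mult[where m = 0 and n = 0] by (auto simp: carrier_R S_mult)
qed (use homogeneous_1 in \<open>auto simp: carrier_R S_mult S_one mult.assoc\<close>)

lemma star_closed_R: "X \<in> carrier R \<Longrightarrow> star R X \<in> carrier R"
  using homogeneous_star[where m = 0] by (auto simp: carrier_R S_star)

text \<open>The component of degree zero of \<open>\<rho>(x)\<close> is the class of a combination of words of degree zero;
  for a fixed point it is \<open>x\<close> itself.\<close>

lemma fixed_point_is_combination_of_degree_zero_words:
  assumes G: "\<And>x y. x \<in> G \<Longrightarrow> y \<in> G \<Longrightarrow> x + y \<in> G" "0 \<in> G"
    and words: "\<And>w c. int k * word_degree GenA w + l * word_degree GenB w = 0 \<Longrightarrow> Poly_Mapping.single w c \<in> G"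
    and X: "X \<in> carrier R"
  shows "X \<in> cl ` G"
proof -
  obtain x where x: "X = cl x" "homogeneous x 0" using X carrier_R by blast
  have "\<rho> (cl y) 0 \<in> cl ` G" for y
  proof (induction y rule: free_elem_induct)
    case (monomial w c)
    show ?case
      using homogeneous_word[of w c] words[of w c] G(2) by (auto simp: homogeneous_def tensor_u_def S_zero)
  next
    case (add y z)
    then show ?case using G(1) by (auto simp: rho_add S_add)
  qed
  from this[of x] show ?thesis using x by (simp add: homogeneous_def tensor_u_def)
qed

text \<open>The induction rule says that \<open>A\<close>, \<open>B\<close>, \<open>C\<close>, \<open>C\<^sup>*\<close> generate the fixed point algebra.  It combines the
  reduction to words of degree zero with their normal form, applied to the set \<open>G\<close> of all
  representatives of fixed points with the property.\<close>

lemma fixed_point_induct [consumes 1, case_names add mult scalar A B C star_C]: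
  assumes X: "X \<in> carrier R"
    and add: "\<And>X Y. X \<in> carrier R \<Longrightarrow> Y \<in> carrier R \<Longrightarrow> P X \<Longrightarrow> P Y \<Longrightarrow> P (X \<oplus>\<^bsub>R\<^esub> Y)"
    and mult: "\<And>X Y. X \<in> carrier R \<Longrightarrow> Y \<in> carrier R \<Longrightarrow> P X \<Longrightarrow> P Y \<Longrightarrow> P (X \<otimes>\<^bsub>R\<^esub> Y)"
    and scalar: "\<And>c. P (c \<odot>\<^bsub>R\<^esub> \<one>\<^bsub>R\<^esub>)"
    and gens: "P (cl A)" "P (cl B)" "P (cl (C k l))" "P (star R (cl (C k l)))"
  shows "P X"
proof -
  define G where "G = {x. cl x \<in> carrier R \<and> P (cl x)}"
  have G_add: "x + y \<in> G" if "x \<in> G" "y \<in> G" for x y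
    using that homogeneous_add[of x 0 y] add[of "cl x" "cl y"]
    by (simp add: G_def S_add cl_in_carrier_R)
  have G_mult: "x * y \<in> G" if "x \<in> G" "y \<in> G" for x y
    using that mult[of "cl x" "cl y"] monoid.m_closed[OF monoid_R, of "cl x" "cl y"]
    by (simp add: G_def S_mult)
  have G_scalar: "scalar c \<in> G" for c
    using scalar[of c] homogeneous_scalar[OF homogeneous_1, of c]
    by (simp add: G_def S_one S_smult cl_in_carrier_R)
  have G_cong: "y \<in> G" if "x \<in> G" "x \<sim>\<^sub>J y" for x y
    using that by (simp add: G_def cong_def cl_eq_iff[symmetric])
  have G_gens: "A \<in> G" "B \<in> G" "C k l \<in> G" "free_star (C k l) \<in> G"
    using gens homogeneous_A homogeneous_B homogeneous_C homogeneous_star[OF homogeneous_C]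
    by (simp_all add: G_def S_star cl_in_carrier_R)
  have "X \<in> cl ` G"
  proof (rule fixed_point_is_combination_of_degree_zero_words[OF _ _ _ X])
    show "0 \<in> G" using G_scalar[of 0] by (simp add: scalar_0)
    show "Poly_Mapping.single w c \<in> G"
      if "int k * word_degree GenA w + l * word_degree GenB w = 0" for w c
      by (rule degree_zero_word_generated[OF k l coprime that G_cong G_add G_mult G_scalar G_gens])
  qed (rule G_add)
  then show ?thesis by (auto simp: G_def)
qed

lemma S2_A_eq: "S2_A p q \<theta> = cl A"
  by (simp add: S2_A_def Let_def S3_a_eq S_star free_star_letter S_mult S_one S_minus)

lemma S2_B_eq: "S2_B p q \<theta> = cl B"
  by (simp add: S2_B_def Let_def S3_b_eq S_star free_star_letter S_mult S_one S_minus)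

lemma S2_C_eq: "S2_C p q \<theta> k l = cl (C k l)"
  unfolding S2_C_def Let_def S3_a_eq S3_b_eq S_star free_star_letter C_def
  by (cases "l > 0") (simp_all only: if_True if_False S_power S_mult not_False_eq_True)

lemma star_A: "star R (cl A) = cl A" and star_B: "star R (cl B) = cl B"
  by (simp_all add: S_star free_star_diff free_star_1 free_star_mult free_star_letter)

end

section \<open>Trace class differences and Chern characters\<close>

lemma op_trace_sequence:
  fixes e :: "nat \<Rightarrow> 'h::chilbert_space"
  assumes "inj e" "orthonormal_basis (range e)" "trace_class T"
    and "((\<lambda>n. cinner (e n) (T (e n))) has_sum s) UNIV"
  shows "op_trace T = s"
  using assms by (intro op_trace_eqI[OF assms(3,2)]) (simp add: has_sum_reindex o_def)

lemma op_trace_prod: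
  fixes e :: "nat \<Rightarrow> 'h::chilbert_space"
  assumes e: "inj e" "orthonormal_basis (range e)" and T: "trace_class T"
    and s: "((\<lambda>n. cinner (e n, 0) (T (e n, 0))) has_sum s) UNIV"
      "((\<lambda>n. cinner (0, e n) (T (0, e n))) has_sum s') UNIV"
  shows "op_trace T = s + s'"
proof (rule op_trace_eqI[OF T orthonormal_basis_prod[OF e(2,2)]])
  have "e n \<noteq> 0" for n using norm_orthonormal_basis[OF e(2), of "e n"] by auto
  then have "(\<lambda>x. (x, 0)) ` range e \<inter> (\<lambda>x. (0, x)) ` range e = {}" by auto
  moreover have "inj (\<lambda>n. (e n, 0::'h))" "inj (\<lambda>n. (0::'h, e n))"
    using e(1) by (auto simp: inj_def)
  ultimately show "((\<lambda>z. cinner z (T z)) has_sum (s + s')) ((\<lambda>x. (x, 0)) ` range e \<union> (\<lambda>y. (0, y)) ` range e)"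
    using s by (intro has_sum_Un_disjoint) (simp_all add: image_image has_sum_reindex o_def)
qed

text \<open>The subtracted \<open>0\<^sup>n\<close> is the diagonal of the \<open>n\<close>-th power of an operator that is zero; it matters only for
  \<open>n = 0\<close>, where it is the identity and cancels the constant term of the progression.\<close>

lemma has_sum_diagonal_difference:
  fixes p :: real
  assumes "0 < p" "p < 1" "0 < L"
  shows "((\<lambda>m. (if \<mu> = (0::int) then complex_of_real ((p ^ (m * L + s)) ^ n) else 0)
      - (if \<mu> = 0 then complex_of_real (0 ^ n) else 0)) has_sum
    (if \<mu> = 0 \<and> n \<noteq> 0 then complex_of_real (p ^ (n * s) / (1 - p ^ (n * L))) else 0)) UNIV"
  using has_sum_geometric_progression[OF assms, of n s]
  by (cases "\<mu> = 0 \<and> n \<noteq> 0") (auto simp: power_0_left)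

context weighted_sphere
begin

lemma star_algebra_R: "star_algebra R"
  using monoid_R star_closed_R by (simp add: star_algebra_def star_algebra_axioms_def)

lemmas generators_in_R = cl_in_carrier_R[THEN iffD2, OF homogeneous_A]
  cl_in_carrier_R[THEN iffD2, OF homogeneous_B] cl_in_carrier_R[THEN iffD2, OF homogeneous_C]

text \<open>Multiples of the unit have difference zero, and sums, products and adjoints preserve the property,
  so the generators decide.\<close>

lemma trace_class_difference:
  assumes rep: "star_rep R \<pi>" "star_rep R \<sigma>"
    and gens: "trace_class (\<lambda>v. \<pi> (cl A) v - \<sigma> (cl A) v)" "trace_class (\<lambda>v. \<pi> (cl B) v - \<sigma> (cl B) v)"
      "trace_class (\<lambda>v. \<pi> (cl (C k l)) v - \<sigma> (cl (C k l)) v)"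
    and X: "X \<in> carrier R"
  shows "trace_class (\<lambda>v. \<pi> X v - \<sigma> X v)"
  using X
proof (induction X rule: fixed_point_induct)
  case (add X Y)
  have "(\<lambda>v. \<pi> (X \<oplus>\<^bsub>R\<^esub> Y) v - \<sigma> (X \<oplus>\<^bsub>R\<^esub> Y) v) = (\<lambda>v. (\<pi> X v - \<sigma> X v) + (\<pi> Y v - \<sigma> Y v))"
    using add(1,2) unfolding star_repD(3)[OF rep(1) add(1,2)] star_repD(3)[OF rep(2) add(1,2)]
    by (simp add: algebra_simps)
  with trace_class_add[OF add(3,4)] show ?case by simp
next
  case (mult X Y)
  then show ?case using star_algebra.trace_class_difference_mult[OF star_algebra_R rep] by blast
next
  case (scalar c)
  have one: "\<one>\<^bsub>R\<^esub> \<in> carrier R" by (rule monoid.one_closed[OF monoid_R])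
  have "(\<lambda>v. \<pi> (c \<odot>\<^bsub>R\<^esub> \<one>\<^bsub>R\<^esub>) v - \<sigma> (c \<odot>\<^bsub>R\<^esub> \<one>\<^bsub>R\<^esub>) v) = (\<lambda>v. 0)"
    unfolding star_repD(5)[OF rep(1) one] star_repD(5)[OF rep(2) one] star_repD(2)[OF rep(1)] star_repD(2)[OF rep(2)]
    by simp
  then show ?case using trace_class_zero by simp
next
  case star_C
  show ?case
    by (rule star_algebra.trace_class_difference_star[OF star_algebra_R rep generators_in_R(3) gens(3)])
qed (rule gens)+

lemmas diagonal_entry = star_algebra.diagonal_entry_sharp_power[OF star_algebra_R]

lemma cinner_basis_Z:
  assumes "inj e" "orthonormal_basis (range e)"
  shows "cinner (basis_Z e i) (basis_Z e j) = (if i = j then 1 else 0)"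
  using orthonormal_basisD[OF assms(2)] assms(1)
  by (auto simp: basis_Z_def cinner_prod_def inj_eq)

lemma pi1_diagonal:
  assumes e: "inj e" "orthonormal_basis (range e)"
    and pi: "is_pi1 R (cl A) (cl B) (cl (C k l)) p l s e \<pi>"
  shows "cinner (e i) (\<pi> (cl A [^]\<^bsub>R\<^esub> (n::nat) \<otimes>\<^bsub>R\<^esub> sharp_power R (cl (C k l)) \<mu>) (e i))
      = (if \<mu> = 0 then complex_of_real ((p ^ (i * nat \<bar>l\<bar> + s)) ^ n) else 0)" (is ?A)
    and "cinner (e i) (\<pi> (cl B [^]\<^bsub>R\<^esub> (n::nat) \<otimes>\<^bsub>R\<^esub> sharp_power R (cl (C k l)) \<mu>) (e i))
      = (if \<mu> = 0 then complex_of_real (0 ^ n) else 0)" (is ?B)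
proof -
  have rep: "star_rep R \<pi>" using pi by (simp add: is_pi1_def)
  have ee: "cinner (e i) (e j) = (if i = j then 1 else 0)" for i j
    using orthonormal_basisD[OF e(2), of "e i" "e j"] e(1) by (simp add: inj_eq)
  have C: "\<pi> (cl (C k l)) (e i) = 0 \<or> (\<exists>r j. int j = int i + sgn l \<and> \<pi> (cl (C k l)) (e i) = r *\<^sub>R e j)" for i
  proof (cases "l > 0")
    case True
    with pi show ?thesis
      unfolding is_pi1_def
      by (intro disjI2 exI[of _ "\<Prod>j=1..nat l. sqrt (1 - p ^ (j + i * nat l + s))"] exI[of _ "i + 1"]) auto
  next
    case False
    with l have neg: "l < 0" by simp
    show ?thesis
    proof (cases i)
      case 0
      with pi neg show ?thesis by (simp add: is_pi1_def)
    next
      case (Suc j)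
      with pi neg show ?thesis
        unfolding is_pi1_def by (intro disjI2 exI[of _ "\<Prod>i=1..nat \<bar>l\<bar>. sqrt (1 - p ^ (i + j * nat \<bar>l\<bar> + s))"] exI[of _ j]) auto
    qed
  qed
  have "\<pi> (cl A) (e i) = p ^ (i * nat \<bar>l\<bar> + s) *\<^sub>R e i" "\<pi> (cl B) (e i) = 0 *\<^sub>R e i" for i
    using pi by (simp_all add: is_pi1_def)
  then show ?A ?B
    using diagonal_entry[OF rep generators_in_R(1) star_A generators_in_R(3) ee _ C, of "\<lambda>i. p ^ (i * nat \<bar>l\<bar> + s)" i n \<mu>]
      diagonal_entry[OF rep generators_in_R(2) star_B generators_in_R(3) ee _ C, of "\<lambda>i. 0" i n \<mu>] l
    by (simp_all add: sgn_eq_0_iff)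
qed

lemma pi2_diagonal:
  assumes e: "inj e" "orthonormal_basis (range e)"
    and pi: "is_pi2 R (cl A) (cl B) (cl (C k l)) q k t e \<pi>"
  shows "cinner (e i) (\<pi> (cl A [^]\<^bsub>R\<^esub> (n::nat) \<otimes>\<^bsub>R\<^esub> sharp_power R (cl (C k l)) \<mu>) (e i))
      = (if \<mu> = 0 then complex_of_real (0 ^ n) else 0)" (is ?A)
    and "cinner (e i) (\<pi> (cl B [^]\<^bsub>R\<^esub> (n::nat) \<otimes>\<^bsub>R\<^esub> sharp_power R (cl (C k l)) \<mu>) (e i))
      = (if \<mu> = 0 then complex_of_real ((q ^ (i * k + t)) ^ n) else 0)" (is ?B)
proof -
  have rep: "star_rep R \<pi>" using pi by (simp add: is_pi2_def)
  have ee: "cinner (e i) (e j) = (if i = j then 1 else 0)" for i j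
    using orthonormal_basisD[OF e(2), of "e i" "e j"] e(1) by (simp add: inj_eq)
  have C: "\<pi> (cl (C k l)) (e i) = 0 \<or> (\<exists>r j. int j = int i + - 1 \<and> \<pi> (cl (C k l)) (e i) = r *\<^sub>R e j)" for i
  proof (cases i)
    case 0
    with pi show ?thesis by (simp add: is_pi2_def)
  next
    case (Suc j)
    with pi show ?thesis
      unfolding is_pi2_def by (intro disjI2 exI[of _ "\<Prod>i=1..k. sqrt (1 - q ^ (i + j * k + t))"] exI[of _ j]) auto
  qed
  have "\<pi> (cl B) (e i) = q ^ (i * k + t) *\<^sub>R e i" "\<pi> (cl A) (e i) = 0 *\<^sub>R e i" for i
    using pi by (simp_all add: is_pi2_def)
  then show ?A ?B
    using diagonal_entry[OF rep generators_in_R(1) star_A generators_in_R(3) ee _ C, of "\<lambda>i. 0" i n \<mu>]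
      diagonal_entry[OF rep generators_in_R(2) star_B generators_in_R(3) ee _ C, of "\<lambda>i. q ^ (i * k + t)" i n \<mu>]
    by simp_all
qed

lemma pic_C:
  assumes "is_pic R (cl A) (cl B) (cl (C k l)) f \<pi>"
  shows "\<pi> (cl (C k l)) (f m) = f (m + 1)"
proof -
  have "\<pi> (cl (C k l) [^]\<^bsub>R\<^esub> (1::nat)) (f m) = f (m + int 1)"
    using assms unfolding is_pic_def by blast
  moreover have "cl (C k l) [^]\<^bsub>R\<^esub> (1::nat) = cl (C k l)"
    by (simp only: R_power S_power power_one_right)
  ultimately show ?thesis by simp
qed

lemma pic_diagonal:
  assumes e: "inj e" "orthonormal_basis (range e)"
    and pi: "is_pic R (cl A) (cl B) (cl (C k l)) (basis_Z e) \<pi>" and X: "X = A \<or> X = B"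
  shows "cinner (basis_Z e i) (\<pi> (cl X [^]\<^bsub>R\<^esub> (n::nat) \<otimes>\<^bsub>R\<^esub> sharp_power R (cl (C k l)) \<mu>) (basis_Z e i))
      = (if \<mu> = 0 then complex_of_real (0 ^ n) else 0)"
proof -
  have rep: "star_rep R \<pi>" using pi by (simp add: is_pic_def)
  have C: "\<pi> (cl (C k l)) (basis_Z e i) = 0
      \<or> (\<exists>r j. id j = id i + 1 \<and> \<pi> (cl (C k l)) (basis_Z e i) = r *\<^sub>R basis_Z e j)" for i
    unfolding pic_C[OF pi] by (intro disjI2 exI[of _ 1] exI[of _ "i + 1"]) simp
  have "\<pi> (cl X) (basis_Z e i) = 0 *\<^sub>R basis_Z e i" for i using pi X by (auto simp: is_pic_def)
  moreover have "cl X \<in> carrier R" "star R (cl X) = cl X"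
    using X generators_in_R star_A star_B by auto
  ultimately show ?thesis
    using diagonal_entry[OF rep _ _ generators_in_R(3) cinner_basis_Z[OF e] _ C, of "cl X" "\<lambda>i. 0" i n \<mu>]
    by simp
qed

text \<open>In the integer basis \<open>\<pi>\<^sub>1(C)\<close> is a weighted shift up on the indices \<open>m \<ge> 0\<close> and \<open>\<pi>\<^sub>2(C)\<close> a weighted
  shift up on \<open>m < 0\<close> that kills \<open>f\<^sub>-\<^sub>1\<close>; the bilateral shift \<open>\<pi>\<^sub>c(C)\<close> has all weights \<open>1\<close>.
  The weights of \<open>C\<close> tend to \<open>1\<close> exponentially fast, so the norms of the differences are summable.\<close>

lemma trace_class_difference_pos:
  assumes pq: "p < 1" "q < 1" and pos: "l > 0"
    and e: "inj e" "orthonormal_basis (range e)"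
    and pi1: "is_pi1 R (cl A) (cl B) (cl (C k l)) p l s e \<pi>1"
    and pi2: "is_pi2 R (cl A) (cl B) (cl (C k l)) q k t e \<pi>2"
    and pic: "is_pic R (cl A) (cl B) (cl (C k l)) (basis_Z e) \<pi>c"
    and X: "X \<in> carrier R"
  shows "trace_class (\<lambda>v. rep_sum \<pi>1 \<pi>2 X v - \<pi>c X v)"
proof -
  have rep1: "star_rep R \<pi>1" and rep2: "star_rep R \<pi>2" and repc: "star_rep R \<pi>c"
    using pi1 pi2 pic by (simp_all add: is_pi1_def is_pi2_def is_pic_def)
  have rep: "star_rep R (rep_sum \<pi>1 \<pi>2)" by (rule star_rep_rep_sum[OF rep1 rep2])
  have ne: "norm (e n) = 1" for n using norm_orthonormal_basis[OF e(2)] by blast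
  have zero: "\<pi>1 X 0 = 0" "\<pi>2 X 0 = 0" if "X \<in> carrier R" for X
    using star_repD(1)[OF rep1 that] star_repD(1)[OF rep2 that]
    by (simp_all add: bounded_clinear_def bounded_linear.linear linear_0)
  have bc: "bounded_clinear (\<lambda>v. rep_sum \<pi>1 \<pi>2 X v - \<pi>c X v)" if "X \<in> carrier R" for X
    using that by (intro bounded_clinear_diff star_repD(1)[OF rep] star_repD(1)[OF repc])
  have L: "0 < nat \<bar>l\<bar>" using pos by simp
  note col = trace_class_prod_of_summable_columns[OF e bc]
  show ?thesis
  proof (rule trace_class_difference[OF rep repc _ _ _ X])
    show "trace_class (\<lambda>v. rep_sum \<pi>1 \<pi>2 (cl A) v - \<pi>c (cl A) v)"
      using pi1 pi2 pic p summable_power_progression[OF p pq(1) L, of 0 s]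
      by (intro col generators_in_R)
         (simp_all add: rep_sum_def is_pi1_def is_pi2_def is_pic_def zero generators_in_R norm_Pair ne)
    show "trace_class (\<lambda>v. rep_sum \<pi>1 \<pi>2 (cl B) v - \<pi>c (cl B) v)"
      using pi1 pi2 pic q summable_power_progression[OF q pq(2) k, of 0 t]
      by (intro col generators_in_R)
         (simp_all add: rep_sum_def is_pi1_def is_pi2_def is_pic_def zero generators_in_R norm_Pair ne)
    show "trace_class (\<lambda>v. rep_sum \<pi>1 \<pi>2 (cl (C k l)) v - \<pi>c (cl (C k l)) v)"
    proof (intro col generators_in_R)
      let ?w = "\<lambda>n. \<Prod>i=1..nat \<bar>l\<bar>. sqrt (1 - p ^ (i + n * nat \<bar>l\<bar> + s))"
      have "norm (rep_sum \<pi>1 \<pi>2 (cl (C k l)) (e n, 0) - \<pi>c (cl (C k l)) (e n, 0)) = \<bar>1 - ?w n\<bar>" for n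
      proof -
        have "\<pi>c (cl (C k l)) (e n, 0) = (e (n + 1), 0)"
          using pic_C[OF pic, of "int n"] by (simp add: basis_Z_def nat_add_distrib)
        moreover have "\<pi>1 (cl (C k l)) (e n) = ?w n *\<^sub>R e (n + 1)"
          using pi1 pos by (simp add: is_pi1_def)
        ultimately have "rep_sum \<pi>1 \<pi>2 (cl (C k l)) (e n, 0) - \<pi>c (cl (C k l)) (e n, 0) = ((?w n - 1) *\<^sub>R e (n + 1), 0)"
          by (simp add: rep_sum_def zero generators_in_R scaleR_diff_left)
        then show ?thesis by (simp add: norm_Pair ne abs_minus_commute)
      qed
      then show "summable (\<lambda>n. norm (rep_sum \<pi>1 \<pi>2 (cl (C k l)) (e n, 0) - \<pi>c (cl (C k l)) (e n, 0)))"
        using summable_weight_defect[OF p pq(1) L, of s] by simp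
      let ?w' = "\<lambda>n. \<Prod>j=1..k. sqrt (1 - q ^ (j + n * k + t))"
      have "norm (rep_sum \<pi>1 \<pi>2 (cl (C k l)) (0, e (Suc n)) - \<pi>c (cl (C k l)) (0, e (Suc n))) = \<bar>1 - ?w' n\<bar>" for n
      proof -
        \<comment> \<open>\<open>(0, e (Suc n))\<close> is the basis vector with index \<open>- n - 2\<close>\<close>
        have "\<pi>c (cl (C k l)) (0, e (Suc n)) = (0, e n)"
          using pic_C[OF pic, of "- int n - 2"] by (simp add: basis_Z_def nat_add_distrib)
        moreover have "\<pi>2 (cl (C k l)) (e (Suc n)) = ?w' n *\<^sub>R e n"
          using pi2 by (simp add: is_pi2_def)
        ultimately have "rep_sum \<pi>1 \<pi>2 (cl (C k l)) (0, e (Suc n)) - \<pi>c (cl (C k l)) (0, e (Suc n)) = (0, (?w' n - 1) *\<^sub>R e n)"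
          by (simp add: rep_sum_def zero generators_in_R scaleR_diff_left)
        then show ?thesis by (simp add: norm_Pair ne abs_minus_commute)
      qed
      then show "summable (\<lambda>n. norm (rep_sum \<pi>1 \<pi>2 (cl (C k l)) (0, e n) - \<pi>c (cl (C k l)) (0, e n)))"
        using summable_weight_defect[OF q pq(2) k, of t] by (subst summable_Suc_iff[symmetric]) simp
    qed
  qed
qed

text \<open>For \<open>l < 0\<close> both representations send \<open>C\<close> to weighted backward shifts of the same basis, and both
  families of weights tend to \<open>1\<close> exponentially fast.\<close>

lemma trace_class_difference_neg:
  assumes pq: "p < 1" "q < 1" and neg: "l < 0"
    and e: "inj e" "orthonormal_basis (range e)"
    and pi1: "is_pi1 R (cl A) (cl B) (cl (C k l)) p l s e \<pi>1"
    and pi2: "is_pi2 R (cl A) (cl B) (cl (C k l)) q k t e \<pi>2"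
    and X: "X \<in> carrier R"
  shows "trace_class (\<lambda>v. \<pi>1 X v - \<pi>2 X v)"
proof -
  have rep1: "star_rep R \<pi>1" and rep2: "star_rep R \<pi>2"
    using pi1 pi2 by (simp_all add: is_pi1_def is_pi2_def)
  have ne: "norm (e n) = 1" for n using norm_orthonormal_basis[OF e(2)] by blast
  have bc: "bounded_clinear (\<lambda>v. \<pi>1 X v - \<pi>2 X v)" if "X \<in> carrier R" for X
    using that by (intro bounded_clinear_diff star_repD(1)[OF rep1] star_repD(1)[OF rep2])
  have L: "0 < nat \<bar>l\<bar>" using neg by simp
  note col = trace_class_of_summable_columns[OF e bc]
  show ?thesis
  proof (rule trace_class_difference[OF rep1 rep2 _ _ _ X])
    show "trace_class (\<lambda>v. \<pi>1 (cl A) v - \<pi>2 (cl A) v)"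
      using pi1 pi2 p summable_power_progression[OF p pq(1) L, of 0 s]
      by (intro col generators_in_R) (simp_all add: is_pi1_def is_pi2_def ne)
    show "trace_class (\<lambda>v. \<pi>1 (cl B) v - \<pi>2 (cl B) v)"
      using pi1 pi2 q summable_power_progression[OF q pq(2) k, of 0 t]
      by (intro col generators_in_R) (simp_all add: is_pi1_def is_pi2_def ne)
    show "trace_class (\<lambda>v. \<pi>1 (cl (C k l)) v - \<pi>2 (cl (C k l)) v)"
    proof (intro col generators_in_R)
      let ?w = "\<lambda>n. \<Prod>i=1..nat \<bar>l\<bar>. sqrt (1 - p ^ (i + n * nat \<bar>l\<bar> + s))"
      let ?w' = "\<lambda>n. \<Prod>j=1..k. sqrt (1 - q ^ (j + n * k + t))"
      have "\<pi>1 (cl (C k l)) (e (Suc n)) = ?w n *\<^sub>R e n" "\<pi>2 (cl (C k l)) (e (Suc n)) = ?w' n *\<^sub>R e n" for n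
        using pi1 pi2 neg by (simp_all add: is_pi1_def is_pi2_def)
      then have "norm (\<pi>1 (cl (C k l)) (e (Suc n)) - \<pi>2 (cl (C k l)) (e (Suc n))) = \<bar>?w n - ?w' n\<bar>" for n
        by (simp add: ne flip: scaleR_diff_left)
      moreover have "summable (\<lambda>n. \<bar>?w n - ?w' n\<bar>)"
      proof (rule summable_comparison_test')
        show "summable (\<lambda>n. \<bar>1 - ?w n\<bar> + \<bar>1 - ?w' n\<bar>)"
          by (intro summable_add summable_weight_defect p q k pq L)
        show "norm \<bar>?w n - ?w' n\<bar> \<le> \<bar>1 - ?w n\<bar> + \<bar>1 - ?w' n\<bar>" for n
          using abs_triangle_ineq4[of "1 - ?w' n" "1 - ?w n"] by (simp add: add.commute)
      qed
      ultimately show "summable (\<lambda>n. norm (\<pi>1 (cl (C k l)) (e n) - \<pi>2 (cl (C k l)) (e n)))"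
        by (subst summable_Suc_iff[symmetric]) simp
    qed
  qed
qed

lemma monomial_in_R:
  "X \<in> carrier R \<Longrightarrow> X [^]\<^bsub>R\<^esub> (n::nat) \<otimes>\<^bsub>R\<^esub> sharp_power R (cl (C k l)) \<mu> \<in> carrier R"
  using star_algebra.sharp_power_closed[OF star_algebra_R generators_in_R(3)]
  by (intro monoid.m_closed[OF monoid_R] monoid.nat_pow_closed[OF monoid_R])

text \<open>The trace is split along the two summands of the integer basis: powers of \<open>A\<close> contribute on the
  nonnegative indices only, powers of \<open>B\<close> on the negative ones only.\<close>

lemma chern_character_pos:
  assumes pq: "p < 1" "q < 1" and pos: "l > 0"
    and e: "inj e" "orthonormal_basis (range e)"
    and pi1: "is_pi1 R (cl A) (cl B) (cl (C k l)) p l s e \<pi>1"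
    and pi2: "is_pi2 R (cl A) (cl B) (cl (C k l)) q k t e \<pi>2"
    and pic: "is_pic R (cl A) (cl B) (cl (C k l)) (basis_Z e) \<pi>c"
  shows "chern_character (rep_sum \<pi>1 \<pi>2) \<pi>c (cl A [^]\<^bsub>R\<^esub> (n::nat) \<otimes>\<^bsub>R\<^esub> sharp_power R (cl (C k l)) \<mu>) =
      (if \<mu> = 0 \<and> n \<noteq> 0 then complex_of_real (p ^ (n * s) / (1 - p ^ (n * nat \<bar>l\<bar>))) else 0)" (is ?A)
    and "chern_character (rep_sum \<pi>1 \<pi>2) \<pi>c (cl B [^]\<^bsub>R\<^esub> (n::nat) \<otimes>\<^bsub>R\<^esub> sharp_power R (cl (C k l)) \<mu>) =
      (if \<mu> = 0 \<and> n \<noteq> 0 then complex_of_real (q ^ (n * t) / (1 - q ^ (n * k))) else 0)" (is ?B)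
proof -
  have L: "0 < nat \<bar>l\<bar>" using pos by simp
  note tr = op_trace_prod[OF e trace_class_difference_pos[OF pq pos e pi1 pi2 pic monomial_in_R]]
  have fst: "cinner (e i, 0) (rep_sum \<pi>1 \<pi>2 X (e i, 0) - \<pi>c X (e i, 0))
      = cinner (e i) (\<pi>1 X (e i)) - cinner (basis_Z e (int i)) (\<pi>c X (basis_Z e (int i)))" for i X
    by (simp add: cinner_diff_right cinner_prod_def rep_sum_def basis_Z_def)
  have snd: "cinner (0, e i) (rep_sum \<pi>1 \<pi>2 X (0, e i) - \<pi>c X (0, e i))
      = cinner (e i) (\<pi>2 X (e i)) - cinner (basis_Z e (- int i - 1)) (\<pi>c X (basis_Z e (- int i - 1)))" for i X
    by (simp add: cinner_diff_right cinner_prod_def rep_sum_def basis_Z_def)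
  note entries = fst snd pi1_diagonal[OF e pi1] pi2_diagonal[OF e pi2]
    pic_diagonal[OF e pic disjI1[OF refl]] pic_diagonal[OF e pic disjI2[OF refl]]
  have "chern_character (rep_sum \<pi>1 \<pi>2) \<pi>c (cl A [^]\<^bsub>R\<^esub> (n::nat) \<otimes>\<^bsub>R\<^esub> sharp_power R (cl (C k l)) \<mu>) =
      (if \<mu> = 0 \<and> n \<noteq> 0 then complex_of_real (p ^ (n * s) / (1 - p ^ (n * nat \<bar>l\<bar>))) else 0) + 0"
    unfolding chern_character_def
    by (rule tr[OF generators_in_R(1)])
       (simp_all only: entries has_sum_diagonal_difference[OF p pq(1) L] diff_self has_sum_0)
  then show ?A by simp
  have "chern_character (rep_sum \<pi>1 \<pi>2) \<pi>c (cl B [^]\<^bsub>R\<^esub> (n::nat) \<otimes>\<^bsub>R\<^esub> sharp_power R (cl (C k l)) \<mu>) =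
      0 + (if \<mu> = 0 \<and> n \<noteq> 0 then complex_of_real (q ^ (n * t) / (1 - q ^ (n * k))) else 0)"
    unfolding chern_character_def
    by (rule tr[OF generators_in_R(2)])
       (simp_all only: entries has_sum_diagonal_difference[OF q pq(2) k] diff_self has_sum_0)
  then show ?B by simp
qed

text \<open>Here \<open>B\<close> acts nontrivially only through the subtracted representation, whence the sign.\<close>

lemma chern_character_neg:
  assumes pq: "p < 1" "q < 1" and neg: "l < 0"
    and e: "inj e" "orthonormal_basis (range e)"
    and pi1: "is_pi1 R (cl A) (cl B) (cl (C k l)) p l s e \<pi>1"
    and pi2: "is_pi2 R (cl A) (cl B) (cl (C k l)) q k t e \<pi>2"
  shows "chern_character \<pi>1 \<pi>2 (cl A [^]\<^bsub>R\<^esub> (n::nat) \<otimes>\<^bsub>R\<^esub> sharp_power R (cl (C k l)) \<mu>) =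
      (if \<mu> = 0 \<and> n \<noteq> 0 then complex_of_real (p ^ (n * s) / (1 - p ^ (n * nat \<bar>l\<bar>))) else 0)"
    and "chern_character \<pi>1 \<pi>2 (cl B [^]\<^bsub>R\<^esub> (n::nat) \<otimes>\<^bsub>R\<^esub> sharp_power R (cl (C k l)) \<mu>) =
      - (if \<mu> = 0 \<and> n \<noteq> 0 then complex_of_real (q ^ (n * t) / (1 - q ^ (n * k))) else 0)"
proof -
  have L: "0 < nat \<bar>l\<bar>" using neg by simp
  note tr = op_trace_sequence[OF e trace_class_difference_neg[OF pq neg e pi1 pi2 monomial_in_R]]
  note entries = cinner_diff_right pi1_diagonal[OF e pi1] pi2_diagonal[OF e pi2]
  show "chern_character \<pi>1 \<pi>2 (cl A [^]\<^bsub>R\<^esub> (n::nat) \<otimes>\<^bsub>R\<^esub> sharp_power R (cl (C k l)) \<mu>) =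
      (if \<mu> = 0 \<and> n \<noteq> 0 then complex_of_real (p ^ (n * s) / (1 - p ^ (n * nat \<bar>l\<bar>))) else 0)"
    unfolding chern_character_def
    by (rule tr[OF generators_in_R(1)])
       (simp only: entries has_sum_diagonal_difference[OF p pq(1) L])
  have "((\<lambda>i. - ((if \<mu> = 0 then complex_of_real ((q ^ (i * k + t)) ^ n) else 0)
      - (if \<mu> = 0 then complex_of_real (0 ^ n) else 0))) has_sum
      - (if \<mu> = 0 \<and> n \<noteq> 0 then complex_of_real (q ^ (n * t) / (1 - q ^ (n * k))) else 0)) UNIV"
    by (subst has_sum_uminus) (simp only: minus_minus has_sum_diagonal_difference[OF q pq(2) k])
  then show "chern_character \<pi>1 \<pi>2 (cl B [^]\<^bsub>R\<^esub> (n::nat) \<otimes>\<^bsub>R\<^esub> sharp_power R (cl (C k l)) \<mu>) =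
      - (if \<mu> = 0 \<and> n \<noteq> 0 then complex_of_real (q ^ (n * t) / (1 - q ^ (n * k))) else 0)"
    unfolding chern_character_def minus_diff_eq
    by (intro tr[OF generators_in_R(2)]) (simp only: entries)
qed

end

theorem proposition4p1:
  fixes p q \<theta> :: real and k :: nat and l :: int and s t :: nat
    and e :: "nat \<Rightarrow> 'h::chilbert_space"
    and \<rho> :: "free_elem set \<Rightarrow> int \<Rightarrow> free_elem set"
  assumes "0 < p" "p < 1" "0 < q" "q < 1" "0 < \<theta>" "\<theta> < 1" "\<theta> \<notin> \<rat>"
    and "k > 0" "l \<noteq> 0" "coprime (int k) l"
    and "int s < \<bar>l\<bar>" "t < k"
    and "inj e" "orthonormal_basis (range e)"
    and "U1_coaction p q \<theta> k l \<rho>"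
  shows "let R = fixed_point_alg (S3 p q \<theta>) \<rho>;
             A = S2_A p q \<theta>; B = S2_B p q \<theta>; C = S2_C p q \<theta> k l
    in (l > 0 \<longrightarrow> (\<forall>\<pi>1 \<pi>2 \<pi>c.
          is_pi1 R A B C p l s e \<pi>1 \<and> is_pi2 R A B C q k t e \<pi>2 \<and>
          is_pic R A B C (basis_Z e) \<pi>c \<longrightarrow>
          even_fredholm_module R (rep_sum (rep_sum \<pi>1 \<pi>2) \<pi>c) flip_op grading_op \<and>
          one_summable R (rep_sum (rep_sum \<pi>1 \<pi>2) \<pi>c) flip_op \<and>
          (\<forall>(n::nat) (\<mu>::int).
            chern_character (rep_sum \<pi>1 \<pi>2) \<pi>c (A [^]\<^bsub>R\<^esub> n \<otimes>\<^bsub>R\<^esub> sharp_power R C \<mu>) =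
              (if \<mu> = 0 \<and> n \<noteq> 0 then p ^ (n * s) / (1 - p ^ (n * nat \<bar>l\<bar>)) else 0) \<and>
            chern_character (rep_sum \<pi>1 \<pi>2) \<pi>c (B [^]\<^bsub>R\<^esub> n \<otimes>\<^bsub>R\<^esub> sharp_power R C \<mu>) =
              (if \<mu> = 0 \<and> n \<noteq> 0 then q ^ (n * t) / (1 - q ^ (n * k)) else 0))))
     \<and> (l < 0 \<longrightarrow> (\<forall>\<pi>1 \<pi>2.
          is_pi1 R A B C p l s e \<pi>1 \<and> is_pi2 R A B C q k t e \<pi>2 \<longrightarrow>
          even_fredholm_module R (rep_sum \<pi>1 \<pi>2) flip_op grading_op \<and>
          one_summable R (rep_sum \<pi>1 \<pi>2) flip_op \<and>
          (\<forall>(n::nat) (\<mu>::int).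
            chern_character \<pi>1 \<pi>2 (A [^]\<^bsub>R\<^esub> n \<otimes>\<^bsub>R\<^esub> sharp_power R C \<mu>) =
              (if \<mu> = 0 \<and> n \<noteq> 0 then p ^ (n * s) / (1 - p ^ (n * nat \<bar>l\<bar>)) else 0) \<and>
            chern_character \<pi>1 \<pi>2 (B [^]\<^bsub>R\<^esub> n \<otimes>\<^bsub>R\<^esub> sharp_power R C \<mu>) =
              (if \<mu> = 0 \<and> n \<noteq> 0 then - (q ^ (n * t) / (1 - q ^ (n * k))) else 0))))"
proof -
  interpret weighted_sphere p q \<theta> k l \<rho>
    using assms by unfold_locales
  note e = \<open>inj e\<close> \<open>orthonormal_basis (range e)\<close> and pq = \<open>p < 1\<close> \<open>q < 1\<close>
  show ?thesis
    unfolding Let_def S2_A_eq S2_B_eq S2_C_eq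
  proof (intro conjI impI allI; elim conjE)
    fix \<pi>1 \<pi>2 \<pi>c
    assume pos: "l > 0"
      and pi1: "is_pi1 R (cl A) (cl B) (cl (C k l)) p l s e \<pi>1"
      and pi2: "is_pi2 R (cl A) (cl B) (cl (C k l)) q k t e \<pi>2"
      and pic: "is_pic R (cl A) (cl B) (cl (C k l)) (basis_Z e) \<pi>c"
    have rep: "star_rep R (rep_sum \<pi>1 \<pi>2)" "star_rep R \<pi>c"
      using pi1 pi2 pic by (simp_all add: is_pi1_def is_pi2_def is_pic_def star_rep_rep_sum)
    note D = trace_class_difference_pos[OF pq pos e pi1 pi2 pic]
    show "even_fredholm_module R (rep_sum (rep_sum \<pi>1 \<pi>2) \<pi>c) flip_op grading_op"
      by (rule fredholm_module_of_trace_class_difference(1)[OF rep D])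
    show "one_summable R (rep_sum (rep_sum \<pi>1 \<pi>2) \<pi>c) flip_op"
      by (rule fredholm_module_of_trace_class_difference(2)[OF rep D])
    fix n :: nat and \<mu> :: int
    show "chern_character (rep_sum \<pi>1 \<pi>2) \<pi>c (cl A [^]\<^bsub>R\<^esub> n \<otimes>\<^bsub>R\<^esub> sharp_power R (cl (C k l)) \<mu>) =
        (if \<mu> = 0 \<and> n \<noteq> 0 then p ^ (n * s) / (1 - p ^ (n * nat \<bar>l\<bar>)) else 0)"
      unfolding chern_character_pos(1)[OF pq pos e pi1 pi2 pic] by simp
    show "chern_character (rep_sum \<pi>1 \<pi>2) \<pi>c (cl B [^]\<^bsub>R\<^esub> n \<otimes>\<^bsub>R\<^esub> sharp_power R (cl (C k l)) \<mu>) =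
        (if \<mu> = 0 \<and> n \<noteq> 0 then q ^ (n * t) / (1 - q ^ (n * k)) else 0)"
      unfolding chern_character_pos(2)[OF pq pos e pi1 pi2 pic] by simp
  next
    fix \<pi>1 \<pi>2
    assume neg: "l < 0"
      and pi1: "is_pi1 R (cl A) (cl B) (cl (C k l)) p l s e \<pi>1"
      and pi2: "is_pi2 R (cl A) (cl B) (cl (C k l)) q k t e \<pi>2"
    have rep: "star_rep R \<pi>1" "star_rep R \<pi>2"
      using pi1 pi2 by (simp_all add: is_pi1_def is_pi2_def)
    note D = trace_class_difference_neg[OF pq neg e pi1 pi2]
    show "even_fredholm_module R (rep_sum \<pi>1 \<pi>2) flip_op grading_op"
      by (rule fredholm_module_of_trace_class_difference(1)[OF rep D])
    show "one_summable R (rep_sum \<pi>1 \<pi>2) flip_op"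
      by (rule fredholm_module_of_trace_class_difference(2)[OF rep D])
    fix n :: nat and \<mu> :: int
    show "chern_character \<pi>1 \<pi>2 (cl A [^]\<^bsub>R\<^esub> n \<otimes>\<^bsub>R\<^esub> sharp_power R (cl (C k l)) \<mu>) =
        (if \<mu> = 0 \<and> n \<noteq> 0 then p ^ (n * s) / (1 - p ^ (n * nat \<bar>l\<bar>)) else 0)"
      unfolding chern_character_neg(1)[OF pq neg e pi1 pi2] by simp
    show "chern_character \<pi>1 \<pi>2 (cl B [^]\<^bsub>R\<^esub> n \<otimes>\<^bsub>R\<^esub> sharp_power R (cl (C k l)) \<mu>) =
        (if \<mu> = 0 \<and> n \<noteq> 0 then - (q ^ (n * t) / (1 - q ^ (n * k))) else 0)"
      unfolding chern_character_neg(2)[OF pq neg e pi1 pi2] by simp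
  qed
qed

end
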